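(* Let $q\in\mathbb{C}$ be a fixed constant with $|q|\neq 1$. Let $$\mathscr{L}=\langle T_{\kappa_1,\kappa_2,\lambda_1,\lambda_2},\,T_{a_1,\lambda_1},\,T_{a_2,\lambda_1},\,T_{\kappa_1,\lambda_1},\,T_{\kappa_1,\lambda_2}\rangle$$ be the lattice of connection preserving deformations, generated by the five transformations of the variables $\left\{\begin{array}{ccc}\kappa_1&\kappa_2&a_1\\ \lambda_1&\lambda_2&a_2\end{array}:w,y,z\right\}$ defined in the context. Let $T_0,T_1,T_2,T_3$ be the translations (with $T_0\circ T_1\circ T_2=I$) of the extended affine Weyl group of type $(A_2+A_1)^{(1)}$ defined in the context. Then the five generators of $\mathscr{L}$ commute and form a basis of $\mathscr{L}$, so that $\mathscr{L}\cong\mathbb{Z}^5$. Furthermore $$T_{a_1,\lambda_1}^{-1}\circ T_{\kappa_1,\lambda_1}\circ T_{a_2,\lambda_1}^{-1}:\ \left\{\begin{array}{ccc}\kappa_1&\kappa_2&a_1\\ \lambda_1&\lambda_2&a_2\end{array}:w,y,z\right\}\to\left\{\begin{array}{ccc}\kappa_1&\kappa_2&a_1\\ \lambda_1&\lambda_2&a_2\end{array}:\frac{\kappa_2w}{\kappa_1},\frac{y}{q},z\right\},$$ which corresponds to the identity element in each of the six correspondences between connection preserving deformations and $T_0,\dots,T_3$ listed in the context. Hence $$\langle T_0,T_1,T_2,T_3\rangle\cong\mathscr{L}\,/\,\langle T_{\kappa_1,\kappa_2,\lambda_1,\lambda_2},\ T_{a_1,\lambda_1}^{-1}\circ T_{\kappa_1,\lambda_1}\circ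 T_{a_2,\lambda_1}^{-1}\rangle.$$
   Context: **Connection preserving deformations.** The variables satisfy $\kappa_1\kappa_2a_1a_2=\lambda_1\lambda_2$. They parameterize a $2\times2$ linear $q$-difference system $Y(qx)=A(x)Y(x)$ with $\det A(x)=\kappa_1\kappa_2x(x-a_1)(x-a_2)$, and the transformations are induced by $\tilde Y(x)=R(x)Y(x)$ with $R$ rational in $x$. Tildes denote images; variables not mentioned are unchanged. - $T_{\kappa_1,\kappa_2,\lambda_1,\lambda_2}$: $\kappa_i\to q\kappa_i$, $\lambda_i\to q\lambda_i$ ($i=1,2$), with $\tilde w=w$, $\tilde y=y$, $\tilde z=z$. - $T_{a_1,\lambda_1}$: $a_1\to qa_1$, $\lambda_1\to q\lambda_1$, with $\tilde w=w(1-\tilde z)$, $\tilde yy=\frac{\tilde z(\tilde za_2\kappa_2+q\lambda_1)}{q(\tilde z-1)\kappa_1}$, $\tilde zz=\frac{qy(y-a_1)\kappa_1}{(y-a_2)\kappa_2}$. - $T_{a_2,\lambda_1}$: $a_2\to qa_2$, $\lambda_1\to q\lambda_1$, obtained from $T_{a_1,\lambda_1}$ by conjugation with the symmetry $S_{a_1,a_2}$: $a_1\leftrightarrow a_2$, $z\to z\frac{y-a_2}{y-a_1}$ (with $w,y,\kappa_i,\lambda_i$ fixed). - $T_{\kappa_1,\lambda_1}$: $\kappa_1\to q\kappa_1$, $\lambda_1\to q\lambda_1$, with $\tilde w=\frac{w(\tilde z-1)(qy\kappa_1-z\kappa_2)}{z\kappa_1}$, $\tilde yy=\frac{z(\tilde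 za_2\kappa_2+q\lambda_1)}{q(\tilde z-1)\kappa_1}$, $\tilde z=\frac{qya_1\kappa_1+qz\lambda_1}{qy^2\kappa_1-yz\kappa_2}$. - $T_{\kappa_1,\lambda_2}$: $\kappa_1\to q\kappa_1$, $\lambda_2\to q\lambda_2$, with $\tilde w=-w(\tilde z-1)$, $y\tilde y=\frac{\tilde z(\tilde za_2\kappa_2+q\lambda_1)}{q(\tilde z-1)\kappa_1}$, $\tilde zz=-\frac{q\kappa_1(za_1a_2\kappa_2+(a_1-y)\lambda_1)}{\kappa_2(a_2(\kappa_2-qy\kappa_1)+\lambda_1)}$. **The translations of type $(A_2+A_1)^{(1)}$.** They act on variables $(b_0,b_1,b_2;f_0,f_1,f_2)$ with $b_0b_1b_2=\sqrt q$ and $f_0f_1f_2=qc^2$ (defining $c$). - $T_0$: $(b_0,b_1,b_2)\to(\sqrt q\,b_0,\,b_1/\sqrt q,\,b_2)$, with $\tilde f_0f_0=\frac{qc^2(b_1+f_1)}{f_1(b_1f_1+1)}$, $\tilde f_1f_1=\frac{qc^2(b_0\tilde f_0+\sqrt q)}{\tilde f_0(b_0+\sqrt q f_0)}$, and $\tilde f_2$ defined by $\tilde f_0\tilde f_1\tilde f_2=qc^2$. - $T_1=\sigma_0\circ T_0\circ\sigma_0^2$ and $T_2=\sigma_0^2\circ T_0\circ\sigma_0$, where $\sigma_0:(b_1,b_2,b_0;f_1,f_2,f_0)\to(b_0,b_1,b_2;f_0,f_1,f_2)$. - $T_3=\sigma_1\circ w_0$, which maps $c\to\sqrt q\,c$.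 Here $\sigma_1$ fixes the $b_i$ and sends $f_i\to1/f_i$. The map $w_0$ fixes the $b_i$ and sends $f_0\to\frac{b_0b_1(b_2b_0+b_2f_0+f_2f_0)}{f_2(b_0b_1+b_0f_1+f_0f_1)}$, $f_1\to\frac{b_1b_2(b_0b_1+b_0f_1+f_0f_1)}{f_0(b_1b_2+b_1f_2+f_1f_2)}$, $f_2\to\frac{b_2b_0(b_1b_2+b_1f_2+f_1f_2)}{f_1(b_2b_0+b_2f_0+f_2f_0)}$. **The six correspondences.** $(T_0,T_1,T_2)$ is matched with $(T_{a_1,\lambda_1}^{-1},T_{\kappa_1,\lambda_1},T_{a_2,\lambda_1}^{-1})$, with $(T_{\kappa_1,\lambda_1},T_{a_2,\lambda_1}^{-1},T_{a_1,\lambda_1}^{-1})$, or with $(T_{a_2,\lambda_1}^{-1},T_{a_1,\lambda_1}^{-1},T_{\kappa_1,\lambda_1})$. In each case $T_3$ is matched either with $T_{\kappa_1,\lambda_2}$ or with $T_{\kappa_1,\lambda_2}^{-1}$.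
   Formalization: Corrected misprints: T_{κ1,λ2} (images of w, y, z); T_0 (shift is b0/√q, √q b1; f̃0 replaces f0 in the denominator of f̃1); the composite also sends κ1→qκ1, a_i→a_i/q, λ1→λ1/q. Also q≠0 is assumed. As printed, the maps do not commute and T_0 is not invertible. *)

theory Defs
  imports
    Complex_Main
    "HOL-Library.Poly_Mapping"
    "HOL-Computational_Algebra.Fraction_Field"
    "HOL-Algebra.Coset"
    "HOL-Algebra.Generated_Groups"
    "HOL-Algebra.Elementary_Groups"
    "HOL-Algebra.Product_Groups"
begin

section \<open>Fields of rational functions and their automorphisms\<close>

text \<open>
  A transformation of the variables is an automorphism over \<open>\<complex>\<close> of the field of rational functions in
  those variables, given by substitution; \<open>T v\<close> is the image of \<open>v\<close>, written with a tilde on paper.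
\<close>

type_synonym 'v mpoly = "('v \<Rightarrow>\<^sub>0 nat) \<Rightarrow>\<^sub>0 complex"
type_synonym 'v ratfun = "'v mpoly fract"

definition cst :: "complex \<Rightarrow> 'v::linorder ratfun" where
  "cst c = Fract (Poly_Mapping.single 0 c) 1"

definition var :: "'v::linorder \<Rightarrow> 'v ratfun" where
  "var v = Fract (Poly_Mapping.single (Poly_Mapping.single v 1) 1) 1"

definition mpoly_eval :: "('v::linorder \<Rightarrow> 'v ratfun) \<Rightarrow> 'v mpoly \<Rightarrow> 'v ratfun" where
  "mpoly_eval \<sigma> p =
     (\<Sum>m\<in>Poly_Mapping.keys p. cst (Poly_Mapping.lookup p m) *
        (\<Prod>v\<in>Poly_Mapping.keys m. \<sigma> v ^ Poly_Mapping.lookup m v))"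

text \<open>
  The value does not depend on the representation \<open>a / b\<close>. If every representation of \<open>u\<close> has a
  denominator that becomes zero under \<open>\<sigma>\<close>, the value is unspecified; this does not occur for a
  \<open>subst \<sigma>\<close> in the group \<open>birat\<close> below, since an automorphism is injective.
\<close>

definition subst :: "('v::linorder \<Rightarrow> 'v ratfun) \<Rightarrow> 'v ratfun \<Rightarrow> 'v ratfun" where
  "subst \<sigma> u =
     (THE t. \<exists>a b. mpoly_eval \<sigma> b \<noteq> 0 \<and> u = Fract a b \<and> t = mpoly_eval \<sigma> a / mpoly_eval \<sigma> b)"

definition birat :: "('v::linorder ratfun \<Rightarrow> 'v ratfun) monoid" where
  "birat =
     \<lparr>carrier = {\<phi>. bij \<phi> \<and> (\<forall>u v. \<phi> (u + v) = \<phi> u + \<phi> v) \<and> (\<forall>u v. \<phi> (u * v) = \<phi> u * \<phi> v) \<and>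
                     (\<forall>c. \<phi> (cst c) = cst c)},
      monoid.mult = (\<circ>),
      one = id\<rparr>"

lemma group_birat: "group (birat :: ('v::linorder ratfun \<Rightarrow> 'v ratfun) monoid)"
proof (rule groupI)
  fix \<phi> :: "'v ratfun \<Rightarrow> 'v ratfun"
  assume "\<phi> \<in> carrier birat"
  then have \<phi>: "bij \<phi>" "\<And>u v. \<phi> (u + v) = \<phi> u + \<phi> v" "\<And>u v. \<phi> (u * v) = \<phi> u * \<phi> v"
      "\<And>c. \<phi> (cst c) = cst c"
    by (auto simp: birat_def)
  let ?\<psi> = "inv_into UNIV \<phi>"
  have s: "\<phi> (?\<psi> u) = u" and i: "?\<psi> (\<phi> u) = u" for u
    using \<phi>(1) by (auto simp: bij_is_surj surj_f_inv_f bij_is_inj inv_f_f)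
  have "?\<psi> (u + v) = ?\<psi> u + ?\<psi> v" "?\<psi> (u * v) = ?\<psi> u * ?\<psi> v" for u v
    by (metis s i \<phi>(2), metis s i \<phi>(3))
  moreover have "?\<psi> (cst c) = cst c" for c
    by (metis i \<phi>(4))
  ultimately have "?\<psi> \<in> carrier birat"
    using bij_imp_bij_inv[OF \<phi>(1)] by (simp add: birat_def)
  moreover have "?\<psi> \<otimes>\<^bsub>birat\<^esub> \<phi> = \<one>\<^bsub>birat\<^esub>"
    using i by (auto simp: birat_def)
  ultimately show "\<exists>\<psi>\<in>carrier birat. \<psi> \<otimes>\<^bsub>birat\<^esub> \<phi> = \<one>\<^bsub>birat\<^esub>"
    by blast
qed (auto simp: birat_def bij_comp comp_assoc)


section \<open>Connection preserving deformations\<close>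

text \<open>
  The constraint \<open>\<kappa>\<^sub>1 \<kappa>\<^sub>2 a\<^sub>1 a\<^sub>2 = \<lambda>\<^sub>1 \<lambda>\<^sub>2\<close> is solved for \<open>\<lambda>\<^sub>2\<close>, so the field of rational functions is generated
  by the eight remaining variables, and the image of \<open>\<lambda>\<^sub>2\<close> is determined by the other images.
\<close>

datatype dvar = Kappa1 | Kappa2 | A1 | A2 | Lambda1 | W | Y | Z

text \<open>Only a technical requirement: the order makes the polynomial ring an instance of \<open>idom\<close>.\<close>

instantiation dvar :: linorder
begin

definition dvar_index :: "dvar \<Rightarrow> nat" where
  "dvar_index v = (case v of Kappa1 \<Rightarrow> 0 | Kappa2 \<Rightarrow> 1 | A1 \<Rightarrow> 2 | A2 \<Rightarrow> 3 | Lambda1 \<Rightarrow> 4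
                     | W \<Rightarrow> 5 | Y \<Rightarrow> 6 | Z \<Rightarrow> 7)"

definition less_eq_dvar :: "dvar \<Rightarrow> dvar \<Rightarrow> bool" where
  "less_eq_dvar u v \<longleftrightarrow> dvar_index u \<le> dvar_index v"

definition less_dvar :: "dvar \<Rightarrow> dvar \<Rightarrow> bool" where
  "less_dvar u v \<longleftrightarrow> dvar_index u < dvar_index v"

instance
  by standard (auto simp: less_eq_dvar_def less_dvar_def dvar_index_def split: dvar.splits)

end

abbreviation ka1 :: "dvar ratfun" where "ka1 \<equiv> var Kappa1"
abbreviation ka2 :: "dvar ratfun" where "ka2 \<equiv> var Kappa2"
abbreviation aa1 :: "dvar ratfun" where "aa1 \<equiv> var A1"
abbreviation aa2 :: "dvar ratfun" where "aa2 \<equiv> var A2"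
abbreviation la1 :: "dvar ratfun" where "la1 \<equiv> var Lambda1"
abbreviation la2 :: "dvar ratfun" where "la2 \<equiv> ka1 * ka2 * aa1 * aa2 / la1"
abbreviation ww :: "dvar ratfun" where "ww \<equiv> var W"
abbreviation yy :: "dvar ratfun" where "yy \<equiv> var Y"
abbreviation zz :: "dvar ratfun" where "zz \<equiv> var Z"

definition T_ka1_ka2_la1_la2 :: "complex \<Rightarrow> dvar ratfun \<Rightarrow> dvar ratfun" where
  "T_ka1_ka2_la1_la2 q =
     subst (var(Kappa1 := cst q * ka1, Kappa2 := cst q * ka2, Lambda1 := cst q * la1))"

definition T_a1_la1 :: "complex \<Rightarrow> dvar ratfun \<Rightarrow> dvar ratfun" where
  "T_a1_la1 q =
     (let z' = cst q * yy * (yy - aa1) * ka1 / ((yy - aa2) * ka2) / zz;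
          y' = z' * (z' * aa2 * ka2 + cst q * la1) / (cst q * (z' - 1) * ka1) / yy
      in subst (var(A1 := cst q * aa1, Lambda1 := cst q * la1,
                    W := ww * (1 - z'), Y := y', Z := z')))"

definition S_a1_a2 :: "dvar ratfun \<Rightarrow> dvar ratfun" where
  "S_a1_a2 = subst (var(A1 := aa2, A2 := aa1, Z := zz * (yy - aa2) / (yy - aa1)))"

definition T_a2_la1 :: "complex \<Rightarrow> dvar ratfun \<Rightarrow> dvar ratfun" where
  "T_a2_la1 q = S_a1_a2 \<otimes>\<^bsub>birat\<^esub> T_a1_la1 q \<otimes>\<^bsub>birat\<^esub> inv\<^bsub>birat\<^esub> S_a1_a2"

definition T_ka1_la1 :: "complex \<Rightarrow> dvar ratfun \<Rightarrow> dvar ratfun" where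
  "T_ka1_la1 q =
     (let z' = (cst q * yy * aa1 * ka1 + cst q * zz * la1) / (cst q * yy\<^sup>2 * ka1 - yy * zz * ka2);
          y' = zz * (z' * aa2 * ka2 + cst q * la1) / (cst q * (z' - 1) * ka1) / yy
      in subst (var(Kappa1 := cst q * ka1, Lambda1 := cst q * la1,
                    W := ww * (z' - 1) * (cst q * yy * ka1 - zz * ka2) / (zz * ka1),
                    Y := y', Z := z')))"

text \<open>
  Here \<open>\<lambda>\<^sub>1\<close> is fixed and \<open>\<lambda>\<^sub>2\<close> goes to \<open>q \<lambda>\<^sub>2\<close>. The formulas come from \<open>A'(x) R(x) = R(q x) A(x)\<close>, where
    \<open>A\<^sub>1\<^sub>1 = \<kappa>\<^sub>1 ((x - \<alpha>) (x - y) + y (y - a\<^sub>1) / z)\<close>, \<open>A\<^sub>1\<^sub>2 = \<kappa>\<^sub>2 w (x - y)\<close>, \<open>A\<^sub>2\<^sub>2 = \<kappa>\<^sub>2 (x - y + (y - a\<^sub>2) z)\<close>,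
  \<open>det A = \<kappa>\<^sub>1 \<kappa>\<^sub>2 x (x - a\<^sub>1) (x - a\<^sub>2)\<close>, \<open>A(0)\<close> has eigenvalues \<open>\<lambda>\<^sub>1\<close> and \<open>0\<close>, and \<open>R(x)\<close> has determinant \<open>x\<close>
  and \<open>ker R(0) = ker A(0)\<close>, with \<open>R\<^sub>2\<^sub>1\<close> and \<open>R\<^sub>2\<^sub>2 = 1\<close> constant and \<open>R\<^sub>1\<^sub>1 - x\<close>, \<open>R\<^sub>1\<^sub>2\<close> constant.
  The choice \<open>ker R(0) = ker (A(0) - \<lambda>\<^sub>1)\<close> gives \<open>T_ka1_la1\<close> in the same way.
  The published formulas have \<open>\<kappa>\<^sub>2\<close> for \<open>z \<kappa>\<^sub>2\<close> in the denominator of \<open>z'\<close>,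
  \<open>z' a\<^sub>2 \<kappa>\<^sub>2 + q \<lambda>\<^sub>1\<close> for \<open>z a\<^sub>2 \<kappa>\<^sub>2 + \<lambda>\<^sub>1\<close> in \<open>y'\<close> and no second factor in the image of \<open>w\<close>; that map
  does not commute with \<open>T_a1_la1\<close>.
\<close>

definition T_ka1_la2 :: "complex \<Rightarrow> dvar ratfun \<Rightarrow> dvar ratfun" where
  "T_ka1_la2 q =
     (let d = aa2 * (zz * ka2 - cst q * yy * ka1) + la1;
          z' = - (cst q * ka1 * (zz * aa1 * aa2 * ka2 + (aa1 - yy) * la1) / (ka2 * d)) / zz;
          y' = z' * (zz * aa2 * ka2 + la1) / (cst q * (z' - 1) * ka1) / yy
      in subst (var(Kappa1 := cst q * ka1,
                    W := - ww * (z' - 1) * (ka2 * d / (ka1 * (zz * aa2 * ka2 + la1))),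
                    Y := y', Z := z')))"

definition deformation_lattice :: "complex \<Rightarrow> (dvar ratfun \<Rightarrow> dvar ratfun) monoid" where
  "deformation_lattice q =
     subgroup_generated birat
       {T_ka1_ka2_la1_la2 q, T_a1_la1 q, T_a2_la1 q, T_ka1_la1 q, T_ka1_la2 q}"

text \<open>
  Besides \<open>w\<close> and \<open>y\<close>, it moves \<open>\<kappa>\<^sub>1, a\<^sub>1, a\<^sub>2, \<lambda>\<^sub>1\<close> (to \<open>q \<kappa>\<^sub>1, a\<^sub>1 / q, a\<^sub>2 / q, \<lambda>\<^sub>1 / q\<close>): it is the scaling of \<open>x\<close>
  that takes \<open>y, a\<^sub>1, a\<^sub>2\<close> to \<open>y / q, a\<^sub>1 / q, a\<^sub>2 / q\<close>.
\<close>

definition T_scaling :: "complex \<Rightarrow> dvar ratfun \<Rightarrow> dvar ratfun" where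
  "T_scaling q = inv\<^bsub>birat\<^esub> (T_a1_la1 q) \<otimes>\<^bsub>birat\<^esub> T_ka1_la1 q \<otimes>\<^bsub>birat\<^esub> inv\<^bsub>birat\<^esub> (T_a2_la1 q)"


section \<open>Translations of type \<open>(A\<^sub>2 + A\<^sub>1)\<^sup>(\<^sup>1\<^sup>)\<close>\<close>

text \<open>
  The parameter \<open>r\<close> is a square root of \<open>q\<close>. The relation \<open>b\<^sub>0 b\<^sub>1 b\<^sub>2 = r\<close> is solved for \<open>b\<^sub>2\<close>, and
  \<open>q c\<^sup>2\<close>, the only form in which \<open>c\<close> occurs, is the product \<open>f\<^sub>0 f\<^sub>1 f\<^sub>2\<close>.
\<close>

datatype wvar = B0 | B1 | F0 | F1 | F2

instantiation wvar :: linorder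
begin

definition wvar_index :: "wvar \<Rightarrow> nat" where
  "wvar_index v = (case v of B0 \<Rightarrow> 0 | B1 \<Rightarrow> 1 | F0 \<Rightarrow> 2 | F1 \<Rightarrow> 3 | F2 \<Rightarrow> 4)"

definition less_eq_wvar :: "wvar \<Rightarrow> wvar \<Rightarrow> bool" where
  "less_eq_wvar u v \<longleftrightarrow> wvar_index u \<le> wvar_index v"

definition less_wvar :: "wvar \<Rightarrow> wvar \<Rightarrow> bool" where
  "less_wvar u v \<longleftrightarrow> wvar_index u < wvar_index v"

instance
  by standard (auto simp: less_eq_wvar_def less_wvar_def wvar_index_def split: wvar.splits)

end

abbreviation bb0 :: "wvar ratfun" where "bb0 \<equiv> var B0"
abbreviation bb1 :: "wvar ratfun" where "bb1 \<equiv> var B1"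
abbreviation bb2 :: "complex \<Rightarrow> wvar ratfun" where "bb2 r \<equiv> cst r / (bb0 * bb1)"
abbreviation ff0 :: "wvar ratfun" where "ff0 \<equiv> var F0"
abbreviation ff1 :: "wvar ratfun" where "ff1 \<equiv> var F1"
abbreviation ff2 :: "wvar ratfun" where "ff2 \<equiv> var F2"
abbreviation qc2 :: "wvar ratfun" where "qc2 \<equiv> ff0 * ff1 * ff2"

text \<open>
  The published version has the shift \<open>(b\<^sub>0, b\<^sub>1) \<mapsto> (r b\<^sub>0, b\<^sub>1 / r)\<close> and, in the image of \<open>f\<^sub>1\<close>, the
  denominator \<open>b\<^sub>0 + r f\<^sub>0\<close> where \<open>f\<^sub>0\<close> should be its image. If either is kept, \<open>T_0\<close> does not commute
  with its rotations \<open>T_1\<close>, \<open>T_2\<close> and \<open>T_0 \<circ> T_1 \<circ> T_2\<close> is not the identity.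
\<close>

definition T_0 :: "complex \<Rightarrow> wvar ratfun \<Rightarrow> wvar ratfun" where
  "T_0 r =
     (let f0' = qc2 * (bb1 + ff1) / (ff1 * (bb1 * ff1 + 1)) / ff0;
          f1' = qc2 * (bb0 * f0' + cst r) / (f0' * (bb0 + cst r * f0')) / ff1
      in subst (var(B0 := bb0 / cst r, B1 := cst r * bb1,
                    F0 := f0', F1 := f1', F2 := qc2 / (f0' * f1'))))"

definition sigma_0 :: "complex \<Rightarrow> wvar ratfun \<Rightarrow> wvar ratfun" where
  "sigma_0 r = subst (var(B1 := bb0, B0 := bb2 r, F1 := ff0, F2 := ff1, F0 := ff2))"

definition T_1 :: "complex \<Rightarrow> wvar ratfun \<Rightarrow> wvar ratfun" where
  "T_1 r = sigma_0 r \<otimes>\<^bsub>birat\<^esub> T_0 r \<otimes>\<^bsub>birat\<^esub> (sigma_0 r \<otimes>\<^bsub>birat\<^esub> sigma_0 r)"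

definition T_2 :: "complex \<Rightarrow> wvar ratfun \<Rightarrow> wvar ratfun" where
  "T_2 r = (sigma_0 r \<otimes>\<^bsub>birat\<^esub> sigma_0 r) \<otimes>\<^bsub>birat\<^esub> T_0 r \<otimes>\<^bsub>birat\<^esub> sigma_0 r"

definition sigma_1 :: "wvar ratfun \<Rightarrow> wvar ratfun" where
  "sigma_1 = subst (var(F0 := 1 / ff0, F1 := 1 / ff1, F2 := 1 / ff2))"

definition w_0 :: "complex \<Rightarrow> wvar ratfun \<Rightarrow> wvar ratfun" where
  "w_0 r =
     (let g0 = bb2 r * bb0 + bb2 r * ff0 + ff2 * ff0;
          g1 = bb0 * bb1 + bb0 * ff1 + ff0 * ff1;
          g2 = bb1 * bb2 r + bb1 * ff2 + ff1 * ff2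
      in subst (var(F0 := bb0 * bb1 * g0 / (ff2 * g1),
                    F1 := bb1 * bb2 r * g1 / (ff0 * g2),
                    F2 := bb2 r * bb0 * g2 / (ff1 * g0))))"

text \<open>It multiplies \<open>q c\<^sup>2\<close> by \<open>q\<close>.\<close>

definition T_3 :: "complex \<Rightarrow> wvar ratfun \<Rightarrow> wvar ratfun" where
  "T_3 r = sigma_1 \<otimes>\<^bsub>birat\<^esub> w_0 r"

definition translation_group :: "complex \<Rightarrow> (wvar ratfun \<Rightarrow> wvar ratfun) monoid" where
  "translation_group r = subgroup_generated birat {T_0 r, T_1 r, T_2 r, T_3 r}"


section \<open>The six correspondences\<close>

text \<open>An element \<open>((u\<^sub>0, u\<^sub>1, u\<^sub>2), u\<^sub>3)\<close> says that \<open>T_0, T_1, T_2, T_3\<close> are matched with \<open>u\<^sub>0, u\<^sub>1, u\<^sub>2, u\<^sub>3\<close>.\<close>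

definition correspondences ::
  "complex \<Rightarrow> (((dvar ratfun \<Rightarrow> dvar ratfun) \<times> (dvar ratfun \<Rightarrow> dvar ratfun) \<times>
     (dvar ratfun \<Rightarrow> dvar ratfun)) \<times> (dvar ratfun \<Rightarrow> dvar ratfun)) set" where
  "correspondences q =
     {(inv\<^bsub>birat\<^esub> (T_a1_la1 q), T_ka1_la1 q, inv\<^bsub>birat\<^esub> (T_a2_la1 q)),
      (T_ka1_la1 q, inv\<^bsub>birat\<^esub> (T_a2_la1 q), inv\<^bsub>birat\<^esub> (T_a1_la1 q)),
      (inv\<^bsub>birat\<^esub> (T_a2_la1 q), inv\<^bsub>birat\<^esub> (T_a1_la1 q), T_ka1_la1 q)}
     \<times> {T_ka1_la2 q, inv\<^bsub>birat\<^esub> (T_ka1_la2 q)}"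

end

(*
Two automorphisms of a field of rational functions agree if they agree on the variables, and a
substitution is an automorphism as soon as it has a formal inverse, so every claim is an identity of
rational functions. These identities are kept small by factoring the translations.

On the side of the deformations, let S exchange a_1 and a_2 and put X = T_{a_1,lambda_1}^{-1} S. Then
X^2 commutes with S, T_{a_2,lambda_1} = X^{-1} S, and T_{kappa_1,lambda_1} is X^{-2} followed by the
scaling of x; hence all translations commute once X, S, T_{kappa_1,lambda_2} and the two scalings
satisfy the obvious relations. On the other side, T_0 = s_1 s_2 sigma_0 with simple reflections
s_0, s_1, s_2 that are permuted by sigma_0, and commutativity follows from the braid relations.

Linear independence is read off from the action on the parameters, where a translation multiplies by
powers of q or sqrt q; neither is a root of unity because |q| is not 1.
*)

theory Submission
  imports Defs
begin

section \<open>Substitution of rational functions\<close>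

text \<open>\<open>subst\<close> is a partial operation: a denominator may vanish under a
  substitution. A formal inverse settles all nonvanishing questions at once, because a polynomial
  sent to 0 could not be sent back. Where a map is a product of maps already known to be
  automorphisms, no inverse has to be found and it suffices to compare values on the variables.

  Composites of the translations are too large to expand blindly. The images of the variables are,
  up to constants, products of integer powers of a few polynomials, and the images of these
  polynomials factor again. Each computation names the factors, proves one small polynomial identity
  per image, and then only cancels.

  The choice of \<open>X\<close> is dictated by commutativity: the translations of
  \<open>a_1\<close> and \<open>a_2\<close>, multiplied in the two orders, are
  \<open>S X^-2 S\<close> and \<open>X^-2\<close>, so they commute exactly when \<open>X^2\<close>
  commutes with \<open>S\<close>.

  The three matchings of \<open>T_0, T_1, T_2\<close> are cyclic shifts of a single one, so one
  statement about the quotient, applied to permuted translations, covers them all.\<close>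

definition mon_eval :: "('v::linorder \<Rightarrow> 'v ratfun) \<Rightarrow> ('v \<Rightarrow>\<^sub>0 nat) \<Rightarrow> 'v ratfun" where
  "mon_eval \<sigma> m = (\<Prod>v\<in>Poly_Mapping.keys m. \<sigma> v ^ Poly_Mapping.lookup m v)"

lemma cst_add: "cst (a + b) = cst a + cst b"
  and cst_mult: "cst (a * b) = cst a * cst b"
  and cst_0 [simp]: "cst 0 = 0"
  and cst_1 [simp]: "cst 1 = 1"
  by (simp_all add: cst_def single_add mult_single Zero_fract_def One_fract_def)

lemma cst_eq_iff [simp]: "cst a = cst b \<longleftrightarrow> a = b"
  by (auto simp: cst_def eq_fract dest: arg_cong[where f = "\<lambda>p. Poly_Mapping.lookup p 0"])

lemma cst_eq_0_iff [simp]: "cst a = 0 \<longleftrightarrow> a = 0"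
  using cst_eq_iff[of a 0] by simp

lemma cst_power: "cst (a ^ n) = cst a ^ n"
  by (induction n) (simp_all add: cst_mult)

text \<open>Products over the keys of different exponent vectors become comparable over a common
  finite set; the additional factors have exponent 0.\<close>

lemma mon_eval_superset:
  assumes "finite S" "Poly_Mapping.keys m \<subseteq> S"
  shows "mon_eval \<sigma> m = (\<Prod>v\<in>S. \<sigma> v ^ Poly_Mapping.lookup m v)"
  unfolding mon_eval_def
  by (rule prod.mono_neutral_left) (use assms in \<open>auto simp: in_keys_iff\<close>)

lemma mon_eval_add: "mon_eval \<sigma> (m + n) = mon_eval \<sigma> m * mon_eval \<sigma> n"
proof -
  let ?S = "Poly_Mapping.keys m \<union> Poly_Mapping.keys n"
  have "mon_eval \<sigma> k = (\<Prod>v\<in>?S. \<sigma> v ^ Poly_Mapping.lookup k v)" if "k \<in> {m, n, m + n}" for k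
    using that keys_add[of m n] by (intro mon_eval_superset) auto
  then show ?thesis
    by (simp add: lookup_add power_add prod.distrib)
qed

lemma mpoly_eval_superset:
  assumes "finite S" "Poly_Mapping.keys p \<subseteq> S"
  shows "mpoly_eval \<sigma> p = (\<Sum>m\<in>S. cst (Poly_Mapping.lookup p m) * mon_eval \<sigma> m)"
  unfolding mpoly_eval_def mon_eval_def
  by (rule sum.mono_neutral_left) (use assms in \<open>auto simp: in_keys_iff\<close>)

lemma mpoly_eval_single: "mpoly_eval \<sigma> (Poly_Mapping.single m c) = cst c * mon_eval \<sigma> m"
  by (simp add: mpoly_eval_def mon_eval_def)

lemma mpoly_eval_0 [simp]: "mpoly_eval \<sigma> 0 = 0"
  by (simp add: mpoly_eval_def)

lemma mpoly_eval_cst: "mpoly_eval \<sigma> (Poly_Mapping.single 0 c) = cst c"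
  by (simp add: mpoly_eval_single mon_eval_def)

lemma mpoly_eval_1 [simp]: "mpoly_eval \<sigma> 1 = 1"
  using mpoly_eval_cst[of \<sigma> 1] by simp

lemma mpoly_eval_var:
  "mpoly_eval \<sigma> (Poly_Mapping.single (Poly_Mapping.single v 1) 1) = \<sigma> v"
  by (simp add: mpoly_eval_single mon_eval_def)

lemma mpoly_eval_add: "mpoly_eval \<sigma> (p + p') = mpoly_eval \<sigma> p + mpoly_eval \<sigma> p'"
proof -
  let ?S = "Poly_Mapping.keys p \<union> Poly_Mapping.keys p'"
  have "mpoly_eval \<sigma> s = (\<Sum>m\<in>?S. cst (Poly_Mapping.lookup s m) * mon_eval \<sigma> m)"
    if "s \<in> {p, p', p + p'}" for s
    using that keys_add[of p p'] by (intro mpoly_eval_superset) auto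
  then show ?thesis
    by (simp add: lookup_add cst_add distrib_right sum.distrib)
qed

lemma mpoly_eval_sum: "mpoly_eval \<sigma> (sum f S) = (\<Sum>i\<in>S. mpoly_eval \<sigma> (f i))"
  by (induction S rule: infinite_finite_induct) (simp_all add: mpoly_eval_add)

lemma sum_single_keys:
  fixes p :: "'a \<Rightarrow>\<^sub>0 'b::comm_monoid_add"
  shows "(\<Sum>m\<in>Poly_Mapping.keys p. Poly_Mapping.single m (Poly_Mapping.lookup p m)) = p"
  by (rule poly_mapping_eqI)
    (auto simp: lookup_sum lookup_single when_def in_keys_iff)

lemma mpoly_eval_mult: "mpoly_eval \<sigma> (p * p') = mpoly_eval \<sigma> p * mpoly_eval \<sigma> p'"
proof -
  \<comment> \<open>Expanding into monomials reduces multiplicativity to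
    \<open>mon_eval_add\<close>. The double sum may list a monomial several times; additivity of the
    evaluation absorbs this.\<close>
  have "p * p' = (\<Sum>m\<in>Poly_Mapping.keys p. \<Sum>m'\<in>Poly_Mapping.keys p'.
      Poly_Mapping.single (m + m') (Poly_Mapping.lookup p m * Poly_Mapping.lookup p' m'))"
    (is "_ = ?s")
    by (subst (1) sum_single_keys[of p, symmetric], subst (1) sum_single_keys[of p', symmetric])
      (simp add: sum_product mult_single)
  then have "mpoly_eval \<sigma> (p * p') = mpoly_eval \<sigma> ?s"
    by simp
  also have "\<dots> = mpoly_eval \<sigma> p * mpoly_eval \<sigma> p'"
    by (simp add: mpoly_eval_sum mpoly_eval_single mon_eval_add cst_mult sum_product
        mpoly_eval_def[of \<sigma> p] mpoly_eval_def[of \<sigma> p'] mult_ac flip: mon_eval_def)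
  finally show ?thesis .
qed

lemma Fract_add: "Fract (a + b) 1 = Fract a 1 + Fract b 1"
  and Fract_mult: "Fract (a * b) 1 = Fract a 1 * Fract b 1"
  by simp_all

lemma Fract_eq_0_iff: "Fract p 1 = 0 \<longleftrightarrow> p = 0"
  by (simp add: Zero_fract_def eq_fract)

lemma Fract_sum: "Fract (sum f S) 1 = (\<Sum>i\<in>S. Fract (f i) 1)"
  by (induction S rule: infinite_finite_induct)
    (simp_all add: Zero_fract_def Fract_add del: add_fract)

lemma Fract_prod: "Fract (prod f S) 1 = (\<Prod>i\<in>S. Fract (f i) 1)"
  by (induction S rule: infinite_finite_induct)
    (simp_all add: One_fract_def Fract_mult del: mult_fract)

text \<open>Evaluation at \<open>var\<close> embeds the polynomials, so every element of the field
  is a quotient of two such evaluations; this is how an automorphism is recovered from its values on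
  the variables.\<close>

lemma mpoly_eval_id: "mpoly_eval var p = Fract p 1"
proof -
  have pow: "Poly_Mapping.single (Poly_Mapping.single v (Suc 0)) (1::complex) ^ n
      = Poly_Mapping.single (Poly_Mapping.single v n) 1" for v :: 'a and n :: nat
    by (induction n) (simp_all add: mult_single flip: single_add)
  have prod: "(\<Prod>v\<in>S. Poly_Mapping.single (f v) (1::complex)) = Poly_Mapping.single (sum f S) 1"
    for f :: "'a \<Rightarrow> 'a \<Rightarrow>\<^sub>0 nat" and S
    by (induction S rule: infinite_finite_induct) (simp_all add: mult_single)
  have power: "Fract (a ^ n) 1 = Fract a 1 ^ n" for a :: "'a mpoly" and n
    by (induction n) (simp_all add: One_fract_def Fract_mult del: mult_fract)
  have mon: "mon_eval var m = Fract (Poly_Mapping.single m 1) 1" for m :: "'a \<Rightarrow>\<^sub>0 nat"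
    by (simp add: mon_eval_def var_def pow prod sum_single_keys flip: power Fract_prod)
  have "mpoly_eval var p = (\<Sum>m\<in>Poly_Mapping.keys p. cst (Poly_Mapping.lookup p m) * mon_eval var m)"
    by (simp add: mpoly_eval_def mon_eval_def)
  also have "\<dots> = Fract (\<Sum>m\<in>Poly_Mapping.keys p. Poly_Mapping.single m (Poly_Mapping.lookup p m)) 1"
    by (simp add: Fract_sum mon cst_def mult_single)
  finally show ?thesis
    by (simp add: sum_single_keys)
qed

text \<open>
  \<open>substitutes \<sigma> u t\<close>: some representation of \<open>u\<close> has a denominator that does not vanish under
  \<open>\<sigma>\<close>, and the substitution takes \<open>u\<close> to \<open>t\<close>. The arguments \<open>u\<close> for which there is such a \<open>t\<close>
  form a local ring, on which the substitution is a homomorphism.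
\<close>

definition substitutes ::
  "('v::linorder \<Rightarrow> 'v ratfun) \<Rightarrow> 'v ratfun \<Rightarrow> 'v ratfun \<Rightarrow> bool" where
  "substitutes \<sigma> u t \<longleftrightarrow>
     (\<exists>a b. mpoly_eval \<sigma> b \<noteq> 0 \<and> u = Fract a b \<and> t = mpoly_eval \<sigma> a / mpoly_eval \<sigma> b)"

lemma substitutesE:
  assumes "substitutes \<sigma> u t"
  obtains a b where "b \<noteq> 0" "mpoly_eval \<sigma> b \<noteq> 0" "u = Fract a b"
    "t = mpoly_eval \<sigma> a / mpoly_eval \<sigma> b"
  using assms by (metis substitutes_def mpoly_eval_0)

text \<open>Cross-multiplying two representations gives an identity of polynomials, which evaluation
  preserves. This justifies the definite description in \<open>subst\<close>.\<close>

lemma substitutes_unique: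
  assumes "substitutes \<sigma> u t" "substitutes \<sigma> u t'"
  shows "t = t'"
proof -
  from assms(1) obtain a b where ab: "b \<noteq> 0" "mpoly_eval \<sigma> b \<noteq> 0" "u = Fract a b"
    "t = mpoly_eval \<sigma> a / mpoly_eval \<sigma> b" by (rule substitutesE)
  from assms(2) obtain a' b' where ab': "b' \<noteq> 0" "mpoly_eval \<sigma> b' \<noteq> 0" "u = Fract a' b'"
    "t' = mpoly_eval \<sigma> a' / mpoly_eval \<sigma> b'" by (rule substitutesE)
  have "a * b' = a' * b"
    using ab ab' by (simp add: eq_fract)
  then have "mpoly_eval \<sigma> a * mpoly_eval \<sigma> b' = mpoly_eval \<sigma> a' * mpoly_eval \<sigma> b"
    by (metis mpoly_eval_mult)
  then show ?thesis
    using ab ab' by (simp add: frac_eq_eq)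
qed

lemma subst_eqI: "substitutes \<sigma> u t \<Longrightarrow> subst \<sigma> u = t"
  unfolding subst_def
  by (rule the_equality) (auto simp: substitutes_def[symmetric] intro: substitutes_unique)

lemma substitutes_Fract_1: "substitutes \<sigma> (Fract p 1) (mpoly_eval \<sigma> p)"
  unfolding substitutes_def by (rule exI[of _ p], rule exI[of _ 1]) simp

lemma substitutes_cst: "substitutes \<sigma> (cst c) (cst c)"
  using substitutes_Fract_1[of \<sigma> "Poly_Mapping.single 0 c"]
  by (simp add: mpoly_eval_cst cst_def)

lemma substitutes_0: "substitutes \<sigma> 0 0"
  using substitutes_cst[of \<sigma> 0] by simp

lemma substitutes_1: "substitutes \<sigma> 1 1"
  using substitutes_cst[of \<sigma> 1] by simp

lemma substitutes_var: "\<sigma> v = t \<Longrightarrow> substitutes \<sigma> (var v) t"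
  using substitutes_Fract_1[of \<sigma> "Poly_Mapping.single (Poly_Mapping.single v 1) 1"] mpoly_eval_var[of \<sigma> v]
  by (simp add: var_def)

lemma substitutes_add:
  assumes "substitutes \<sigma> u t" "substitutes \<sigma> u' t'"
  shows "substitutes \<sigma> (u + u') (t + t')"
proof -
  from assms(1) obtain a b where ab: "b \<noteq> 0" "mpoly_eval \<sigma> b \<noteq> 0" "u = Fract a b"
    "t = mpoly_eval \<sigma> a / mpoly_eval \<sigma> b" by (rule substitutesE)
  from assms(2) obtain a' b' where ab': "b' \<noteq> 0" "mpoly_eval \<sigma> b' \<noteq> 0" "u' = Fract a' b'"
    "t' = mpoly_eval \<sigma> a' / mpoly_eval \<sigma> b'" by (rule substitutesE)
  show ?thesis
    unfolding substitutes_def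
    by (rule exI[of _ "a * b' + a' * b"], rule exI[of _ "b * b'"])
      (use ab ab' in \<open>simp add: mpoly_eval_add mpoly_eval_mult add_frac_eq\<close>)
qed

lemma substitutes_mult:
  assumes "substitutes \<sigma> u t" "substitutes \<sigma> u' t'"
  shows "substitutes \<sigma> (u * u') (t * t')"
proof -
  from assms(1) obtain a b where ab: "b \<noteq> 0" "mpoly_eval \<sigma> b \<noteq> 0" "u = Fract a b"
    "t = mpoly_eval \<sigma> a / mpoly_eval \<sigma> b" by (rule substitutesE)
  from assms(2) obtain a' b' where ab': "b' \<noteq> 0" "mpoly_eval \<sigma> b' \<noteq> 0" "u' = Fract a' b'"
    "t' = mpoly_eval \<sigma> a' / mpoly_eval \<sigma> b'" by (rule substitutesE)
  show ?thesis
    unfolding substitutes_def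
    by (rule exI[of _ "a * a'"], rule exI[of _ "b * b'"])
      (use ab ab' in \<open>simp add: mpoly_eval_mult\<close>)
qed

lemma substitutes_uminus:
  assumes "substitutes \<sigma> u t"
  shows "substitutes \<sigma> (- u) (- t)"
proof -
  have "cst (- 1) = (- 1 :: 'a ratfun)"
    using cst_add[of "- 1" 1] by (simp add: eq_neg_iff_add_eq_0)
  then show ?thesis
    using substitutes_mult[OF substitutes_cst[of \<sigma> "- 1"] assms] by simp
qed

lemma substitutes_diff:
  "substitutes \<sigma> u t \<Longrightarrow> substitutes \<sigma> u' t' \<Longrightarrow> substitutes \<sigma> (u - u') (t - t')"
  using substitutes_add[OF _ substitutes_uminus] by fastforce

lemma substitutes_inverse:
  assumes "substitutes \<sigma> u t" "t \<noteq> 0"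
  shows "substitutes \<sigma> (inverse u) (inverse t)"
proof -
  from assms(1) obtain a b where ab: "b \<noteq> 0" "mpoly_eval \<sigma> b \<noteq> 0" "u = Fract a b"
    "t = mpoly_eval \<sigma> a / mpoly_eval \<sigma> b" by (rule substitutesE)
  then show ?thesis
    using assms(2) unfolding substitutes_def
    by (intro exI[of _ b] exI[of _ a]) auto
qed

lemma substitutes_divide:
  "substitutes \<sigma> u t \<Longrightarrow> substitutes \<sigma> u' t' \<Longrightarrow> t' \<noteq> 0 \<Longrightarrow> substitutes \<sigma> (u / u') (t / t')"
  using substitutes_mult[OF _ substitutes_inverse] by (fastforce simp: divide_inverse)

lemma substitutes_power: "substitutes \<sigma> u t \<Longrightarrow> substitutes \<sigma> (u ^ n) (t ^ n)"
  by (induction n) (auto intro: substitutes_1 substitutes_mult)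

lemmas substitutes_intros =
  substitutes_cst substitutes_0 substitutes_1 substitutes_var substitutes_add substitutes_mult
  substitutes_uminus substitutes_diff substitutes_divide substitutes_power

lemma substitutes_nonzero: "substitutes \<sigma> u t \<Longrightarrow> t \<noteq> 0 \<Longrightarrow> u \<noteq> 0"
  using substitutes_0 substitutes_unique by blast

lemma substitutes_sum:
  "(\<And>i. i \<in> S \<Longrightarrow> substitutes \<sigma> (f i) (g i)) \<Longrightarrow> substitutes \<sigma> (sum f S) (sum g S)"
  by (induction S rule: infinite_finite_induct) (auto intro: substitutes_0 substitutes_add)

lemma substitutes_prod:
  "(\<And>i. i \<in> S \<Longrightarrow> substitutes \<sigma> (f i) (g i)) \<Longrightarrow> substitutes \<sigma> (prod f S) (prod g S)"
  by (induction S rule: infinite_finite_induct) (auto intro: substitutes_1 substitutes_mult)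

lemma substitutes_mpoly_eval:
  assumes "\<And>v. substitutes \<tau> (\<sigma> v) (\<rho> v)"
  shows "substitutes \<tau> (mpoly_eval \<sigma> p) (mpoly_eval \<rho> p)"
  unfolding mpoly_eval_def using assms
  by (intro substitutes_sum substitutes_mult substitutes_cst substitutes_prod substitutes_power)

lemma mpoly_eval_nonzero:
  assumes "\<And>v. substitutes \<tau> (\<sigma> v) (var v)" "p \<noteq> 0"
  shows "mpoly_eval \<sigma> p \<noteq> 0"
proof (rule substitutes_nonzero)
  show "substitutes \<tau> (mpoly_eval \<sigma> p) (Fract p 1)"
    using substitutes_mpoly_eval[of \<tau> \<sigma> var, OF assms(1)] by (simp add: mpoly_eval_id)
  show "Fract p 1 \<noteq> 0"
    using assms(2) by (simp add: Fract_eq_0_iff)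
qed

text \<open>With a left inverse \<open>\<tau>\<close> no nonzero denominator vanishes under
  \<open>\<sigma>\<close>, so the local ring on which the substitution is defined is the whole
  field.\<close>

lemma substitutes_subst:
  assumes "\<And>v. substitutes \<tau> (\<sigma> v) (var v)"
  shows "substitutes \<sigma> u (subst \<sigma> u)"
proof -
  obtain a b where "u = Fract a b" "b \<noteq> 0"
    by (cases u)
  then have "substitutes \<sigma> u (mpoly_eval \<sigma> a / mpoly_eval \<sigma> b)"
    using mpoly_eval_nonzero[OF assms] unfolding substitutes_def by blast
  then show ?thesis
    by (simp add: subst_eqI)
qed

lemma subst_subst:
  assumes \<tau>: "\<And>v. substitutes \<tau> (\<sigma> v) (var v)" and \<sigma>: "\<And>v. substitutes \<sigma> (\<tau> v) (var v)"
  shows "subst \<tau> (subst \<sigma> u) = u"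
proof (rule subst_eqI)
  obtain a b where u: "u = Fract a b" "b \<noteq> 0"
    by (cases u)
  have nz: "mpoly_eval \<sigma> b \<noteq> 0"
    using mpoly_eval_nonzero[OF \<tau>] u by blast
  then have "subst \<sigma> u = mpoly_eval \<sigma> a / mpoly_eval \<sigma> b"
    using u by (intro subst_eqI) (auto simp: substitutes_def)
  moreover have "substitutes \<tau> (mpoly_eval \<sigma> a / mpoly_eval \<sigma> b) (Fract a 1 / Fract b 1)"
    using substitutes_mpoly_eval[of \<tau> \<sigma> var, OF \<tau>] u
    by (intro substitutes_divide) (auto simp: mpoly_eval_id Fract_eq_0_iff)
  ultimately show "substitutes \<tau> (subst \<sigma> u) u"
    using u by simp
qed

text \<open>
  It is not assumed that \<open>\<sigma>\<close> and \<open>\<tau>\<close> are injective on polynomials: if \<open>\<sigma>\<close> took \<open>p \<noteq> 0\<close> to \<open>0\<close>,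
  then \<open>\<tau>\<close> would take \<open>0\<close> back to \<open>p\<close>.
\<close>

theorem subst_in_birat:
  assumes "\<And>v. substitutes \<tau> (\<sigma> v) (var v)" and "\<And>v. substitutes \<sigma> (\<tau> v) (var v)"
  shows "subst \<sigma> \<in> carrier birat"
proof -
  note S = substitutes_subst[OF assms(1)]
  have "bij (subst \<sigma>)"
    by (rule o_bij[of "subst \<tau>"]) (auto simp: subst_subst[OF assms] subst_subst[OF assms(2,1)])
  then show ?thesis
    by (auto simp: birat_def intro!: subst_eqI substitutes_intros S)
qed

lemma subst_var: "subst \<sigma> (var v) = \<sigma> v"
  by (intro subst_eqI substitutes_var) simp

text \<open>Certifies that an expression is nonzero by its value at a point with at most four
  coordinates equal to 1 and all others 0; the four variables may coincide.\<close>

lemma nonzero_at: "substitutes ((\<lambda>_. 0)(v1 := 1, v2 := 1, v3 := 1, v4 := 1)) u t \<Longrightarrow> t \<noteq> 0 \<Longrightarrow> u \<noteq> 0"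
  by (rule substitutes_nonzero)

lemma var_neq_0 [simp]: "var v \<noteq> 0"
  by (rule nonzero_at[of v v v v], rule substitutes_var[OF refl]) simp

text \<open>Splits \<open>substitutes\<close> into a domain condition and an equation.
  \<open>substitutes\<close> needs the value in advance, whereas these two can serve as rewrite
  rules that compute it.\<close>

definition regular :: "('v::linorder \<Rightarrow> 'v ratfun) \<Rightarrow> 'v ratfun \<Rightarrow> bool" where
  "regular \<sigma> u \<longleftrightarrow> (\<exists>t. substitutes \<sigma> u t)"

lemma substitutes_iff: "substitutes \<sigma> u t \<longleftrightarrow> regular \<sigma> u \<and> subst \<sigma> u = t"
  unfolding regular_def by (metis subst_eqI)

lemma regular_subst:
  "regular \<sigma> (cst c) \<and> subst \<sigma> (cst c) = cst c"
  "regular \<sigma> 1 \<and> subst \<sigma> 1 = 1"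
  "regular \<sigma> (var x) \<and> subst \<sigma> (var x) = \<sigma> x"
  "regular \<sigma> u \<Longrightarrow> regular \<sigma> v \<Longrightarrow> regular \<sigma> (u + v) \<and> subst \<sigma> (u + v) = subst \<sigma> u + subst \<sigma> v"
  "regular \<sigma> u \<Longrightarrow> regular \<sigma> v \<Longrightarrow> regular \<sigma> (u - v) \<and> subst \<sigma> (u - v) = subst \<sigma> u - subst \<sigma> v"
  "regular \<sigma> u \<Longrightarrow> regular \<sigma> v \<Longrightarrow> regular \<sigma> (u * v) \<and> subst \<sigma> (u * v) = subst \<sigma> u * subst \<sigma> v"
  "regular \<sigma> u \<Longrightarrow> regular \<sigma> (- u) \<and> subst \<sigma> (- u) = - subst \<sigma> u"
  "regular \<sigma> u \<Longrightarrow> regular \<sigma> v \<Longrightarrow> subst \<sigma> v \<noteq> 0 \<Longrightarrow>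
     regular \<sigma> (u / v) \<and> subst \<sigma> (u / v) = subst \<sigma> u / subst \<sigma> v"
proof -
  have D: "substitutes \<sigma> x (subst \<sigma> x)" if "regular \<sigma> x" for x
    using that by (simp add: substitutes_iff)
  note iff = substitutes_iff[symmetric]
  show "regular \<sigma> (cst c) \<and> subst \<sigma> (cst c) = cst c"
    "regular \<sigma> 1 \<and> subst \<sigma> 1 = 1"
    "regular \<sigma> (var x) \<and> subst \<sigma> (var x) = \<sigma> x"
    unfolding iff by (rule substitutes_cst substitutes_1 substitutes_var[OF refl])+
  assume u: "regular \<sigma> u"
  show "regular \<sigma> (- u) \<and> subst \<sigma> (- u) = - subst \<sigma> u"
    unfolding iff by (rule substitutes_uminus[OF D[OF u]])
  assume v: "regular \<sigma> v"
  show "regular \<sigma> (u + v) \<and> subst \<sigma> (u + v) = subst \<sigma> u + subst \<sigma> v"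
    "regular \<sigma> (u - v) \<and> subst \<sigma> (u - v) = subst \<sigma> u - subst \<sigma> v"
    "regular \<sigma> (u * v) \<and> subst \<sigma> (u * v) = subst \<sigma> u * subst \<sigma> v"
    unfolding iff
    by (rule substitutes_add[OF D[OF u] D[OF v]] substitutes_diff[OF D[OF u] D[OF v]]
        substitutes_mult[OF D[OF u] D[OF v]])+
  assume "subst \<sigma> v \<noteq> 0"
  then show "regular \<sigma> (u / v) \<and> subst \<sigma> (u / v) = subst \<sigma> u / subst \<sigma> v"
    unfolding iff by (rule substitutes_divide[OF D[OF u] D[OF v]])
qed

lemmas regular_simps = regular_subst[THEN conjunct1] regular_subst[THEN conjunct2]

section \<open>The group of automorphisms\<close>

lemma mult_birat: "\<phi> \<otimes>\<^bsub>birat\<^esub> \<psi> = \<phi> \<circ> \<psi>"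
  and one_birat: "\<one>\<^bsub>birat\<^esub> = id"
  by (simp_all add: birat_def)

lemma birat_hom:
  assumes "\<phi> \<in> carrier birat"
  shows "\<phi> (u + v) = \<phi> u + \<phi> v" "\<phi> (u * v) = \<phi> u * \<phi> v" "\<phi> (cst c) = cst c"
    "\<phi> 0 = 0" "\<phi> 1 = 1" "\<phi> (- u) = - \<phi> u" "\<phi> (u - v) = \<phi> u - \<phi> v"
    "\<phi> (u / v) = \<phi> u / \<phi> v" "\<phi> (u ^ n) = \<phi> u ^ n"
proof -
  show add: "\<phi> (u + v) = \<phi> u + \<phi> v" and mult: "\<phi> (u * v) = \<phi> u * \<phi> v"
    and cst: "\<phi> (cst c) = cst c" for u v c
    using assms by (auto simp: birat_def)
  show 0: "\<phi> 0 = 0" and 1: "\<phi> 1 = 1"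
    using cst[of 0] cst[of 1] by simp_all
  show minus: "\<phi> (- u) = - \<phi> u" for u
    using add[of "- u" u] 0 by (simp add: eq_neg_iff_add_eq_0)
  show "\<phi> (u - v) = \<phi> u - \<phi> v"
    using add[of u "- v"] minus by simp
  \<comment> \<open>Since \<open>u / 0 = 0\<close>, the rule has no side condition and can be used
    for rewriting.\<close>
  show "\<phi> (u / v) = \<phi> u / \<phi> v"
  proof (cases "v = 0")
    case False
    then have "\<phi> v \<noteq> 0"
      using mult[of v "1 / v"] 1 by auto
    moreover have "\<phi> (u / v) * \<phi> v = \<phi> u"
      using False mult[of "u / v" v] by simp
    ultimately show ?thesis
      by (simp add: field_simps)
  qed (simp add: 0)
  show "\<phi> (u ^ n) = \<phi> u ^ n"
    by (induction n) (simp_all add: 1 mult)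
qed

lemma birat_eq_0_iff:
  assumes "\<phi> \<in> carrier birat"
  shows "\<phi> u = 0 \<longleftrightarrow> u = 0"
proof -
  have "inj \<phi>"
    using assms by (simp add: birat_def bij_is_inj)
  then show ?thesis
    using birat_hom(4)[OF assms] by (metis injD)
qed

lemma birat_mpoly_eval:
  fixes \<sigma> :: "'a::linorder \<Rightarrow> 'a ratfun"
  assumes "\<phi> \<in> carrier birat"
  shows "\<phi> (mpoly_eval \<sigma> p) = mpoly_eval (\<phi> \<circ> \<sigma>) p"
proof -
  have sum: "\<phi> (sum f S) = (\<Sum>i\<in>S. \<phi> (f i))" for f :: "_ \<Rightarrow> 'a ratfun" and S :: "('a \<Rightarrow>\<^sub>0 nat) set"
    by (induction S rule: infinite_finite_induct) (simp_all add: birat_hom[OF assms])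
  have prod: "\<phi> (prod f S) = (\<Prod>i\<in>S. \<phi> (f i))" for f :: "_ \<Rightarrow> 'a ratfun" and S :: "'a set"
    by (induction S rule: infinite_finite_induct) (simp_all add: birat_hom[OF assms])
  show ?thesis
    by (simp add: mpoly_eval_def sum prod birat_hom[OF assms])
qed

lemma birat_Fract:
  assumes "\<phi> \<in> carrier birat"
  shows "\<phi> (Fract a b) = mpoly_eval (\<lambda>v. \<phi> (var v)) a / mpoly_eval (\<lambda>v. \<phi> (var v)) b"
proof -
  have "\<phi> (Fract a b) = \<phi> (mpoly_eval var a / mpoly_eval var b)"
    by (simp add: mpoly_eval_id)
  then show ?thesis
    by (simp add: birat_hom[OF assms] birat_mpoly_eval[OF assms] o_def)
qed

lemma birat_eqI:
  assumes "\<phi> \<in> carrier birat" "\<psi> \<in> carrier birat" "\<And>v. \<phi> (var v) = \<psi> (var v)"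
  shows "\<phi> = \<psi>"
proof
  fix u
  show "\<phi> u = \<psi> u"
    using assms by (cases u) (simp add: birat_Fract)
qed

text \<open>An automorphism is injective, so no denominator vanishes. This identifies a
  transformation given by formulas with a product of known automorphisms, and its membership in
  \<open>birat\<close> follows without an explicit inverse.\<close>

lemma subst_eq_birat:
  fixes \<sigma> :: "'a::linorder \<Rightarrow> 'a ratfun"
  assumes "\<phi> \<in> carrier birat" "\<And>v. \<phi> (var v) = \<sigma> v"
  shows "subst \<sigma> = \<phi>"
proof
  fix u :: "'a ratfun"
  obtain a b where u: "u = Fract a b" "b \<noteq> 0"
    by (cases u)
  have "mpoly_eval \<sigma> b = \<phi> (Fract b 1)"
    using assms by (simp add: birat_Fract)
  also have "\<dots> \<noteq> 0"
    using u by (simp add: birat_eq_0_iff[OF assms(1)] Fract_eq_0_iff)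
  finally show "subst \<sigma> u = \<phi> u"
    using u assms by (intro subst_eqI) (auto simp: substitutes_def birat_Fract)
qed

theorem inv_subst:
  assumes "\<And>v. substitutes \<tau> (\<sigma> v) (var v)" and "\<And>v. substitutes \<sigma> (\<tau> v) (var v)"
  shows "inv\<^bsub>birat\<^esub> (subst \<sigma>) = subst \<tau>"
proof (rule group.inv_equality[OF group_birat])
  show "subst \<tau> \<otimes>\<^bsub>birat\<^esub> subst \<sigma> = \<one>\<^bsub>birat\<^esub>"
    by (auto simp: mult_birat one_birat subst_subst[OF assms])
qed (use subst_in_birat[OF assms] subst_in_birat[OF assms(2,1)] in auto)

lemma birat_comp_apply:
  "(\<phi> \<otimes>\<^bsub>birat\<^esub> \<psi>) u = \<phi> (\<psi> u)"
  by (simp add: mult_birat)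

interpretation birat: group birat
  by (rule group_birat)

lemma birat_inv_apply:
  assumes "\<phi> \<in> carrier birat"
  shows "(inv\<^bsub>birat\<^esub> \<phi>) (\<phi> u) = u" "\<phi> ((inv\<^bsub>birat\<^esub> \<phi>) u) = u"
  using birat.l_inv[OF assms] birat.r_inv[OF assms]
  by (metis birat_comp_apply one_birat id_apply)+

section \<open>The lattice of connection preserving deformations\<close>

lemma dvar_nonzero:
  shows "yy - aa1 \<noteq> 0" "yy - aa2 \<noteq> 0" "zz - 1 \<noteq> 0" "zz * aa2 * ka2 + la1 \<noteq> 0"
    and "(zz - 1) * yy - aa2 * zz \<noteq> 0" "cst q * ka1 * yy - ka2 * zz \<noteq> 0"
    and "aa2 * (zz * ka2 - cst q * yy * ka1) + la1 \<noteq> 0"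
    and "zz * aa1 * aa2 * ka2 + (aa1 - yy) * la1 \<noteq> 0"
    and "cst q * ka1 * (aa1 - yy) + ka2 * zz \<noteq> 0"
    and "aa1 * ka1 * (zz - 1) * yy - la1 * zz \<noteq> 0"
    and "ka1 * yy * aa1 + la1 * zz \<noteq> 0"
    and "ka2 * (yy - zz * (yy - aa2)) + la1 \<noteq> 0"
    and "la1 * (yy - aa1) + aa1 * ka2 * zz * (yy - aa2) \<noteq> 0"
    and "la1 * zz * (yy - aa2) - aa1 * aa2 * ka1 * yy \<noteq> 0"
  \<comment> \<open>At the points used for expressions with \<open>cst q\<close>, the coordinate
    \<open>Kappa1\<close> is 0, so \<open>q\<close> drops out of the value.\<close>
  by (rule nonzero_at[of Y Y Y Y], (rule substitutes_intros refl)+, simp,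
      rule nonzero_at[of Y Y Y Y], (rule substitutes_intros refl)+, simp,
      rule nonzero_at[of Y Y Y Y], (rule substitutes_intros refl)+, simp,
      rule nonzero_at[of Lambda1 Y Y Lambda1], (rule substitutes_intros refl)+, simp,
      rule nonzero_at[of Y Y Y Y], (rule substitutes_intros refl)+, simp,
      rule nonzero_at[of Kappa2 Z Y Kappa2], (rule substitutes_intros refl)+, simp,
      rule nonzero_at[of Lambda1 Y Y Lambda1], (rule substitutes_intros refl)+, simp,
      rule nonzero_at[of A1 Lambda1 Lambda1 A1], (rule substitutes_intros refl)+, simp,
      rule nonzero_at[of Kappa2 Z Z Kappa2], (rule substitutes_intros refl)+, simp,
      rule nonzero_at[of Lambda1 Z Y Lambda1], (rule substitutes_intros refl)+, simp,
      rule nonzero_at[of Lambda1 Z Z Lambda1], (rule substitutes_intros refl)+, simp,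
      rule nonzero_at[of Lambda1 Z Z Lambda1], (rule substitutes_intros refl)+, simp,
      rule nonzero_at[of Lambda1 Y Y Lambda1], (rule substitutes_intros refl)+, simp,
      rule nonzero_at[of Lambda1 Z Y Y], (rule substitutes_intros refl)+, simp)

text \<open>The simplifier turns \<open>a - b = 0\<close> into \<open>a = b\<close>, so side
  conditions may arrive in either shape.\<close>

lemmas dvar_neq = dvar_nonzero dvar_nonzero[simplified]

lemma S_a1_a2_in_birat: "S_a1_a2 \<in> carrier birat" and S_a1_a2_involution: "S_a1_a2 \<otimes>\<^bsub>birat\<^esub> S_a1_a2 = \<one>\<^bsub>birat\<^esub>"
proof -
  let ?\<sigma> = "var(A1 := aa2, A2 := aa1, Z := zz * (yy - aa2) / (yy - aa1))"
  have *: "substitutes ?\<sigma> (?\<sigma> v) (var v)" for v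
    by (cases v) (simp_all add: substitutes_iff regular_simps dvar_neq)
  show "S_a1_a2 \<in> carrier birat"
    unfolding S_a1_a2_def by (rule subst_in_birat[OF * *])
  then show "S_a1_a2 \<otimes>\<^bsub>birat\<^esub> S_a1_a2 = \<one>\<^bsub>birat\<^esub>"
    using birat.r_inv[of S_a1_a2] unfolding S_a1_a2_def inv_subst[OF * *] by blast
qed

lemma S_a1_a2_var:
  "S_a1_a2 ka1 = ka1" "S_a1_a2 ka2 = ka2" "S_a1_a2 aa1 = aa2" "S_a1_a2 aa2 = aa1" "S_a1_a2 la1 = la1"
  "S_a1_a2 ww = ww" "S_a1_a2 yy = yy" "S_a1_a2 zz = zz * (yy - aa2) / (yy - aa1)"
  by (simp_all add: S_a1_a2_def subst_var)

text \<open>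
  A square root of a translation, up to the reflection \<open>S_a1_a2\<close> and the scaling: \<open>T_half q\<close> is
  \<open>T_a1_la1\<^sup>-\<^sup>1 \<circ> S_a1_a2\<close>, and \<open>T_ka1_la1 \<circ> T_half\<^sup>2\<close> is the scaling of \<open>x\<close>.
\<close>

definition T_half :: "complex \<Rightarrow> dvar ratfun \<Rightarrow> dvar ratfun" where
  "T_half q =
     subst (var(A1 := aa2, A2 := aa1 / cst q, Lambda1 := la1 / cst q, W := ww / (1 - zz),
                Y := zz * (zz * aa2 * ka2 + la1) / (cst q * ka1 * (zz - 1) * yy),
                Z := (zz * aa2 * ka2 + la1) / (ka2 * (zz - 1) * yy)))"

text \<open>Found by solving for the old variables: the images of \<open>yy\<close> and
  \<open>zz\<close> under \<open>T_half q\<close> share the factor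
  \<open>(zz * aa2 * ka2 + la1) / ((zz - 1) * yy)\<close>, hence \<open>T_half q\<close> takes
  \<open>cst q * ka1 * yy / (ka2 * zz)\<close> to \<open>zz\<close>. This gives the image of
  \<open>zz\<close>, and the other images follow from it.\<close>

definition T_half_inv :: "complex \<Rightarrow> dvar ratfun \<Rightarrow> dvar ratfun" where
  "T_half_inv q =
     (let z' = cst q * ka1 * yy / (ka2 * zz)
      in subst (var(A1 := cst q * aa2, A2 := aa1, Lambda1 := cst q * la1, W := ww * (1 - z'),
                    Y := (z' * aa1 * ka2 + cst q * la1) / (ka2 * (z' - 1) * zz), Z := z')))"

text \<open>The closed form of the composite \<open>T_scaling q\<close>; the two are identified in
  \<open>T_scaling_eq\<close>. It has an evident inverse, and \<open>T_ka1_la1\<close> is factored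
  through it.\<close>

definition scaling :: "complex \<Rightarrow> dvar ratfun \<Rightarrow> dvar ratfun" where
  "scaling q =
     subst (var(Kappa1 := cst q * ka1, A1 := aa1 / cst q, A2 := aa2 / cst q, Lambda1 := la1 / cst q,
                W := ka2 * ww / ka1, Y := yy / cst q))"

context
  fixes q :: complex
  assumes q: "q \<noteq> 0"
begin

lemma T_ka1_ka2_la1_la2_in_birat: "T_ka1_ka2_la1_la2 q \<in> carrier birat"
proof -
  let ?\<sigma> = "var(Kappa1 := cst q * ka1, Kappa2 := cst q * ka2, Lambda1 := cst q * la1)"
  let ?\<tau> = "var(Kappa1 := ka1 / cst q, Kappa2 := ka2 / cst q, Lambda1 := la1 / cst q)"
  have 1: "substitutes ?\<tau> (?\<sigma> v) (var v)" for v
    by (cases v) (simp_all add: substitutes_iff regular_simps q)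
  have 2: "substitutes ?\<sigma> (?\<tau> v) (var v)" for v
    by (cases v) (simp_all add: substitutes_iff regular_simps q)
  show ?thesis
    unfolding T_ka1_ka2_la1_la2_def by (rule subst_in_birat[OF 1 2])
qed

lemma scaling_in_birat: "scaling q \<in> carrier birat"
proof -
  let ?\<sigma> = "var(Kappa1 := cst q * ka1, A1 := aa1 / cst q, A2 := aa2 / cst q, Lambda1 := la1 / cst q,
                W := ka2 * ww / ka1, Y := yy / cst q)"
  let ?\<tau> = "var(Kappa1 := ka1 / cst q, A1 := cst q * aa1, A2 := cst q * aa2, Lambda1 := cst q * la1,
                W := ka1 * ww / ka2 / cst q, Y := cst q * yy)"
  have 1: "substitutes ?\<tau> (?\<sigma> v) (var v)" for v
    by (cases v) (simp_all add: substitutes_iff regular_simps q)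
  have 2: "substitutes ?\<sigma> (?\<tau> v) (var v)" for v
    by (cases v) (simp_all add: substitutes_iff regular_simps q)
  show ?thesis
    unfolding scaling_def by (rule subst_in_birat[OF 1 2])
qed

lemma
  shows T_half_in_birat: "T_half q \<in> carrier birat"
    and inv_T_half: "inv\<^bsub>birat\<^esub> (T_half q) = T_half_inv q"
proof -
  let ?N = "zz * aa2 * ka2 + la1"
  let ?\<sigma> = "var(A1 := aa2, A2 := aa1 / cst q, Lambda1 := la1 / cst q, W := ww / (1 - zz),
                Y := zz * ?N / (cst q * ka1 * (zz - 1) * yy), Z := ?N / (ka2 * (zz - 1) * yy))"
  let ?z = "cst q * ka1 * yy / (ka2 * zz)"
  let ?M = "?z * aa1 * ka2 + cst q * la1"
  let ?\<tau> = "var(A1 := cst q * aa2, A2 := aa1, Lambda1 := cst q * la1, W := ww * (1 - ?z),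
                Y := ?M / (ka2 * (?z - 1) * zz), Z := ?z)"
  have neq: "?z - 1 \<noteq> 0" "1 - ?z \<noteq> 0"
    using dvar_neq(6)[of q] by (auto simp: field_simps)
  \<comment> \<open>\<open>?M\<close> is the image of \<open>?N\<close> under \<open>?\<tau>\<close>
    and a factor of the image of \<open>yy\<close>, which is a denominator.\<close>
  have M: "?M \<noteq> 0"
  proof -
    have "?M = cst q * (ka1 * yy * aa1 + la1 * zz) / zz"
      by (simp add: field_simps)
    then show ?thesis
      using dvar_neq(11) q by simp
  qed
  have z: "regular ?\<sigma> ?z" "subst ?\<sigma> ?z = zz"
    by (simp_all add: regular_simps q dvar_neq)
  have N: "regular ?\<tau> ?N" "subst ?\<tau> ?N = ?M"
    by (simp_all add: regular_simps q)
  have M': "regular ?\<sigma> ?M" "subst ?\<sigma> ?M = ?N"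
    using z by (simp_all add: regular_simps q del: times_divide_eq_left)
  have 1: "substitutes ?\<tau> (?\<sigma> v) (var v)" for v
    by (cases v) (use N neq M in \<open>simp_all add: substitutes_iff regular_simps q\<close>)
  have 2: "substitutes ?\<sigma> (?\<tau> v) (var v)" for v
    by (cases v) (use z M' in \<open>simp_all add: substitutes_iff regular_simps q dvar_neq
        dvar_neq(4)[unfolded mult.assoc] mult.assoc\<close>)
  show "T_half q \<in> carrier birat"
    unfolding T_half_def by (rule subst_in_birat[OF 1 2])
  show "inv\<^bsub>birat\<^esub> (T_half q) = T_half_inv q"
    unfolding T_half_def T_half_inv_def Let_def by (rule inv_subst[OF 1 2])
qed

lemmas deformation_hom =
  birat_hom[OF S_a1_a2_in_birat] birat_hom[OF T_ka1_ka2_la1_la2_in_birat] birat_hom[OF scaling_in_birat]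
  birat_hom[OF T_half_in_birat]

lemma deformation_var:
  "T_half q ka1 = ka1" "T_half q ka2 = ka2" "T_half q aa1 = aa2" "T_half q aa2 = aa1 / cst q"
  "T_half q la1 = la1 / cst q" "T_half q ww = ww / (1 - zz)"
  "T_half q yy = zz * (zz * aa2 * ka2 + la1) / (cst q * ka1 * (zz - 1) * yy)"
  "T_half q zz = (zz * aa2 * ka2 + la1) / (ka2 * (zz - 1) * yy)"
  "scaling q ka1 = cst q * ka1" "scaling q ka2 = ka2" "scaling q aa1 = aa1 / cst q"
  "scaling q aa2 = aa2 / cst q" "scaling q la1 = la1 / cst q" "scaling q ww = ka2 * ww / ka1"
  "scaling q yy = yy / cst q" "scaling q zz = zz"
  "T_ka1_ka2_la1_la2 q ka1 = cst q * ka1" "T_ka1_ka2_la1_la2 q ka2 = cst q * ka2"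
  "T_ka1_ka2_la1_la2 q aa1 = aa1" "T_ka1_ka2_la1_la2 q aa2 = aa2"
  "T_ka1_ka2_la1_la2 q la1 = cst q * la1" "T_ka1_ka2_la1_la2 q ww = ww"
  "T_ka1_ka2_la1_la2 q yy = yy" "T_ka1_ka2_la1_la2 q zz = zz"
  by (simp_all add: T_half_def scaling_def T_ka1_ka2_la1_la2_def subst_var)

text \<open>The square shifts \<open>aa1\<close> and \<open>aa2\<close> alike, while
  \<open>T_half q\<close> itself treats them asymmetrically. After two steps the images of
  \<open>yy\<close> and \<open>ww\<close> involve, besides variables and constants, only the factors
  \<open>P\<close> and \<open>K\<close>; the exchange fixes \<open>K\<close> and multiplies
  \<open>P\<close>, like \<open>zz\<close>, by \<open>y2 / y1\<close>.\<close>

lemma T_half_sq_S_a1_a2: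
  "T_half q \<otimes>\<^bsub>birat\<^esub> T_half q \<otimes>\<^bsub>birat\<^esub> S_a1_a2 = S_a1_a2 \<otimes>\<^bsub>birat\<^esub> T_half q \<otimes>\<^bsub>birat\<^esub> T_half q"
proof (rule birat_eqI)
  fix v
  let ?X = "T_half q" and ?S = S_a1_a2
  define Q where "Q = (cst q :: dvar ratfun)"
  define u where "u = zz - 1"
  define N where "N = zz * aa2 * ka2 + la1"
  define K where "K = ka2 * (yy - zz * (yy - aa2)) + la1"
  define P where "P = N * aa1 + la1 * yy * u"
  define H where "H = zz * (yy - aa2) - (yy - aa1)"
  define G where "G = la1 * (yy - aa1) + aa1 * ka2 * zz * (yy - aa2)"
  define y1 where "y1 = yy - aa1"
  define y2 where "y2 = yy - aa2"
  have nz: "Q \<noteq> 0" "u \<noteq> 0" "N \<noteq> 0" "K \<noteq> 0" "G \<noteq> 0" "y1 \<noteq> 0" "y2 \<noteq> 0"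
    using q dvar_nonzero by (simp_all add: Q_def u_def N_def K_def G_def y1_def y2_def del: right_minus_eq)
  have X: "?X yy = zz * N / (Q * ka1 * u * yy)" "?X zz = N / (ka2 * u * yy)"
    "?X ww = - (ww / u)" "?X ka1 = ka1" "?X ka2 = ka2" "?X aa1 = aa2" "?X aa2 = aa1 / Q"
    "?X la1 = la1 / Q" "?X Q = Q"
    using nz by (simp_all add: deformation_var deformation_hom N_def u_def Q_def field_simps)
  have XN: "?X N = P / (Q * u * yy)"
  proof -
    have "?X N = ?X zz * (aa1 / Q) * ka2 + la1 / Q"
      by (simp add: N_def deformation_hom X(4-))
    then show ?thesis
      unfolding X(2) P_def using nz by (simp add: field_simps)
  qed
  have Xu: "?X u = K / (ka2 * u * yy)"
  proof -
    have "?X u = ?X zz - 1"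
      by (simp add: u_def deformation_hom)
    moreover have "N - ka2 * u * yy = K"
      by (simp add: N_def u_def K_def algebra_simps)
    ultimately show ?thesis
      unfolding X(2) using nz by (simp add: field_simps)
  qed
  have XXy: "?X (?X yy) = P / (Q * zz * K)"
    unfolding X(1) using nz by (simp add: deformation_hom X XN Xu)
  have XXz: "?X (?X zz) = ka1 * yy * P * u / (zz * N * K)"
    unfolding X(2) using nz by (simp add: deformation_hom X XN Xu mult_ac)
  have XXw: "?X (?X ww) = ww * ka2 * yy / K"
    unfolding X(3) using nz by (simp add: deformation_hom X Xu)
  have S: "?S zz = zz * y2 / y1" "?S y1 = y2" "?S y2 = y1" "?S Q = Q"
    by (simp_all add: deformation_hom S_a1_a2_var y1_def y2_def Q_def)
  note Sv = S_a1_a2_var(1-7)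
  have KP: "K = ka2 * (yy - zz * y2) + la1" "P = zz * aa1 * aa2 * ka2 + la1 * (zz * yy - y1)"
    "N = zz * aa2 * ka2 + la1" "u = zz - 1"
    by (simp_all add: K_def P_def N_def u_def y1_def y2_def algebra_simps)
  then have SK: "?S K = ka2 * (yy - ?S zz * y1) + la1"
    and SP: "?S P = ?S zz * aa1 * aa2 * ka2 + la1 * (?S zz * yy - y2)"
    and SN: "?S N = ?S zz * aa1 * ka2 + la1" and Su: "?S u = ?S zz - 1"
    by (simp_all add: deformation_hom Sv S mult_ac)
  have G: "G = la1 * y1 + aa1 * ka2 * zz * y2" and H: "H = zz * y2 - y1"
    by (simp_all add: G_def H_def y1_def y2_def)
  have S': "?S K = K" "?S P = P * y2 / y1" "?S N = G / y1" "?S u = H / y1"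
    unfolding SK SP SN Su S(1) unfolding KP G H using nz(6) by (simp_all add: field_simps)
  \<comment> \<open>Numerators of the double image of \<open>yy\<close> minus \<open>aa2 / Q\<close>
    and minus \<open>aa1 / Q\<close>. They split into known factors, so the double image of
    \<open>?S zz\<close>, which contains the quotient of these differences, stays a product.\<close>
  have PN: "P - aa2 * zz * K = N * H" and PG: "P - aa1 * zz * K = u * G"
    by (simp_all add: K_def P_def N_def G_def H_def u_def algebra_simps)
  have a2: "?X (?X yy) - aa2 / Q = N * H / (Q * zz * K)" and a1: "?X (?X yy) - aa1 / Q = u * G / (Q * zz * K)"
    unfolding XXy PN[symmetric] PG[symmetric] using nz by (simp_all add: field_simps)
  have XXSz: "?X (?X (?S zz)) = ka1 * yy * P * H / (zz * K * G)"
  proof -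
    have "?X (?X (?S zz)) = ?X (?X zz) * (?X (?X yy) - aa2 / Q) / (?X (?X yy) - aa1 / Q)"
      by (simp add: S(1) y1_def y2_def deformation_hom X(4-))
    then show ?thesis
      unfolding a1 a2 XXz using nz by (simp add: mult_ac)
  qed
  show "(?X \<otimes>\<^bsub>birat\<^esub> ?X \<otimes>\<^bsub>birat\<^esub> ?S) (var v) = (?S \<otimes>\<^bsub>birat\<^esub> ?X \<otimes>\<^bsub>birat\<^esub> ?X) (var v)"
  proof (cases v)
    case Y then show ?thesis using nz by (simp add: birat_comp_apply XXy deformation_hom Sv S S')
  next
    case Z then show ?thesis using nz by (simp only: birat_comp_apply XXSz XXz) (simp add: deformation_hom Sv S S' mult_ac)
  next
    case W then show ?thesis using nz by (simp add: birat_comp_apply XXw deformation_hom Sv S S')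
  qed (simp_all add: birat_comp_apply deformation_hom X Sv S S')
qed (simp_all add: S_a1_a2_in_birat T_half_in_birat)

lemma scaling_comm:
  "scaling q \<otimes>\<^bsub>birat\<^esub> S_a1_a2 = S_a1_a2 \<otimes>\<^bsub>birat\<^esub> scaling q"
  "scaling q \<otimes>\<^bsub>birat\<^esub> T_half q = T_half q \<otimes>\<^bsub>birat\<^esub> scaling q"
  "T_ka1_ka2_la1_la2 q \<otimes>\<^bsub>birat\<^esub> S_a1_a2 = S_a1_a2 \<otimes>\<^bsub>birat\<^esub> T_ka1_ka2_la1_la2 q"
  "T_ka1_ka2_la1_la2 q \<otimes>\<^bsub>birat\<^esub> T_half q = T_half q \<otimes>\<^bsub>birat\<^esub> T_ka1_ka2_la1_la2 q"
  "T_ka1_ka2_la1_la2 q \<otimes>\<^bsub>birat\<^esub> scaling q = scaling q \<otimes>\<^bsub>birat\<^esub> T_ka1_ka2_la1_la2 q"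
proof -
  note in_birat = S_a1_a2_in_birat scaling_in_birat T_half_in_birat T_ka1_ka2_la1_la2_in_birat
  \<comment> \<open>The polynomial common to the images of \<open>yy\<close> and \<open>zz\<close>
    under \<open>T_half q\<close> is homogeneous for both scalings and only acquires a power of
    \<open>q\<close>.\<close>
  have E: "zz * aa2 * (cst q * ka2) + cst q * la1 = cst q * (zz * aa2 * ka2 + la1)"
    by (simp add: algebra_simps)
  have Sc: "zz * (aa2 / cst q) * ka2 + la1 / cst q = (zz * aa2 * ka2 + la1) / cst q"
    by (simp add: add_divide_distrib)
  show "scaling q \<otimes>\<^bsub>birat\<^esub> S_a1_a2 = S_a1_a2 \<otimes>\<^bsub>birat\<^esub> scaling q"
    by (rule birat_eqI; (simp add: in_birat)?)
      (case_tac v; simp add: birat_comp_apply deformation_var S_a1_a2_var deformation_hom q flip: diff_divide_distrib)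
  show "T_ka1_ka2_la1_la2 q \<otimes>\<^bsub>birat\<^esub> S_a1_a2 = S_a1_a2 \<otimes>\<^bsub>birat\<^esub> T_ka1_ka2_la1_la2 q"
    by (rule birat_eqI; (simp add: in_birat)?)
      (case_tac v; simp add: birat_comp_apply deformation_var S_a1_a2_var deformation_hom)
  show "scaling q \<otimes>\<^bsub>birat\<^esub> T_half q = T_half q \<otimes>\<^bsub>birat\<^esub> scaling q"
    by (rule birat_eqI; (simp add: in_birat)?)
      (case_tac v; simp add: birat_comp_apply deformation_var S_a1_a2_var deformation_hom q Sc del: times_divide_eq_left times_divide_eq_right; simp add: q)
  show "T_ka1_ka2_la1_la2 q \<otimes>\<^bsub>birat\<^esub> T_half q = T_half q \<otimes>\<^bsub>birat\<^esub> T_ka1_ka2_la1_la2 q"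
    by (rule birat_eqI; (simp add: in_birat)?)
      (case_tac v; simp add: birat_comp_apply deformation_var S_a1_a2_var deformation_hom E; simp add: q)
  show "T_ka1_ka2_la1_la2 q \<otimes>\<^bsub>birat\<^esub> scaling q = scaling q \<otimes>\<^bsub>birat\<^esub> T_ka1_ka2_la1_la2 q"
    by (rule birat_eqI; (simp add: in_birat)?)
      (case_tac v; simp add: birat_comp_apply deformation_var S_a1_a2_var deformation_hom; simp add: q)
qed

text \<open>A cancellation is hidden in the definition: \<open>z' - 1\<close> contains the factor
  \<open>zz * aa2 * ka2 + la1\<close>, which also occurs in the images of \<open>ww\<close> and
  \<open>yy\<close>. In reduced form all images are products of powers of \<open>d\<close>,
  \<open>M\<close>, \<open>t\<close>, variables and constants.\<close>

lemma T_ka1_la2_eq: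
  "T_ka1_la2 q =
     (let d = aa2 * (zz * ka2 - cst q * yy * ka1) + la1;
          M = zz * aa1 * aa2 * ka2 + (aa1 - yy) * la1;
          t = cst q * ka1 * (aa1 - yy) + ka2 * zz
      in subst (var(Kappa1 := cst q * ka1, W := ww * t / (zz * ka1), Y := M / (yy * t),
           Z := - (cst q * ka1 * M / (ka2 * zz * d)))))"
proof -
  define Q where "Q = (cst q :: dvar ratfun)"
  define N where "N = zz * aa2 * ka2 + la1"
  define d where "d = aa2 * (zz * ka2 - Q * yy * ka1) + la1"
  define M where "M = zz * aa1 * aa2 * ka2 + (aa1 - yy) * la1"
  define t where "t = Q * ka1 * (aa1 - yy) + ka2 * zz"
  define z' where "z' = - (Q * ka1 * M / (ka2 * zz * d))"
  have nz: "Q \<noteq> 0" "N \<noteq> 0" "d \<noteq> 0" "t \<noteq> 0"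
    using q dvar_nonzero by (simp_all add: Q_def N_def d_def t_def del: right_minus_eq)
  \<comment> \<open>The left side is the numerator of \<open>1 - z'\<close>; its factor
    \<open>N\<close> is the one that cancels.\<close>
  have "Q * ka1 * M + ka2 * zz * d = N * t"
    by (simp add: N_def d_def M_def t_def algebra_simps)
  moreover have "z' - 1 = - ((Q * ka1 * M + ka2 * zz * d) / (ka2 * zz * d))"
    using nz by (simp add: z'_def field_simps)
  ultimately have z1: "z' - 1 = - (N * t / (ka2 * zz * d))"
    by simp
  have 1: "- (Q * ka1 * M / (ka2 * d)) / zz = z'"
    by (simp add: z'_def mult_ac)
  have 2: "z' * N / (Q * (z' - 1) * ka1) / yy = M / (yy * t)"
    unfolding z1 using nz by (simp add: z'_def field_simps)
  have 3: "- ww * (z' - 1) * (ka2 * d / (ka1 * N)) = ww * t / (zz * ka1)"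
    unfolding z1 using nz by (simp add: field_simps)
  show ?thesis
    unfolding T_ka1_la2_def Let_def
    unfolding Q_def[symmetric]
    unfolding d_def[symmetric] M_def[symmetric] N_def[symmetric] t_def[symmetric] 1
    unfolding 2 3
    unfolding z'_def ..
qed

lemma T_ka1_la2_in_birat: "T_ka1_la2 q \<in> carrier birat"
proof -
  define Q where "Q = (cst q :: dvar ratfun)"
  define d where "d = aa2 * (zz * ka2 - Q * yy * ka1) + la1"
  define M where "M = zz * aa1 * aa2 * ka2 + (aa1 - yy) * la1"
  define t where "t = Q * ka1 * (aa1 - yy) + ka2 * zz"
  define N where "N = zz * aa2 * ka2 + la1"
  define u where "u = zz - 1"
  \<comment> \<open>\<open>B\<close>, \<open>C\<close> and \<open>j\<close> are the factors of the
    inverse map. Up to variables and constants, \<open>?\<tau>\<close> turns \<open>d\<close>,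
    \<open>M\<close>, \<open>t\<close> into products of powers of them, and \<open>?\<sigma>\<close>
    turns them into products of powers of \<open>d\<close>, \<open>M\<close>,
    \<open>t\<close>.\<close>
  define B where "B = u * yy - aa2 * zz"
  define C where "C = aa1 * ka1 * u * yy - la1 * zz"
  define j where "j = la1 * zz * (yy - aa2) - aa1 * aa2 * ka1 * yy"
  let ?\<sigma> = "var(Kappa1 := Q * ka1, W := ww * t / (zz * ka1), Y := M / (yy * t),
           Z := - (Q * ka1 * M / (ka2 * zz * d)))"
  let ?\<tau> = "var(Kappa1 := ka1 / Q, W := - (ww * ka1 * yy / (ka2 * B * Q)),
           Y := j / (ka1 * yy * B), Z := - (C / (ka2 * zz * B)))"
  have nz: "Q \<noteq> 0" "N \<noteq> 0" "d \<noteq> 0" "t \<noteq> 0" "M \<noteq> 0" "u \<noteq> 0" "B \<noteq> 0" "C \<noteq> 0" "j \<noteq> 0"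
    using q dvar_nonzero
    by (simp_all add: Q_def N_def d_def t_def M_def u_def B_def C_def j_def del: right_minus_eq)
  have Q: "regular \<rho> Q" "subst \<rho> Q = Q" for \<rho>
    by (simp_all add: Q_def regular_simps)
  have d0: "regular ?\<tau> d"
    by (simp add: d_def regular_simps Q nz)
  have "subst ?\<tau> d = aa2 * (- (C / (ka2 * zz * B)) * ka2 - Q * (j / (ka1 * yy * B)) * (ka1 / Q)) + la1"
    by (simp add: d_def regular_simps Q nz)
  moreover have "\<dots> = (zz * yy * B * la1 - aa2 * (C * yy + j * zz)) / (zz * yy * B)"
    using nz by (simp add: field_simps)
  moreover have "zz * yy * B * la1 - aa2 * (C * yy + j * zz) = j * B"
    by (simp add: B_def C_def j_def u_def algebra_simps)
  ultimately have d: "regular ?\<tau> d" "subst ?\<tau> d = j / (zz * yy)"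
    using nz d0 by auto
  have M0: "regular ?\<tau> M"
    by (simp add: M_def regular_simps Q nz)
  have "subst ?\<tau> M = - (C / (ka2 * zz * B)) * aa1 * aa2 * ka2 + (aa1 - j / (ka1 * yy * B)) * la1"
    by (simp add: M_def regular_simps Q nz)
  moreover have "\<dots> = (aa1 * la1 * ka1 * zz * yy * B - C * aa1 * aa2 * ka1 * yy - la1 * j * zz) / (ka1 * zz * yy * B)"
    using nz by (simp add: field_simps)
  moreover have "aa1 * la1 * ka1 * zz * yy * B - C * aa1 * aa2 * ka1 * yy - la1 * j * zz = j * C"
    by (simp add: B_def C_def j_def u_def algebra_simps)
  ultimately have M: "regular ?\<tau> M" "subst ?\<tau> M = j * C / (ka1 * zz * yy * B)"
    using nz M0 by auto
  have t0: "regular ?\<tau> t"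
    by (simp add: t_def regular_simps Q nz)
  have "subst ?\<tau> t = Q * (ka1 / Q) * (aa1 - j / (ka1 * yy * B)) + ka2 * (- (C / (ka2 * zz * B)))"
    by (simp add: t_def regular_simps Q nz)
  moreover have "\<dots> = (ka1 * aa1 * yy * zz * B - j * zz - C * yy) / (yy * zz * B)"
    using nz by (simp add: field_simps)
  moreover have "ka1 * aa1 * yy * zz * B - j * zz - C * yy = C * B"
    by (simp add: B_def C_def j_def u_def algebra_simps)
  ultimately have t: "regular ?\<tau> t" "subst ?\<tau> t = C / (yy * zz)"
    using nz t0 by auto
  have 1: "substitutes ?\<tau> (?\<sigma> v) (var v)" for v
    by (cases v; simp add: substitutes_iff regular_simps Q d M t nz; simp add: nz field_simps)
  have u0: "regular ?\<sigma> u"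
    by (simp add: u_def regular_simps)
  have "subst ?\<sigma> u = - (Q * ka1 * M / (ka2 * zz * d)) - 1"
    by (simp add: u_def regular_simps)
  moreover have "\<dots> = - ((Q * ka1 * M + ka2 * zz * d) / (ka2 * zz * d))"
    using nz by (simp add: field_simps)
  moreover have "Q * ka1 * M + ka2 * zz * d = N * t"
    by (simp add: N_def d_def M_def t_def algebra_simps)
  ultimately have u: "regular ?\<sigma> u" "subst ?\<sigma> u = - (N * t / (ka2 * zz * d))"
    using nz u0 by auto
  have B0: "regular ?\<sigma> B"
    by (simp add: B_def regular_simps u nz)
  have "subst ?\<sigma> B = - (N * t / (ka2 * zz * d)) * (M / (yy * t)) + aa2 * (Q * ka1 * M / (ka2 * zz * d))"
    by (simp add: B_def regular_simps u nz)
  moreover have "\<dots> = - ((N - aa2 * Q * ka1 * yy) * M / (ka2 * zz * yy * d))"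
    using nz by (simp add: field_simps)
  moreover have "N - aa2 * Q * ka1 * yy = d"
    by (simp add: N_def d_def algebra_simps)
  ultimately have B: "regular ?\<sigma> B" "subst ?\<sigma> B = - (M / (ka2 * zz * yy))"
    using nz B0 by auto
  have C0: "regular ?\<sigma> C"
    by (simp add: C_def regular_simps u Q nz)
  have "subst ?\<sigma> C = aa1 * (Q * ka1) * (- (N * t / (ka2 * zz * d))) * (M / (yy * t)) + la1 * (Q * ka1 * M / (ka2 * zz * d))"
    by (simp add: C_def regular_simps u Q nz)
  moreover have "\<dots> = - (Q * ka1 * M * (aa1 * N - la1 * yy) / (ka2 * zz * yy * d))"
    using nz by (simp add: field_simps)
  moreover have "aa1 * N - la1 * yy = M"
    by (simp add: N_def M_def algebra_simps)
  ultimately have C: "regular ?\<sigma> C" "subst ?\<sigma> C = - (Q * ka1 * M * M / (ka2 * zz * yy * d))"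
    using nz C0 by auto
  have j0: "regular ?\<sigma> j"
    by (simp add: j_def regular_simps Q nz)
  have "subst ?\<sigma> j = la1 * (- (Q * ka1 * M / (ka2 * zz * d))) * (M / (yy * t) - aa2) - aa1 * aa2 * (Q * ka1) * (M / (yy * t))"
    by (simp add: j_def regular_simps Q nz)
  moreover have "\<dots> = - (Q * ka1 * M * (la1 * (M - aa2 * yy * t) + aa1 * aa2 * ka2 * zz * d) / (ka2 * zz * yy * t * d))"
    using nz by (simp add: field_simps)
  moreover have "la1 * (M - aa2 * yy * t) + aa1 * aa2 * ka2 * zz * d = M * d"
    by (simp add: M_def t_def d_def algebra_simps)
  ultimately have j: "regular ?\<sigma> j" "subst ?\<sigma> j = - (Q * ka1 * M * M / (ka2 * zz * yy * t))"
    using nz j0 by (auto simp: mult_ac)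
  have 2: "substitutes ?\<sigma> (?\<tau> v) (var v)" for v
    by (cases v; simp add: substitutes_iff regular_simps Q u B C j nz; simp add: nz field_simps)
  have "T_ka1_la2 q = subst ?\<sigma>"
    by (simp add: T_ka1_la2_eq Let_def Q_def t_def M_def d_def)
  then show ?thesis
    using subst_in_birat[OF 1 2] by simp
qed

lemma T_ka1_la2_comm:
  shows "T_ka1_la2 q \<otimes>\<^bsub>birat\<^esub> S_a1_a2 = S_a1_a2 \<otimes>\<^bsub>birat\<^esub> T_ka1_la2 q"
    and "T_ka1_la2 q \<otimes>\<^bsub>birat\<^esub> T_half q = T_half q \<otimes>\<^bsub>birat\<^esub> T_ka1_la2 q"
    and "T_ka1_la2 q \<otimes>\<^bsub>birat\<^esub> scaling q = scaling q \<otimes>\<^bsub>birat\<^esub> T_ka1_la2 q"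
    and "T_ka1_la2 q \<otimes>\<^bsub>birat\<^esub> T_ka1_ka2_la1_la2 q = T_ka1_ka2_la1_la2 q \<otimes>\<^bsub>birat\<^esub> T_ka1_la2 q"
    and "T_ka1_la2 q ka1 = cst q * ka1" "T_ka1_la2 q ka2 = ka2" "T_ka1_la2 q aa1 = aa1"
      "T_ka1_la2 q aa2 = aa2" "T_ka1_la2 q la1 = la1"
proof -
  let ?D = "T_ka1_la2 q" and ?X = "T_half q" and ?S = S_a1_a2
  define Q where "Q = (cst q :: dvar ratfun)"
  define d where "d = aa2 * (zz * ka2 - Q * yy * ka1) + la1"
  define M where "M = zz * aa1 * aa2 * ka2 + (aa1 - yy) * la1"
  define t where "t = Q * ka1 * (aa1 - yy) + ka2 * zz"
  define N where "N = zz * aa2 * ka2 + la1"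
  define u where "u = zz - 1"
  define y1 where "y1 = yy - aa1"
  define y2 where "y2 = yy - aa2"
  \<comment> \<open>\<open>d'\<close> is the numerator of \<open>?S d\<close>. \<open>L\<close> is
    the numerator of \<open>?D N\<close> and, up to sign, of \<open>?X M\<close>; that the same
    polynomial arises from both is why the two orders of \<open>?D\<close> and \<open>?X\<close>
    agree on \<open>yy\<close> and \<open>zz\<close>.\<close>
  define d' where "d' = aa1 * (zz * y2 * ka2 - Q * yy * ka1 * y1) + la1 * y1"
  define L where "L = N * (la1 * zz - Q * ka1 * aa1 * aa2) - Q * ka1 * aa2 * la1 * yy * u"
  have nz: "Q \<noteq> 0" "N \<noteq> 0" "d \<noteq> 0" "t \<noteq> 0" "M \<noteq> 0" "u \<noteq> 0" "y1 \<noteq> 0" "y2 \<noteq> 0"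
    using q dvar_nonzero
    by (simp_all add: Q_def N_def d_def t_def M_def u_def y1_def y2_def del: right_minus_eq)
  note hom = deformation_hom birat_hom[OF T_ka1_la2_in_birat]
  have D: "?D ka1 = Q * ka1" "?D ka2 = ka2" "?D aa1 = aa1" "?D aa2 = aa2" "?D la1 = la1"
    "?D ww = ww * t / (zz * ka1)" "?D yy = M / (yy * t)" "?D zz = - (Q * ka1 * M / (ka2 * zz * d))"
    by (simp_all add: T_ka1_la2_eq Let_def subst_var flip: Q_def d_def M_def t_def)
  have DQ: "?D Q = Q"
    unfolding Q_def by (rule birat_hom(3)[OF T_ka1_la2_in_birat])
  from D show "?D ka1 = cst q * ka1" "?D ka2 = ka2" "?D aa1 = aa1" "?D aa2 = aa2" "?D la1 = la1"
    by (simp_all add: Q_def)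
  note D = D DQ
  have Qt: "Q * ka1 * M + ka2 * zz * d = N * t"
    by (simp add: N_def d_def M_def t_def algebra_simps)
  have Du: "?D u = - (N * t / (ka2 * zz * d))"
  proof -
    have "?D u = ?D zz - 1"
      by (simp add: u_def hom)
    also have "\<dots> = - ((Q * ka1 * M + ka2 * zz * d) / (ka2 * zz * d))"
      unfolding D(8) using nz by (simp add: field_simps)
    finally show ?thesis
      by (simp add: Qt)
  qed
  have DN: "?D N = L / (zz * d)"
  proof -
    have "?D N = ?D zz * aa2 * ka2 + la1"
      by (simp add: N_def hom D(2-5))
    also have "\<dots> = (la1 * zz * d - Q * ka1 * M * aa2) / (zz * d)"
      unfolding D(8) using nz by (simp add: field_simps)
    also have "la1 * zz * d - Q * ka1 * M * aa2 = L"
      by (simp add: L_def N_def d_def M_def u_def algebra_simps)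
    finally show ?thesis .
  qed
  have S: "?S zz = zz * y2 / y1" "?S y1 = y2" "?S y2 = y1" "?S Q = Q"
    by (simp_all add: hom S_a1_a2_var y1_def y2_def Q_def)
  note Sv = S_a1_a2_var(1-7)
  have SM: "?S M = M * y2 / y1"
  proof -
    have SM0: "?S M = ?S zz * aa2 * aa1 * ka2 - y2 * la1" and M0: "M = zz * aa1 * aa2 * ka2 - y1 * la1"
      by (simp_all add: M_def y1_def y2_def hom Sv algebra_simps)
    show ?thesis
      unfolding SM0 S(1) unfolding M0 using nz by (simp add: field_simps)
  qed
  have St: "?S t = t * y2 / y1"
  proof -
    have St0: "?S t = - (Q * ka1 * y2) + ka2 * ?S zz" and t0: "t = - (Q * ka1 * y1) + ka2 * zz"
      by (simp_all add: t_def y1_def y2_def hom Sv S(4) algebra_simps)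
    show ?thesis
      unfolding St0 S(1) unfolding t0 using nz by (simp add: field_simps)
  qed
  have Sd: "?S d = d' / y1"
  proof -
    have "?S d = aa1 * (?S zz * ka2 - Q * yy * ka1) + la1"
      by (simp add: d_def hom Sv S(4))
    then show ?thesis
      unfolding S(1) d'_def using nz by (simp add: field_simps)
  qed
  have Dy1: "?D yy - aa1 = - (d' / (yy * t))" and Dy2: "?D yy - aa2 = - (y1 * d / (yy * t))"
  proof -
    have "M - aa1 * yy * t = - d'" "M - aa2 * yy * t = - (y1 * d)"
      by (simp_all add: M_def t_def d_def d'_def y1_def y2_def algebra_simps)
    moreover have "?D yy - aa1 = (M - aa1 * yy * t) / (yy * t)" "?D yy - aa2 = (M - aa2 * yy * t) / (yy * t)"
      unfolding D(7) using nz by (simp_all add: field_simps)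
    ultimately show "?D yy - aa1 = - (d' / (yy * t))" "?D yy - aa2 = - (y1 * d / (yy * t))"
      by simp_all
  qed
  \<comment> \<open>Up to the factor \<open>y1\<close>, \<open>d'\<close> is the image of
    \<open>d\<close> under an automorphism, so nonvanishing is inherited.\<close>
  have "d' \<noteq> 0"
    using birat_eq_0_iff[OF S_a1_a2_in_birat, of d] Sd nz by auto
  have DSz: "?D (?S zz) = - (Q * ka1 * M * y1 / (ka2 * zz * d'))"
  proof -
    have "?D (?S zz) = ?D zz * (?D yy - aa2) / (?D yy - aa1)"
      by (simp add: hom S_a1_a2_var D(3,4))
    then show ?thesis
      unfolding Dy1 Dy2 D(8) using nz \<open>d' \<noteq> 0\<close> by (simp add: field_simps)
  qed
  show "?D \<otimes>\<^bsub>birat\<^esub> ?S = ?S \<otimes>\<^bsub>birat\<^esub> ?D"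
  proof (rule birat_eqI)
    fix v
    show "(?D \<otimes>\<^bsub>birat\<^esub> ?S) (var v) = (?S \<otimes>\<^bsub>birat\<^esub> ?D) (var v)"
    proof (cases v)
      case Z
      then show ?thesis
        unfolding birat_comp_apply using nz \<open>d' \<noteq> 0\<close>
        by (simp only: DSz D(8)) (simp add: hom Sv S SM Sd field_simps)
    qed (use nz in \<open>simp_all add: birat_comp_apply hom D Sv S SM St\<close>)
  qed (simp_all add: S_a1_a2_in_birat T_ka1_la2_in_birat)
  have X: "?X yy = zz * N / (Q * ka1 * u * yy)" "?X zz = N / (ka2 * u * yy)"
    "?X ww = - (ww / u)" "?X ka1 = ka1" "?X ka2 = ka2" "?X aa1 = aa2" "?X aa2 = aa1 / Q"
    "?X la1 = la1 / Q" "?X Q = Q"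
    using nz by (simp_all add: deformation_var deformation_hom N_def u_def Q_def field_simps)
  have XM: "?X M = - (L / (Q * Q * ka1 * u * yy))"
  proof -
    have "?X M = (?X zz * aa2 * aa1 * ka2 + (aa2 - ?X yy) * la1) / Q"
      using nz by (simp add: M_def hom X(4-) field_simps)
    also have "\<dots> = (N * (Q * ka1 * aa1 * aa2 - la1 * zz) + Q * ka1 * aa2 * la1 * yy * u) / (Q * Q * ka1 * u * yy)"
      unfolding X(1,2) using nz by (simp add: field_simps)
    also have "N * (Q * ka1 * aa1 * aa2 - la1 * zz) + Q * ka1 * aa2 * la1 * yy * u = - L"
      by (simp add: L_def algebra_simps)
    finally show ?thesis
      by simp
  qed
  have Xd: "?X d = - (M / (Q * yy))"
  proof -
    have "?X d = aa1 / Q * (?X zz * ka2 - Q * ?X yy * ka1) + la1 / Q"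
      by (simp add: d_def hom X(4-))
    also have "\<dots> = (N * aa1 * (1 - zz) + la1 * yy * u) / (Q * u * yy)"
      unfolding X(1,2) using nz by (simp add: field_simps)
    also have "N * aa1 * (1 - zz) + la1 * yy * u = - (u * M)"
      by (simp add: N_def M_def u_def algebra_simps)
    finally show ?thesis
      using nz by simp
  qed
  have Xt: "?X t = - (d / yy)"
  proof -
    have "?X t = Q * ka1 * (aa2 - ?X yy) + ka2 * ?X zz"
      by (simp add: t_def hom X(4-))
    also have "\<dots> = (Q * ka1 * aa2 * u * yy - zz * N + N) / (u * yy)"
      unfolding X(1,2) using nz by (simp add: field_simps)
    also have "Q * ka1 * aa2 * u * yy - zz * N + N = - (u * d)"
      by (simp add: N_def d_def u_def algebra_simps)
    finally show ?thesis
      using nz by simp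
  qed
  show "?D \<otimes>\<^bsub>birat\<^esub> ?X = ?X \<otimes>\<^bsub>birat\<^esub> ?D"
  proof (rule birat_eqI)
    fix v
    show "(?D \<otimes>\<^bsub>birat\<^esub> ?X) (var v) = (?X \<otimes>\<^bsub>birat\<^esub> ?D) (var v)"
    proof (cases v)
      case Z
      then show ?thesis
        unfolding birat_comp_apply using nz
        by (simp add: hom X D DN Du XM Xd field_simps)
    next
      case Y
      then show ?thesis
        unfolding birat_comp_apply using nz
        by (simp add: hom X D DN Du XM Xt field_simps)
    next
      case W
      then show ?thesis
        unfolding birat_comp_apply using nz
        by (simp add: hom X D Du Xt field_simps)
    qed (use nz in \<open>simp_all add: birat_comp_apply hom D X\<close>)
  qed (simp_all add: T_half_in_birat T_ka1_la2_in_birat)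
  \<comment> \<open>\<open>M\<close>, \<open>d\<close> and \<open>t\<close> are homogeneous for both
    scalings, so commutation with these is a count of powers of \<open>Q\<close>.\<close>
  have Sc: "scaling q M = M / Q / Q" "scaling q d = d / Q" "scaling q t = t" "scaling q Q = Q"
    using nz by (simp_all add: M_def d_def t_def hom deformation_var field_simps flip: Q_def)
      (simp_all add: hom Q_def)
  show "?D \<otimes>\<^bsub>birat\<^esub> scaling q = scaling q \<otimes>\<^bsub>birat\<^esub> ?D"
  proof (rule birat_eqI)
    fix v
    show "(?D \<otimes>\<^bsub>birat\<^esub> scaling q) (var v) = (scaling q \<otimes>\<^bsub>birat\<^esub> ?D) (var v)"
      by (cases v) (use nz in \<open>simp_all add: birat_comp_apply hom deformation_var D Sc field_simps flip: Q_def\<close>)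
  qed (simp_all add: scaling_in_birat T_ka1_la2_in_birat)
  let ?E = "T_ka1_ka2_la1_la2 q"
  have E: "?E M = Q * M" "?E d = Q * d" "?E t = Q * t" "?E Q = Q"
    using nz by (simp_all add: M_def d_def t_def hom deformation_var field_simps flip: Q_def)
      (simp_all add: hom Q_def)
  show "?D \<otimes>\<^bsub>birat\<^esub> ?E = ?E \<otimes>\<^bsub>birat\<^esub> ?D"
  proof (rule birat_eqI)
    fix v
    show "(?D \<otimes>\<^bsub>birat\<^esub> ?E) (var v) = (?E \<otimes>\<^bsub>birat\<^esub> ?D) (var v)"
      by (cases v) (use nz in \<open>simp_all add: birat_comp_apply hom deformation_var D E field_simps flip: Q_def\<close>)
  qed (simp_all add: T_ka1_ka2_la1_la2_in_birat T_ka1_la2_in_birat)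
qed

section \<open>Factorization of the translations through the square root\<close>

lemma T_half_inv_in_birat: "T_half_inv q \<in> carrier birat"
  using birat.inv_closed[OF T_half_in_birat] by (simp add: inv_T_half)

lemma T_half_inv_var:
  "T_half_inv q ka1 = ka1" "T_half_inv q ka2 = ka2" "T_half_inv q aa1 = cst q * aa2"
  "T_half_inv q aa2 = aa1" "T_half_inv q la1 = cst q * la1"
  "T_half_inv q zz = cst q * ka1 * yy / (ka2 * zz)"
  "T_half_inv q ww = ww * (1 - T_half_inv q zz)"
  "T_half_inv q yy = (T_half_inv q zz * aa1 * ka2 + cst q * la1) / (ka2 * (T_half_inv q zz - 1) * zz)"
  by (simp_all add: T_half_inv_def Let_def subst_var)

lemma T_a1_la1_eq: "T_a1_la1 q = S_a1_a2 \<otimes>\<^bsub>birat\<^esub> inv\<^bsub>birat\<^esub> (T_half q)"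
  unfolding inv_T_half T_a1_la1_def Let_def
proof (rule subst_eq_birat)
  note hom = birat_hom[OF S_a1_a2_in_birat]
  define Q where "Q = (cst q :: dvar ratfun)"
  define z' where "z' = Q * yy * (yy - aa1) * ka1 / ((yy - aa2) * ka2) / zz"
  have nz: "Q \<noteq> 0" "yy - aa1 \<noteq> 0" "yy - aa2 \<noteq> 0"
    using q dvar_nonzero by (simp_all add: Q_def del: right_minus_eq)
  have SQ: "S_a1_a2 Q = Q"
    by (simp add: Q_def hom)
  have z: "S_a1_a2 (T_half_inv q zz) = z'"
    by (simp add: T_half_inv_var hom S_a1_a2_var z'_def SQ mult_ac flip: Q_def)
  \<comment> \<open>The definition has the factor \<open>z' / (Q * ka1 * yy)\<close> where the
    product has the reciprocal of \<open>ka2\<close> times the image of \<open>zz\<close> under the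
    exchange; the definition of \<open>z'\<close> says that they agree.\<close>
  have z'z: "z' / (Q * ka1 * yy) = 1 / (ka2 * (zz * (yy - aa2) / (yy - aa1)))"
    unfolding z'_def using nz by (simp add: frac_eq_eq)
  have y: "S_a1_a2 (T_half_inv q yy) = z' * (z' * aa2 * ka2 + Q * la1) / (Q * (z' - 1) * ka1) / yy"
  proof -
    have "S_a1_a2 (T_half_inv q yy) = (z' * aa2 * ka2 + Q * la1) / (z' - 1) * (1 / (ka2 * (zz * (yy - aa2) / (yy - aa1))))"
      by (simp add: T_half_inv_var(8) hom z S_a1_a2_var SQ flip: Q_def)
    then show ?thesis
      unfolding z'z[symmetric] by (simp add: mult_ac)
  qed
  have w: "S_a1_a2 (T_half_inv q ww) = ww * (1 - z')"
    by (simp add: T_half_inv_var(7) hom z S_a1_a2_var)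
  show "(S_a1_a2 \<otimes>\<^bsub>birat\<^esub> T_half_inv q) (var v) =
      (var(A1 := cst q * aa1, Lambda1 := cst q * la1,
           W := ww * (1 - cst q * yy * (yy - aa1) * ka1 / ((yy - aa2) * ka2) / zz),
           Y := cst q * yy * (yy - aa1) * ka1 / ((yy - aa2) * ka2) / zz *
             (cst q * yy * (yy - aa1) * ka1 / ((yy - aa2) * ka2) / zz * aa2 * ka2 + cst q * la1) /
             (cst q * (cst q * yy * (yy - aa1) * ka1 / ((yy - aa2) * ka2) / zz - 1) * ka1) / yy,
           Z := cst q * yy * (yy - aa1) * ka1 / ((yy - aa2) * ka2) / zz)) v" for v
    unfolding birat_comp_apply Q_def[symmetric] unfolding z'_def[symmetric]
    by (cases v) (simp_all only: y z w dvar.distinct fun_upd_apply if_False if_True simp_thms,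
        simp_all add: T_half_inv_var(1-5) hom S_a1_a2_var SQ flip: Q_def)
qed (simp add: S_a1_a2_in_birat T_half_inv_in_birat)

text \<open>Two steps of the inverse square root multiply \<open>aa1\<close> and \<open>aa2\<close>
  by \<open>q\<close> and \<open>la1\<close> by \<open>q^2\<close>; the scaling undoes the shift of
  \<open>aa1\<close> and \<open>aa2\<close> and leaves \<open>ka1\<close> and \<open>la1\<close>
  multiplied by \<open>q\<close>. It also supplies the factor \<open>ka2 / ka1\<close> for
  \<open>ww\<close> and \<open>1 / q\<close> for \<open>yy\<close>.\<close>

lemma T_ka1_la1_eq:
  "T_ka1_la1 q =
     inv\<^bsub>birat\<^esub> (T_half q) \<otimes>\<^bsub>birat\<^esub> inv\<^bsub>birat\<^esub> (T_half q) \<otimes>\<^bsub>birat\<^esub> scaling q"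
  unfolding inv_T_half T_ka1_la1_def Let_def
proof (rule subst_eq_birat)
  let ?X = "T_half_inv q"
  note hom = birat_hom[OF T_half_inv_in_birat]
  define Q where "Q = (cst q :: dvar ratfun)"
  define z' where "z' = (Q * yy * aa1 * ka1 + Q * zz * la1) / (Q * yy\<^sup>2 * ka1 - yy * zz * ka2)"
  have nz: "Q \<noteq> 0" "Q * ka1 * yy - ka2 * zz \<noteq> 0"
    using q dvar_nonzero by (simp_all add: Q_def del: right_minus_eq)
  have XQ: "?X Q = Q"
    by (simp add: Q_def hom)
  have z1: "?X zz - 1 = (Q * ka1 * yy - ka2 * zz) / (ka2 * zz)"
    by (simp add: T_half_inv_var(6) diff_divide_distrib flip: Q_def)
  have y: "?X yy = ka2 * (Q * ka1 * yy * aa1 + Q * la1 * zz) / (zz * ka2 * (Q * ka1 * yy - ka2 * zz))"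
    unfolding T_half_inv_var(8) z1 using nz
    by (simp add: T_half_inv_var(6) field_simps flip: Q_def)
  have zz: "?X (?X zz) = z'"
  proof -
    have "?X (?X zz) = ?X (Q * ka1 * yy / (ka2 * zz))"
      by (simp only: T_half_inv_var(6) Q_def)
    also have "\<dots> = Q * ka1 * ?X yy / (ka2 * ?X zz)"
      by (simp only: hom XQ T_half_inv_var(1,2))
    also have "\<dots> = (Q * yy * aa1 * ka1 + Q * zz * la1) / (yy * (Q * ka1 * yy - ka2 * zz))"
      unfolding y T_half_inv_var(6) Q_def[symmetric] using nz by (simp add: field_simps)
    finally show ?thesis
      unfolding z'_def by (simp add: power2_eq_square algebra_simps)
  qed
  have y': "?X (?X yy) / Q = zz * (z' * aa2 * ka2 + Q * la1) / (Q * (z' - 1) * ka1) / yy"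
  proof -
    have "?X (?X yy) = ?X ((?X zz * aa1 * ka2 + Q * la1) / (ka2 * (?X zz - 1) * zz))"
      by (simp only: T_half_inv_var(8) Q_def)
    also have "\<dots> = (z' * (Q * aa2) * ka2 + Q * (Q * la1)) / (ka2 * (z' - 1) * ?X zz)"
      by (simp only: hom XQ T_half_inv_var(1-5) zz Q_def[symmetric])
    also have "\<dots> = Q * (z' * aa2 * ka2 + Q * la1) / (ka2 * (z' - 1) * ?X zz)"
      by (simp add: algebra_simps)
    finally show ?thesis
      unfolding T_half_inv_var(6) Q_def[symmetric] using nz by (simp add: mult_ac)
  qed
  have w: "ka2 * ?X (?X ww) / ka1 = ww * (z' - 1) * (Q * yy * ka1 - zz * ka2) / (zz * ka1)"
  proof -
    have "?X (?X ww) = ww * (1 - ?X zz) * (1 - z')"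
      by (simp only: T_half_inv_var(7) hom zz)
    also have "\<dots> = ww * (?X zz - 1) * (z' - 1)"
      by (simp add: algebra_simps)
    finally show ?thesis
      unfolding z1 by (simp add: mult_ac)
  qed
  show "(?X \<otimes>\<^bsub>birat\<^esub> ?X \<otimes>\<^bsub>birat\<^esub> scaling q) (var v) =
      (var(Kappa1 := cst q * ka1, Lambda1 := cst q * la1,
           W := ww * ((cst q * yy * aa1 * ka1 + cst q * zz * la1) / (cst q * yy\<^sup>2 * ka1 - yy * zz * ka2) - 1) *
             (cst q * yy * ka1 - zz * ka2) / (zz * ka1),
           Y := zz * ((cst q * yy * aa1 * ka1 + cst q * zz * la1) / (cst q * yy\<^sup>2 * ka1 - yy * zz * ka2) *
               aa2 * ka2 + cst q * la1) /
             (cst q * ((cst q * yy * aa1 * ka1 + cst q * zz * la1) / (cst q * yy\<^sup>2 * ka1 - yy * zz * ka2) - 1) *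
               ka1) / yy,
           Z := (cst q * yy * aa1 * ka1 + cst q * zz * la1) / (cst q * yy\<^sup>2 * ka1 - yy * zz * ka2))) v" for v
    unfolding birat_comp_apply Q_def[symmetric] unfolding z'_def[symmetric]
    using y' w
    by (cases v) (simp_all add: T_half_inv_var(1-5) deformation_var hom XQ nz zz flip: Q_def)
qed (simp add: scaling_in_birat T_half_inv_in_birat)

end

section \<open>The translations of type \<open>(A\<^sub>2 + A\<^sub>1)\<^sup>(\<^sup>1\<^sup>)\<close>\<close>

text \<open>The simple reflection \<open>s_1\<close> of the affine Weyl group of type
  \<open>A_2\<close>. The relation among the \<open>b_i\<close> makes \<open>b_2\<close> go to
  \<open>b_1 b_2\<close>; the factors in the images of \<open>ff0\<close> and \<open>ff2\<close> are
  reciprocal, so \<open>f_0 f_1 f_2\<close> is preserved.\<close>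

definition refl_1 :: "wvar ratfun \<Rightarrow> wvar ratfun" where
  "refl_1 =
     subst (var(B0 := bb0 * bb1, B1 := 1 / bb1, F0 := ff0 * (1 + bb1 * ff1) / (bb1 + ff1),
                F2 := ff2 * (bb1 + ff1) / (1 + bb1 * ff1)))"

lemma wvar_nonzero:
  shows "1 + bb1 * ff1 \<noteq> 0" "bb1 + ff1 \<noteq> 0" "bb0 * bb1 + bb0 * ff1 + ff0 * ff1 \<noteq> 0"
  by (rule nonzero_at[of F0 F0 F0 F0], (rule substitutes_intros refl)+, simp,
      rule nonzero_at[of F1 F1 F1 F1], (rule substitutes_intros refl)+, simp,
      rule nonzero_at[of F1 F0 F0 F0], (rule substitutes_intros refl)+, simp)

lemma refl_1_in_birat: "refl_1 \<in> carrier birat"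
  and refl_1_involution: "refl_1 \<otimes>\<^bsub>birat\<^esub> refl_1 = \<one>\<^bsub>birat\<^esub>"
proof -
  let ?\<sigma> = "var(B0 := bb0 * bb1, B1 := 1 / bb1, F0 := ff0 * (1 + bb1 * ff1) / (bb1 + ff1),
                F2 := ff2 * (bb1 + ff1) / (1 + bb1 * ff1))"
  have 1: "1 + ff1 / bb1 = (bb1 + ff1) / bb1" "1 / bb1 + ff1 = (1 + bb1 * ff1) / bb1"
    by (simp_all add: field_simps)
  have *: "substitutes ?\<sigma> (?\<sigma> v) (var v)" for v
    by (cases v) (simp_all add: substitutes_iff regular_simps wvar_nonzero 1)
  show "refl_1 \<in> carrier birat"
    unfolding refl_1_def by (rule subst_in_birat[OF * *])
  then show "refl_1 \<otimes>\<^bsub>birat\<^esub> refl_1 = \<one>\<^bsub>birat\<^esub>"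
    using birat.r_inv[of refl_1] unfolding refl_1_def inv_subst[OF * *] by blast
qed

lemma sigma_1_in_birat: "sigma_1 \<in> carrier birat"
proof -
  let ?\<sigma> = "var(F0 := 1 / ff0, F1 := 1 / ff1, F2 := 1 / ff2)"
  have *: "substitutes ?\<sigma> (?\<sigma> v) (var v)" for v
    by (cases v) (simp_all add: substitutes_iff regular_simps)
  show ?thesis
    unfolding sigma_1_def by (rule subst_in_birat[OF * *])
qed

context
  fixes r :: complex
  assumes r: "r \<noteq> 0"
begin

lemma sigma_0_in_birat: "sigma_0 r \<in> carrier birat"
proof -
  let ?\<sigma> = "var(B1 := bb0, B0 := bb2 r, F1 := ff0, F2 := ff1, F0 := ff2)"
  let ?\<tau> = "var(B0 := bb1, B1 := bb2 r, F0 := ff1, F1 := ff2, F2 := ff0)"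
  have 1: "substitutes ?\<tau> (?\<sigma> v) (var v)" for v
    by (cases v) (simp_all add: substitutes_iff regular_simps r)
  have 2: "substitutes ?\<sigma> (?\<tau> v) (var v)" for v
    by (cases v) (simp_all add: substitutes_iff regular_simps r)
  show ?thesis
    unfolding sigma_0_def by (rule subst_in_birat[OF 1 2])
qed

lemma sigma_0_var:
  "sigma_0 r bb0 = bb2 r" "sigma_0 r bb1 = bb0" "sigma_0 r ff0 = ff2" "sigma_0 r ff1 = ff0"
  "sigma_0 r ff2 = ff1"
  and sigma_0_bb2: "sigma_0 r (bb2 r) = bb1"
proof -
  show v: "sigma_0 r bb0 = bb2 r" "sigma_0 r bb1 = bb0" "sigma_0 r ff0 = ff2" "sigma_0 r ff1 = ff0"
      "sigma_0 r ff2 = ff1"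
    by (simp_all add: sigma_0_def subst_var)
  show "sigma_0 r (bb2 r) = bb1"
    using r by (simp add: birat_hom[OF sigma_0_in_birat] v)
qed

lemma refl_1_var:
  "refl_1 bb0 = bb0 * bb1" "refl_1 bb1 = 1 / bb1" "refl_1 ff0 = ff0 * (1 + bb1 * ff1) / (bb1 + ff1)"
  "refl_1 ff1 = ff1" "refl_1 ff2 = ff2 * (bb1 + ff1) / (1 + bb1 * ff1)"
  and refl_1_bb2: "refl_1 (bb2 r) = bb1 * bb2 r"
proof -
  show v: "refl_1 bb0 = bb0 * bb1" "refl_1 bb1 = 1 / bb1" "refl_1 ff0 = ff0 * (1 + bb1 * ff1) / (bb1 + ff1)"
      "refl_1 ff1 = ff1" "refl_1 ff2 = ff2 * (bb1 + ff1) / (1 + bb1 * ff1)"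
    by (simp_all add: refl_1_def subst_var)
  show "refl_1 (bb2 r) = bb1 * bb2 r"
    using r by (simp add: birat_hom[OF refl_1_in_birat] v)
qed

lemma sigma_1_var:
  "sigma_1 bb0 = bb0" "sigma_1 bb1 = bb1" "sigma_1 ff0 = 1 / ff0" "sigma_1 ff1 = 1 / ff1"
  "sigma_1 ff2 = 1 / ff2"
  and sigma_1_bb2: "sigma_1 (bb2 r) = bb2 r"
proof -
  show v: "sigma_1 bb0 = bb0" "sigma_1 bb1 = bb1" "sigma_1 ff0 = 1 / ff0" "sigma_1 ff1 = 1 / ff1"
      "sigma_1 ff2 = 1 / ff2"
    by (simp_all add: sigma_1_def subst_var)
  show "sigma_1 (bb2 r) = bb2 r"
    using r by (simp add: birat_hom[OF sigma_1_in_birat] v)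
qed

lemma sigma_0_cube: "sigma_0 r \<otimes>\<^bsub>birat\<^esub> sigma_0 r \<otimes>\<^bsub>birat\<^esub> sigma_0 r = \<one>\<^bsub>birat\<^esub>"
proof (rule birat_eqI)
  show "(sigma_0 r \<otimes>\<^bsub>birat\<^esub> sigma_0 r \<otimes>\<^bsub>birat\<^esub> sigma_0 r) (var v) = \<one>\<^bsub>birat\<^esub> (var v)" for v
    by (cases v) (simp_all only: birat_comp_apply sigma_0_var sigma_0_bb2 one_birat id_apply)
qed (simp_all add: sigma_0_in_birat)

text \<open>A conjugate of \<open>refl_1\<close>, since the square of the rotation is its inverse;
  being an automorphism is thereby inherited.\<close>

definition refl_2 :: "wvar ratfun \<Rightarrow> wvar ratfun" where
  "refl_2 = sigma_0 r \<otimes>\<^bsub>birat\<^esub> sigma_0 r \<otimes>\<^bsub>birat\<^esub> refl_1 \<otimes>\<^bsub>birat\<^esub> sigma_0 r"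

lemma refl_2_in_birat: "refl_2 \<in> carrier birat"
  by (simp add: refl_2_def sigma_0_in_birat refl_1_in_birat)

lemmas translation_hom =
  birat_hom[OF refl_1_in_birat] birat_hom[OF sigma_1_in_birat]
  birat_hom[OF sigma_0_in_birat] birat_hom[OF refl_2_in_birat]

lemma refl_2_var:
  "refl_2 bb0 = bb0 * bb2 r" "refl_2 bb1 = bb1 * bb2 r" "refl_2 (bb2 r) = 1 / bb2 r"
  "refl_2 ff0 = ff0 * (bb2 r + ff2) / (1 + bb2 r * ff2)"
  "refl_2 ff1 = ff1 * (1 + bb2 r * ff2) / (bb2 r + ff2)" "refl_2 ff2 = ff2"
proof -
  \<comment> \<open>\<open>bb2 r\<close> abbreviates a quotient. As an opaque \<open>b2\<close> it
    is not taken apart by \<open>translation_hom\<close>, and the formulas stay symmetric in the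
    three \<open>b_i\<close>.\<close>
  define b2 where "b2 = bb2 r"
  note v = sigma_0_var sigma_0_bb2 refl_1_var refl_1_bb2
  show "refl_2 bb0 = bb0 * bb2 r" "refl_2 bb1 = bb1 * bb2 r" "refl_2 (bb2 r) = 1 / bb2 r"
    "refl_2 ff0 = ff0 * (bb2 r + ff2) / (1 + bb2 r * ff2)"
    "refl_2 ff1 = ff1 * (1 + bb2 r * ff2) / (bb2 r + ff2)" "refl_2 ff2 = ff2"
    unfolding b2_def[symmetric]
    by (simp_all only: refl_2_def birat_comp_apply v[folded b2_def] translation_hom mult.commute)
qed

lemma refl_braid:
  "refl_1 \<otimes>\<^bsub>birat\<^esub> refl_2 \<otimes>\<^bsub>birat\<^esub> refl_1 = refl_2 \<otimes>\<^bsub>birat\<^esub> refl_1 \<otimes>\<^bsub>birat\<^esub> refl_2"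
  and T_0_eq: "T_0 r = refl_1 \<otimes>\<^bsub>birat\<^esub> refl_2 \<otimes>\<^bsub>birat\<^esub> sigma_0 r"
proof -
  define b2 where "b2 = bb2 r"
  define n1 where "n1 = bb1 + ff1"
  define m1 where "m1 = 1 + bb1 * ff1"
  define n2 where "n2 = b2 + ff2"
  define m2 where "m2 = 1 + b2 * ff2"
  \<comment> \<open>\<open>V\<close>, \<open>U\<close> are the numerators of the images of
    \<open>n2\<close>, \<open>m2\<close> under \<open>refl_1\<close>, and \<open>A\<close>,
    \<open>C\<close> those of \<open>n1\<close>, \<open>m1\<close> under \<open>refl_2\<close>. The
    braid relation rests on \<open>refl_1\<close> fixing \<open>A\<close> and \<open>refl_2\<close>
    fixing \<open>U\<close>, while \<open>C\<close> and \<open>V\<close> only acquire a known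
    factor.\<close>
  define U where "U = m1 + bb1 * b2 * ff2 * n1"
  define V where "V = bb1 * b2 * m1 + ff2 * n1"
  define A where "A = bb1 * b2 * n2 + ff1 * m2"
  define C where "C = n2 + bb1 * b2 * ff1 * m2"
  have b2: "b2 \<noteq> 0"
    using r by (simp add: b2_def)
  have nz: "n1 \<noteq> 0" "m1 \<noteq> 0"
    using wvar_nonzero by (simp_all add: n1_def m1_def)
  \<comment> \<open>The double rotation carries \<open>n1\<close>, \<open>m1\<close> to
    \<open>n2\<close>, \<open>m2\<close>, so nonvanishing is inherited.\<close>
  have s: "sigma_0 r (sigma_0 r n1) = n2" "sigma_0 r (sigma_0 r m1) = m2"
    by (simp_all only: n1_def m1_def n2_def m2_def sigma_0_var sigma_0_bb2 translation_hom b2_def)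
  then have nz: "n1 \<noteq> 0" "m1 \<noteq> 0" "n2 \<noteq> 0" "m2 \<noteq> 0"
    using nz by (auto simp: birat_eq_0_iff[OF sigma_0_in_birat])
  note r1 = refl_1_var[folded n1_def m1_def] refl_1_bb2[folded b2_def]
  note r2 = refl_2_var[folded b2_def, folded n2_def m2_def]
  have r1n2: "refl_1 n2 = V / m1"
    unfolding n2_def V_def using nz by (simp add: translation_hom r1 field_simps)
  have r1m2: "refl_1 m2 = U / m1"
    unfolding m2_def U_def using nz by (simp add: translation_hom r1 field_simps)
  have r2n1: "refl_2 n1 = A / n2"
    unfolding n1_def A_def using nz by (simp add: translation_hom r2 field_simps)
  have r2m1: "refl_2 m1 = C / n2"
    unfolding m1_def C_def using nz by (simp add: translation_hom r2 field_simps)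
  have nz': "U \<noteq> 0" "V \<noteq> 0" "A \<noteq> 0" "C \<noteq> 0"
    using nz r1n2 r1m2 r2n1 r2m1 by (auto simp: birat_eq_0_iff[OF refl_1_in_birat] birat_eq_0_iff[OF refl_2_in_birat])
  have r1n1: "refl_1 n1 = m1 / bb1" and r1m1: "refl_1 m1 = n1 / bb1"
    by (simp_all add: n1_def m1_def translation_hom r1(1,2,4,6) field_simps)
  have r2n2: "refl_2 n2 = m2 / b2" and r2m2: "refl_2 m2 = n2 / b2"
    using b2 by (simp_all add: n2_def m2_def translation_hom r2(1-3,6) field_simps)
  have r1A: "refl_1 A = A"
  proof -
    have "refl_1 A = b2 * (V / m1) + ff1 * (U / m1)"
      by (simp add: A_def translation_hom r1 r1n2 r1m2)
    also have "\<dots> = (b2 * V + ff1 * U) / m1"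
      by (simp add: add_divide_distrib)
    also have "b2 * V + ff1 * U = A * m1"
      by (simp add: A_def U_def V_def n1_def m1_def n2_def m2_def algebra_simps)
    finally show ?thesis
      using nz by simp
  qed
  have r1C: "refl_1 C = C * n1 / m1"
  proof -
    have "refl_1 C = V / m1 + b2 * ff1 * (U / m1)"
      by (simp add: C_def translation_hom r1 r1n2 r1m2)
    also have "\<dots> = (V + b2 * ff1 * U) / m1"
      by (simp add: add_divide_distrib)
    also have "V + b2 * ff1 * U = C * n1"
      by (simp add: C_def U_def V_def n1_def m1_def n2_def m2_def algebra_simps)
    finally show ?thesis .
  qed
  have r2U: "refl_2 U = U"
  proof -
    have "refl_2 U = C / n2 + bb1 * ff2 * (A / n2)"
      using b2 by (simp add: U_def translation_hom r2 r2n1 r2m1)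
    also have "\<dots> = (C + bb1 * ff2 * A) / n2"
      by (simp add: add_divide_distrib)
    also have "C + bb1 * ff2 * A = U * n2"
      by (simp add: A_def C_def U_def n1_def m1_def n2_def m2_def algebra_simps)
    finally show ?thesis
      using nz by simp
  qed
  have r2V: "refl_2 V = V * m2 / n2"
  proof -
    have "refl_2 V = bb1 * (C / n2) + ff2 * (A / n2)"
      using b2 by (simp add: V_def translation_hom r2 r2n1 r2m1)
    also have "\<dots> = (bb1 * C + ff2 * A) / n2"
      by (simp add: add_divide_distrib)
    also have "bb1 * C + ff2 * A = V * m2"
      by (simp add: A_def C_def V_def n1_def m1_def n2_def m2_def algebra_simps)
    finally show ?thesis .
  qed
  show "refl_1 \<otimes>\<^bsub>birat\<^esub> refl_2 \<otimes>\<^bsub>birat\<^esub> refl_1 = refl_2 \<otimes>\<^bsub>birat\<^esub> refl_1 \<otimes>\<^bsub>birat\<^esub> refl_2"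
  proof (rule birat_eqI)
    show "(refl_1 \<otimes>\<^bsub>birat\<^esub> refl_2 \<otimes>\<^bsub>birat\<^esub> refl_1) (var v) = (refl_2 \<otimes>\<^bsub>birat\<^esub> refl_1 \<otimes>\<^bsub>birat\<^esub> refl_2) (var v)" for v
      by (cases v) (use nz nz' b2 in \<open>simp_all add: birat_comp_apply translation_hom r1 r2 r1n2 r1m2 r2n1 r2m1
          r1n1 r1m1 r2n2 r2m2 r1A r1C r2U r2V field_simps\<close>)
  qed (simp_all add: refl_1_in_birat refl_2_in_birat)
  show "T_0 r = refl_1 \<otimes>\<^bsub>birat\<^esub> refl_2 \<otimes>\<^bsub>birat\<^esub> sigma_0 r"
    unfolding T_0_def Let_def
  proof (rule subst_eq_birat)
    define f0' where "f0' = qc2 * (bb1 + ff1) / (ff1 * (bb1 * ff1 + 1)) / ff0"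
    define f1' where "f1' = qc2 * (bb0 * f0' + cst r) / (f0' * (bb0 + cst r * f0')) / ff1"
    \<comment> \<open>With \<open>cst r\<close> written as the product of the \<open>b_i\<close>, a
      factor \<open>bb0\<close> comes out of the numerator and the denominator of
      \<open>f1'\<close>.\<close>
    have R: "cst r = bb0 * bb1 * b2"
      using r by (simp add: b2_def)
    have f0': "f0' = ff2 * n1 / m1"
      by (simp add: f0'_def n1_def m1_def add.commute mult_ac)
    have "f1' = ff0 * ff2 * (f0' + bb1 * b2) / (f0' * (1 + bb1 * b2 * f0'))"
    proof -
      have "bb0 * f0' + cst r = bb0 * (f0' + bb1 * b2)" "bb0 + cst r * f0' = bb0 * (1 + bb1 * b2 * f0')"
        by (simp_all add: R algebra_simps)
      then show ?thesis
        by (simp add: f1'_def mult_ac)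
    qed
    moreover have "f0' + bb1 * b2 = V / m1" "1 + bb1 * b2 * f0' = U / m1"
      unfolding f0' V_def U_def using nz by (simp_all add: field_simps)
    ultimately have "f1' = ff0 * ff2 * (V / m1) / (f0' * (U / m1))"
      by simp
    then have f1': "f1' = ff0 * m1 * V / (n1 * U)"
      unfolding f0' using nz nz' by (simp add: field_simps)
    show "(refl_1 \<otimes>\<^bsub>birat\<^esub> refl_2 \<otimes>\<^bsub>birat\<^esub> sigma_0 r) (var v) =
      (var(B0 := bb0 / cst r, B1 := cst r * bb1,
        F0 := qc2 * (bb1 + ff1) / (ff1 * (bb1 * ff1 + 1)) / ff0,
        F1 := qc2 * (bb0 * (qc2 * (bb1 + ff1) / (ff1 * (bb1 * ff1 + 1)) / ff0) + cst r) /
          (qc2 * (bb1 + ff1) / (ff1 * (bb1 * ff1 + 1)) / ff0 *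
           (bb0 + cst r * (qc2 * (bb1 + ff1) / (ff1 * (bb1 * ff1 + 1)) / ff0))) / ff1,
        F2 := qc2 / (qc2 * (bb1 + ff1) / (ff1 * (bb1 * ff1 + 1)) / ff0 *
          (qc2 * (bb0 * (qc2 * (bb1 + ff1) / (ff1 * (bb1 * ff1 + 1)) / ff0) + cst r) /
           (qc2 * (bb1 + ff1) / (ff1 * (bb1 * ff1 + 1)) / ff0 *
            (bb0 + cst r * (qc2 * (bb1 + ff1) / (ff1 * (bb1 * ff1 + 1)) / ff0))) / ff1)))) v" for v
      unfolding f0'_def[symmetric] unfolding f1'_def[symmetric] unfolding f0' f1'
      by (cases v) (use nz nz' b2 in \<open>simp_all add: birat_comp_apply sigma_0_var[folded b2_def] translation_hom r1 r2
          r1n2 r1m2 R field_simps\<close>)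
  qed (simp add: refl_1_in_birat refl_2_in_birat sigma_0_in_birat)
qed

text \<open>\<open>w_0\<close> is a reflection of the \<open>A_1\<close> factor and therefore
  commutes with the \<open>A_2\<close> part. Only \<open>refl_1\<close> and the rotation have to be
  tested, as the other reflections are conjugates of \<open>refl_1\<close> by rotations.\<close>

lemma w_0_in_birat: "w_0 r \<in> carrier birat"
  and w_0_refl_1: "w_0 r \<otimes>\<^bsub>birat\<^esub> refl_1 = refl_1 \<otimes>\<^bsub>birat\<^esub> w_0 r"
  and w_0_sigma_0: "w_0 r \<otimes>\<^bsub>birat\<^esub> sigma_0 r = sigma_0 r \<otimes>\<^bsub>birat\<^esub> w_0 r"
  and w_0_var: "w_0 r bb0 = bb0" "w_0 r bb1 = bb1" "w_0 r qc2 = cst (r\<^sup>2) / qc2"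
proof -
  define b2 where "b2 = bb2 r"
  define g0 where "g0 = b2 * bb0 + b2 * ff0 + ff2 * ff0"
  define g1 where "g1 = bb0 * bb1 + bb0 * ff1 + ff0 * ff1"
  define g2 where "g2 = bb1 * b2 + bb1 * ff2 + ff1 * ff2"
  let ?\<sigma> = "var(F0 := bb0 * bb1 * g0 / (ff2 * g1), F1 := bb1 * b2 * g1 / (ff0 * g2),
                F2 := b2 * bb0 * g2 / (ff1 * g0))"
  note sv = sigma_0_var[folded b2_def] sigma_0_bb2[folded b2_def]
  have b2: "b2 \<noteq> 0"
    using r by (simp add: b2_def)
  have s: "sigma_0 r g0 = g2" "sigma_0 r g1 = g0" "sigma_0 r g2 = g1"
    by (simp_all only: g0_def g1_def g2_def sv translation_hom mult.commute)
  have "g1 \<noteq> 0"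
    using wvar_nonzero by (simp add: g1_def)
  with s(2) have "g0 \<noteq> 0"
    by (auto simp: birat_eq_0_iff[OF sigma_0_in_birat])
  with s(1) have "g2 \<noteq> 0"
    by (auto simp: birat_eq_0_iff[OF sigma_0_in_birat])
  note nz = \<open>g0 \<noteq> 0\<close> \<open>g1 \<noteq> 0\<close> \<open>g2 \<noteq> 0\<close> b2
  define \<sigma> where "\<sigma> = ?\<sigma>"
  have \<sigma>: "\<sigma> B0 = bb0" "\<sigma> B1 = bb1" "\<sigma> F0 = bb0 * bb1 * g0 / (ff2 * g1)"
    "\<sigma> F1 = bb1 * b2 * g1 / (ff0 * g2)" "\<sigma> F2 = b2 * bb0 * g2 / (ff1 * g0)"
    by (simp_all add: \<sigma>_def)
  have b: "regular \<sigma> b2" "subst \<sigma> b2 = b2"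
    by (simp_all add: b2_def regular_simps \<sigma>(1,2))
  have G: "regular \<sigma> g0" "subst \<sigma> g0 = b2 * bb0 + b2 * \<sigma> F0 + \<sigma> F2 * \<sigma> F0"
    "regular \<sigma> g1" "subst \<sigma> g1 = bb0 * bb1 + bb0 * \<sigma> F1 + \<sigma> F0 * \<sigma> F1"
    "regular \<sigma> g2" "subst \<sigma> g2 = bb1 * b2 + bb1 * \<sigma> F2 + \<sigma> F1 * \<sigma> F2"
    by (simp_all add: g0_def g1_def g2_def regular_simps b \<sigma>(1,2))
  \<comment> \<open>Three rotations of one computation: each numerator collapses to a product of two
    of the \<open>g\<close>s, which makes the substitution its own inverse.\<close>
  have "subst \<sigma> g0 = b2 * bb0 * (ff1 * ff2 * g1 + bb1 * ff1 * g0 + bb0 * bb1 * g2) / (ff1 * ff2 * g1)"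
    unfolding G \<sigma> using nz by (simp add: field_simps)
  also have "ff1 * ff2 * g1 + bb1 * ff1 * g0 + bb0 * bb1 * g2 = g2 * g1"
    by (simp add: g0_def g1_def g2_def algebra_simps)
  finally have G0: "subst \<sigma> g0 = b2 * bb0 * g2 / (ff1 * ff2)"
    using nz by simp
  have "subst \<sigma> g1 = bb0 * bb1 * (ff2 * ff0 * g2 + b2 * ff2 * g1 + bb1 * b2 * g0) / (ff2 * ff0 * g2)"
    unfolding G \<sigma> using nz by (simp add: field_simps)
  also have "ff2 * ff0 * g2 + b2 * ff2 * g1 + bb1 * b2 * g0 = g0 * g2"
    by (simp add: g0_def g1_def g2_def algebra_simps)
  finally have G1: "subst \<sigma> g1 = bb0 * bb1 * g0 / (ff2 * ff0)"
    using nz by simp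
  have "subst \<sigma> g2 = bb1 * b2 * (ff0 * ff1 * g0 + bb0 * ff0 * g2 + b2 * bb0 * g1) / (ff0 * ff1 * g0)"
    unfolding G \<sigma> using nz by (simp add: field_simps)
  also have "ff0 * ff1 * g0 + bb0 * ff0 * g2 + b2 * bb0 * g1 = g1 * g0"
    by (simp add: g0_def g1_def g2_def algebra_simps)
  finally have G2: "subst \<sigma> g2 = bb1 * b2 * g1 / (ff0 * ff1)"
    using nz by simp
  have *: "substitutes \<sigma> (\<sigma> v) (var v)" for v
    by (cases v; simp add: substitutes_iff \<sigma> regular_simps b G(1,3,5) G0 G1 G2 nz; simp add: nz field_simps)
  have w0: "w_0 r = subst \<sigma>"
    by (simp only: \<sigma>_def w_0_def Let_def b2_def g0_def g1_def g2_def)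
  show w: "w_0 r \<in> carrier birat"
    unfolding w0 by (rule subst_in_birat[OF * *])
  note hom = translation_hom birat_hom[OF w]
  have v: "w_0 r bb0 = bb0" "w_0 r bb1 = bb1" "w_0 r b2 = b2" "w_0 r ff0 = bb0 * bb1 * g0 / (ff2 * g1)"
    "w_0 r ff1 = bb1 * b2 * g1 / (ff0 * g2)" "w_0 r ff2 = b2 * bb0 * g2 / (ff1 * g0)"
    by (simp_all add: w0 subst_var b \<sigma>)
  show "w_0 r bb0 = bb0" "w_0 r bb1 = bb1"
    by (fact v)+
  have "w_0 r qc2 = (bb0 * bb1 * b2)\<^sup>2 / qc2"
    using nz by (simp add: hom v field_simps power2_eq_square)
  moreover have "bb0 * bb1 * b2 = cst r"
    by (simp add: b2_def)
  ultimately show "w_0 r qc2 = cst (r\<^sup>2) / qc2"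
    by (simp add: cst_power)
  show "w_0 r \<otimes>\<^bsub>birat\<^esub> sigma_0 r = sigma_0 r \<otimes>\<^bsub>birat\<^esub> w_0 r"
  proof (rule birat_eqI)
    show "(w_0 r \<otimes>\<^bsub>birat\<^esub> sigma_0 r) (var x) = (sigma_0 r \<otimes>\<^bsub>birat\<^esub> w_0 r) (var x)" for x
      by (cases x) (simp_all only: birat_comp_apply v sv s hom mult.commute)
  qed (simp_all add: w sigma_0_in_birat)
  define n where "n = bb1 + ff1"
  define m where "m = 1 + bb1 * ff1"
  \<comment> \<open>\<open>refl_1\<close> merely rescales \<open>g1\<close> and \<open>g2\<close>,
    but its value at \<open>g0\<close> is a new expression. It is kept as \<open>G\<close> because
    it reappears in \<open>w_0 r m\<close>.\<close>
  define G where "G = refl_1 g0"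
  have nz': "n \<noteq> 0" "m \<noteq> 0" "G \<noteq> 0"
    using wvar_nonzero nz by (simp_all add: n_def m_def G_def birat_eq_0_iff[OF refl_1_in_birat])
  note r1 = refl_1_var[folded n_def m_def] refl_1_bb2[folded b2_def]
  have r0: "G = bb1 * bb1 * b2 * bb0 + bb1 * b2 * ff0 * m / n + ff2 * ff0"
    using nz' by (simp add: G_def g0_def translation_hom r1)
  have rg1: "refl_1 g1 = g1 * m / n"
  proof -
    have "refl_1 g1 = bb0 + bb0 * bb1 * ff1 + ff0 * ff1 * m / n"
      using nz' by (simp add: g1_def translation_hom r1)
    also have "\<dots> = m * (bb0 * n + ff0 * ff1) / n"
      using nz' by (simp add: field_simps m_def)
    finally show ?thesis
      by (simp add: g1_def n_def algebra_simps)
  qed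
  have rg2: "refl_1 g2 = g2 / bb1"
  proof -
    have "refl_1 g2 = (bb1 * b2 + ff2 * n * (1 + bb1 * ff1) / m) / bb1"
      using nz' by (simp add: g2_def translation_hom r1 field_simps)
    also have "ff2 * n * (1 + bb1 * ff1) / m = ff2 * n"
      unfolding m_def[symmetric] using nz' by simp
    finally show ?thesis
      by (simp add: g2_def n_def algebra_simps)
  qed
  have wn: "w_0 r n = bb1 * n * g0 / (ff0 * g2)"
  proof -
    have "w_0 r n = bb1 * (ff0 * g2 + b2 * g1) / (ff0 * g2)"
      using nz by (simp add: n_def hom v field_simps)
    also have "ff0 * g2 + b2 * g1 = n * g0"
      by (simp add: g0_def g1_def g2_def n_def algebra_simps)
    finally show ?thesis
      by (simp add: mult_ac)
  qed
  have wm: "w_0 r m = n * G / (ff0 * g2)"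
  proof -
    have "w_0 r m = (ff0 * g2 + bb1 * bb1 * b2 * g1) / (ff0 * g2)"
      using nz by (simp add: m_def hom v field_simps)
    also have "ff0 * g2 + bb1 * bb1 * b2 * g1 = n * (bb1 * bb1 * b2 * bb0 + ff2 * ff0) + bb1 * b2 * ff0 * m"
      by (simp add: g1_def g2_def n_def m_def algebra_simps)
    also have "\<dots> = n * G"
      unfolding r0 using nz' by (simp add: field_simps)
    finally show ?thesis .
  qed
  show "w_0 r \<otimes>\<^bsub>birat\<^esub> refl_1 = refl_1 \<otimes>\<^bsub>birat\<^esub> w_0 r"
  proof (rule birat_eqI)
    show "(w_0 r \<otimes>\<^bsub>birat\<^esub> refl_1) (var x) = (refl_1 \<otimes>\<^bsub>birat\<^esub> w_0 r) (var x)" for x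
      by (cases x) (use nz nz' in \<open>simp_all add: birat_comp_apply v r1 hom rg1 rg2 wn wm field_simps flip: G_def\<close>)
  qed (simp_all add: w refl_1_in_birat)
qed

lemma sigma_1_comm:
  "sigma_1 \<otimes>\<^bsub>birat\<^esub> refl_1 = refl_1 \<otimes>\<^bsub>birat\<^esub> sigma_1"
  "sigma_1 \<otimes>\<^bsub>birat\<^esub> sigma_0 r = sigma_0 r \<otimes>\<^bsub>birat\<^esub> sigma_1"
proof -
  \<comment> \<open>Inverting \<open>ff1\<close> exchanges the two linear factors in
    \<open>refl_1\<close> up to division by \<open>ff1\<close>.\<close>
  have *: "1 + bb1 / ff1 = (bb1 + ff1) / ff1" "bb1 + 1 / ff1 = (1 + bb1 * ff1) / ff1"
    by (simp_all add: field_simps)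
  show "sigma_1 \<otimes>\<^bsub>birat\<^esub> refl_1 = refl_1 \<otimes>\<^bsub>birat\<^esub> sigma_1"
  proof (rule birat_eqI)
    show "(sigma_1 \<otimes>\<^bsub>birat\<^esub> refl_1) (var x) = (refl_1 \<otimes>\<^bsub>birat\<^esub> sigma_1) (var x)" for x
      by (cases x) (simp_all add: birat_comp_apply translation_hom refl_1_var sigma_1_var *)
  qed (simp_all add: refl_1_in_birat sigma_1_in_birat)
  show "sigma_1 \<otimes>\<^bsub>birat\<^esub> sigma_0 r = sigma_0 r \<otimes>\<^bsub>birat\<^esub> sigma_1"
  proof (rule birat_eqI)
    show "(sigma_1 \<otimes>\<^bsub>birat\<^esub> sigma_0 r) (var x) = (sigma_0 r \<otimes>\<^bsub>birat\<^esub> sigma_1) (var x)" for x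
      by (cases x) (simp_all add: birat_comp_apply translation_hom sigma_0_var sigma_1_var sigma_0_bb2 sigma_1_bb2)
  qed (simp_all add: sigma_0_in_birat sigma_1_in_birat)
qed

end

section \<open>Commuting elements\<close>

text \<open>The elements that commute with \<open>x\<close> form a subgroup.\<close>

lemma (in group) commutes_generate:
  assumes "S \<subseteq> carrier G" "x \<in> carrier G" "\<And>s. s \<in> S \<Longrightarrow> x \<otimes> s = s \<otimes> x" "y \<in> generate G S"
  shows "x \<otimes> y = y \<otimes> x"
  using assms(4)
proof induction
  case (inv h)
  then have h: "h \<in> carrier G" "x \<otimes> h = h \<otimes> x"
    using assms by auto
  have "inv h \<otimes> x \<otimes> h = x"
    using h assms(2) by (simp add: m_assoc) (simp add: assms(2) h(1) flip: m_assoc)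
  then have "inv h \<otimes> x = x \<otimes> inv h"
    using h assms(2) by (subst inv_solve_right) auto
  then show ?case
    by simp
next
  case (eng y z)
  then have c: "y \<in> carrier G" "z \<in> carrier G"
    using generate_in_carrier[OF assms(1)] by auto
  have "x \<otimes> (y \<otimes> z) = y \<otimes> x \<otimes> z"
    using c assms(2) by (simp add: eng.IH flip: m_assoc)
  also have "\<dots> = y \<otimes> z \<otimes> x"
    using c assms(2) by (simp add: eng.IH m_assoc)
  finally show ?case .
qed (use assms in auto)

lemma (in group) comm_group_subgroup_generated_commuting:
  assumes S: "S \<subseteq> carrier G" and comm: "\<And>x y. x \<in> S \<Longrightarrow> y \<in> S \<Longrightarrow> x \<otimes> y = y \<otimes> x"
  shows "comm_group (subgroup_generated G S)"
proof (rule group.group_comm_groupI)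
  \<comment> \<open>One argument at a time is extended from \<open>S\<close> to the generated
    subgroup.\<close>
  have 1: "y \<otimes> x = x \<otimes> y" if "x \<in> S" "y \<in> generate G S" for x y
    using commutes_generate[OF S _ comm, of x y] that S by auto
  have "x \<otimes> y = y \<otimes> x" if "x \<in> generate G S" "y \<in> generate G S" for x y
    using commutes_generate[OF S _ _ that(2), of x] 1 that(1) generate_in_carrier[OF S] by auto
  then show "x \<otimes>\<^bsub>subgroup_generated G S\<^esub> y = y \<otimes>\<^bsub>subgroup_generated G S\<^esub> x"
    if "x \<in> carrier (subgroup_generated G S)" "y \<in> carrier (subgroup_generated G S)" for x y
    using that S by (simp add: carrier_subgroup_generated Int_absorb1)
qed simp

text \<open>Surjectivity of \<open>monomial\<close> onto \<open>L\<close> is a statement about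
  generation inside \<open>L\<close> itself, not inside the ambient group.\<close>

lemma (in group) generate_subgroup_generated:
  assumes "S \<subseteq> carrier G"
  shows "generate (subgroup_generated G S) S = carrier (subgroup_generated G S)"
  using subgroup_generated2[of S] subgroup_generated_subset_carrier_subset[OF assms]
  by (metis carrier_subgroup_generated inf.absorb_iff2)

section \<open>The free abelian group of rank five and its quotient\<close>

abbreviation (input) int_vectors :: "(nat \<Rightarrow> int) monoid" where
  "int_vectors \<equiv> product_group {..<5} (\<lambda>_. integer_group)"

text \<open>The restriction to \<open>{..<5}\<close> is there because the elements of a product
  group are extensional functions.\<close>

definition int_vec :: "int \<Rightarrow> int \<Rightarrow> int \<Rightarrow> int \<Rightarrow> int \<Rightarrow> nat \<Rightarrow> int" where
  "int_vec a b c d e = (\<lambda>i\<in>{..<5}. [a, b, c, d, e] ! i)"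

lemma int_vec_in_carrier: "int_vec a b c d e \<in> carrier int_vectors"
  by (simp add: int_vec_def)

lemma int_vec_nth:
  "int_vec a b c d e 0 = a" "int_vec a b c d e (Suc 0) = b" "int_vec a b c d e 2 = c"
  "int_vec a b c d e 3 = d" "int_vec a b c d e 4 = e"
  by (simp_all add: int_vec_def)

lemma int_vectors_eqI:
  assumes "m \<in> carrier int_vectors" "n \<in> carrier int_vectors"
    "m 0 = n 0" "m 1 = n 1" "m 2 = n 2" "m 3 = n 3" "m 4 = n 4"
  shows "m = n"
proof (rule PiE_ext)
  show "m \<in> ({..<5} \<rightarrow>\<^sub>E UNIV)" "n \<in> ({..<5} \<rightarrow>\<^sub>E UNIV)"
    using assms by simp_all
  show "m i = n i" if "i \<in> {..<5}" for i
  proof -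
    have "i \<in> {0, 1, 2, 3, 4}"
      using that by auto
    then show ?thesis
      using assms by auto
  qed
qed

locale five_elements = comm_group +
  fixes a0 a1 a2 a3 a4 :: 'a
  assumes closed: "a0 \<in> carrier G" "a1 \<in> carrier G" "a2 \<in> carrier G" "a3 \<in> carrier G" "a4 \<in> carrier G"
begin

definition monomial :: "(nat \<Rightarrow> int) \<Rightarrow> 'a" where
  "monomial n = a0 [^] n 0 \<otimes> a1 [^] n 1 \<otimes> a2 [^] n 2 \<otimes> a3 [^] n 3 \<otimes> a4 [^] n 4"

lemma monomial_hom: "monomial \<in> hom int_vectors G"
proof (rule homI)
  show "monomial n \<in> carrier G" for n
    by (simp add: monomial_def closed)
  show "monomial (m \<otimes>\<^bsub>int_vectors\<^esub> n) = monomial m \<otimes> monomial n" for m n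
    by (simp add: monomial_def closed int_pow_mult m_ac)
qed

lemma monomial_surj:
  assumes "generate G {a0, a1, a2, a3, a4} = carrier G"
  shows "monomial ` carrier int_vectors = carrier G"
proof -
  interpret h: group_hom int_vectors G monomial
    by (intro group_hom.intro group_hom_axioms.intro monomial_hom product_group) auto
  have "monomial (int_vec 1 0 0 0 0) = a0" "monomial (int_vec 0 1 0 0 0) = a1"
    "monomial (int_vec 0 0 1 0 0) = a2" "monomial (int_vec 0 0 0 1 0) = a3"
    "monomial (int_vec 0 0 0 0 1) = a4"
    by (simp_all add: monomial_def int_vec_nth closed int_pow_1)
  then have "{a0, a1, a2, a3, a4} \<subseteq> monomial ` carrier int_vectors"
    by (metis image_eqI int_vec_in_carrier insert_subset empty_subsetI)
  then have "generate G {a0, a1, a2, a3, a4} \<subseteq> monomial ` carrier int_vectors"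
    by (rule generate_subgroup_incl[OF _ h.img_is_subgroup])
  moreover have "monomial ` carrier int_vectors \<subseteq> carrier G"
    using monomial_hom by (auto simp: hom_def)
  ultimately show ?thesis
    using assms by auto
qed

lemma monomial_iso:
  assumes "generate G {a0, a1, a2, a3, a4} = carrier G"
    and indep: "\<And>n. monomial n = \<one> \<Longrightarrow> n 0 = 0 \<and> n 1 = 0 \<and> n 2 = 0 \<and> n 3 = 0 \<and> n 4 = 0"
  shows "monomial \<in> iso int_vectors G"
proof -
  interpret h: group_hom int_vectors G monomial
    by (intro group_hom.intro group_hom_axioms.intro monomial_hom product_group) auto
  have "n = \<one>\<^bsub>int_vectors\<^esub>" if n: "n \<in> carrier int_vectors" "monomial n = \<one>" for n
    using indep[OF n(2)] by (intro int_vectors_eqI n(1) h.G.one_closed) auto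
  then have "kernel int_vectors G monomial = {\<one>\<^bsub>int_vectors\<^esub>}"
    using h.G.one_closed h.hom_one unfolding kernel_def by blast
  then have "inj_on monomial (carrier int_vectors)"
    by (rule h.trivial_ker_imp_inj)
  then show ?thesis
    using monomial_hom monomial_surj[OF assms(1)] by (auto simp: iso_def bij_betw_def)
qed

end

text \<open>The isomorphism theorem \<open>FactGroup_iso_set\<close> uses \<open>the_elem\<close> of
  the image of a coset; this evaluates it on the coset of \<open>x\<close>.\<close>

lemma (in group_hom) the_elem_rcos_kernel:
  assumes "x \<in> carrier G"
  shows "the_elem (h ` (kernel G H h #> x)) = h x"
proof -
  have "h ` (kernel G H h #> x) = {h x}"
    using assms subgroup.one_closed[OF subgroup_kernel]
    by (auto simp: r_coset_def kernel_def image_def intro!: exI[of _ "\<one>"])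
  then show ?thesis
    by simp
qed

text \<open>
  The homomorphism \<open>L \<rightarrow> V\<close> that matches the generators has kernel \<open>N\<close>, because the only relations
  of \<open>y1, y2, y3, y4\<close> are the powers of \<open>y1 y2 y3 = 1\<close>.
\<close>

lemma quotient_iso:
  fixes L :: "'a monoid" and V :: "'b monoid"
  assumes L: "five_elements L a0 a1 a2 a3 a4" and iso: "five_elements.monomial L a0 a1 a2 a3 a4 \<in> iso int_vectors L"
    and V: "comm_group V" and y: "y1 \<in> carrier V" "y2 \<in> carrier V" "y3 \<in> carrier V" "y4 \<in> carrier V"
    and gen: "generate V {y1, y2, y3, y4} = carrier V"
    and rel: "y1 \<otimes>\<^bsub>V\<^esub> y2 \<otimes>\<^bsub>V\<^esub> y3 = \<one>\<^bsub>V\<^esub>"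
    and indep: "\<And>(a :: int) (b :: int) (c :: int) (d :: int). y1 [^]\<^bsub>V\<^esub> a \<otimes>\<^bsub>V\<^esub> y2 [^]\<^bsub>V\<^esub> b \<otimes>\<^bsub>V\<^esub> y3 [^]\<^bsub>V\<^esub> c \<otimes>\<^bsub>V\<^esub> y4 [^]\<^bsub>V\<^esub> d = \<one>\<^bsub>V\<^esub>
      \<Longrightarrow> a = b \<and> b = c \<and> d = 0"
    and N: "N = generate L {a0, inv\<^bsub>L\<^esub> a1 \<otimes>\<^bsub>L\<^esub> a3 \<otimes>\<^bsub>L\<^esub> inv\<^bsub>L\<^esub> a2}"
  shows "\<exists>h \<in> iso V (L Mod N). h y1 = N #>\<^bsub>L\<^esub> inv\<^bsub>L\<^esub> a1 \<and> h y2 = N #>\<^bsub>L\<^esub> a3 \<and>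
    h y3 = N #>\<^bsub>L\<^esub> inv\<^bsub>L\<^esub> a2 \<and> h y4 = N #>\<^bsub>L\<^esub> a4 \<and> h (inv\<^bsub>V\<^esub> y4) = N #>\<^bsub>L\<^esub> inv\<^bsub>L\<^esub> a4"
proof -
  interpret L: five_elements L a0 a1 a2 a3 a4 by (rule L)
  interpret V: comm_group V by (rule V)
  interpret P: group int_vectors by simp
  \<comment> \<open>\<open>\<psi>\<close> forgets the exponent of \<open>a0\<close>; the signs
    express that \<open>a1\<close> and \<open>a2\<close> go to the inverses of \<open>y1\<close> and
    \<open>y3\<close>.\<close>
  define \<psi> where "\<psi> n = y1 [^]\<^bsub>V\<^esub> (- n 1) \<otimes>\<^bsub>V\<^esub> y2 [^]\<^bsub>V\<^esub> n 3 \<otimes>\<^bsub>V\<^esub> y3 [^]\<^bsub>V\<^esub> (- n 2) \<otimes>\<^bsub>V\<^esub> y4 [^]\<^bsub>V\<^esub> n 4"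
    for n :: "nat \<Rightarrow> int"
  have \<psi>: "\<psi> \<in> hom int_vectors V"
  proof (rule homI)
    show "\<psi> (m \<otimes>\<^bsub>int_vectors\<^esub> n) = \<psi> m \<otimes>\<^bsub>V\<^esub> \<psi> n" for m n
      by (simp add: \<psi>_def y V.int_pow_mult V.int_pow_diff V.int_pow_neg V.inv_mult V.m_ac)
  qed (simp add: \<psi>_def y)
  \<comment> \<open>As \<open>monomial\<close> is bijective, exponents are unique, so
    \<open>\<psi>\<close> induces a map on \<open>L\<close>.\<close>
  define g where "g = \<psi> \<circ> inv_into (carrier int_vectors) L.monomial"
  have inv: "inv_into (carrier int_vectors) L.monomial \<in> iso L int_vectors"
    by (rule P.iso_set_sym[OF iso])
  have g_hom: "g \<in> hom L V"
    unfolding g_def by (rule hom_compose[OF _ \<psi>]) (use inv in \<open>simp add: iso_def\<close>)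
  interpret g: group_hom L V g
    by (intro group_hom.intro group_hom_axioms.intro g_hom) auto
  have g: "g (L.monomial n) = \<psi> n" if "n \<in> carrier int_vectors" for n
    using iso that by (simp add: g_def iso_def bij_betw_def inv_into_f_f del: carrier_product_group)
  have mono: "L.monomial (int_vec 1 0 0 0 0) = a0" "L.monomial (int_vec 0 1 0 0 0) = a1"
    "L.monomial (int_vec 0 0 1 0 0) = a2" "L.monomial (int_vec 0 0 0 1 0) = a3"
    "L.monomial (int_vec 0 0 0 0 1) = a4"
    by (simp_all add: L.monomial_def int_vec_nth L.closed L.int_pow_1)
  have ga: "g a0 = \<one>\<^bsub>V\<^esub>" "g a1 = inv\<^bsub>V\<^esub> y1" "g a2 = inv\<^bsub>V\<^esub> y3" "g a3 = y2" "g a4 = y4"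
    using g[OF int_vec_in_carrier, of 1 0 0 0 0] g[OF int_vec_in_carrier, of 0 1 0 0 0]
      g[OF int_vec_in_carrier, of 0 0 1 0 0] g[OF int_vec_in_carrier, of 0 0 0 1 0]
      g[OF int_vec_in_carrier, of 0 0 0 0 1]
    by (simp_all add: mono \<psi>_def int_vec_nth y V.int_pow_neg V.int_pow_1)
  let ?s = "inv\<^bsub>L\<^esub> a1 \<otimes>\<^bsub>L\<^esub> a3 \<otimes>\<^bsub>L\<^esub> inv\<^bsub>L\<^esub> a2"
  have s: "?s \<in> carrier L"
    by (simp add: L.closed)
  have subN: "subgroup N L"
    unfolding N by (rule L.generate_is_subgroup) (use L.closed s in auto)
  have ker: "kernel L V g = N"
  proof
    show "N \<subseteq> kernel L V g"
      unfolding N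
    proof (rule L.generate_subgroup_incl[OF _ g.subgroup_kernel])
      show "{a0, ?s} \<subseteq> kernel L V g"
        using L.closed s y rel by (simp add: kernel_def ga)
    qed
    show "kernel L V g \<subseteq> N"
    proof
      fix x assume x: "x \<in> kernel L V g"
      then have "x \<in> L.monomial ` carrier int_vectors"
        using iso by (simp add: kernel_def iso_def bij_betw_def del: carrier_product_group)
      then obtain n where n: "n \<in> carrier int_vectors" "x = L.monomial n"
        by auto
      then have "\<psi> n = \<one>\<^bsub>V\<^esub>"
        using x g by (simp add: kernel_def)
      then have "- n 1 = n 3" "- n 2 = n 3" "n 4 = 0"
        using indep[of "- n 1" "n 3" "- n 2" "n 4"] by (auto simp: \<psi>_def)
      then have "n 1 = - n 3" "n 2 = - n 3" "n 4 = 0"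
        by auto
      \<comment> \<open>The exponent vector is \<open>(n 0, - n 3, - n 3, n 3, 0)\<close>.\<close>
      then have "x = a0 [^]\<^bsub>L\<^esub> n 0 \<otimes>\<^bsub>L\<^esub> ?s [^]\<^bsub>L\<^esub> n 3"
        using n L.closed by (simp add: L.monomial_def L.int_pow_distrib L.int_pow_neg L.int_pow_inv L.m_ac)
      moreover have "a0 \<in> N" "?s \<in> N"
        unfolding N by (auto intro: generate.incl)
      ultimately show "x \<in> N"
        using subN by (simp add: subgroup.m_closed L.subgroup_int_pow_closed)
    qed
  qed
  have "g ` carrier L = carrier V"
  proof
    show "g ` carrier L \<subseteq> carrier V"
      by auto
    have "g (inv\<^bsub>L\<^esub> a1) = y1" "g (inv\<^bsub>L\<^esub> a2) = y3"
      using L.closed y by (simp_all add: ga)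
    then have "{y1, y2, y3, y4} \<subseteq> g ` carrier L"
      by (metis L.closed L.inv_closed ga(4,5) empty_subsetI image_eqI insert_subset)
    then show "carrier V \<subseteq> g ` carrier L"
      unfolding gen[symmetric] by (rule V.generate_subgroup_incl[OF _ g.img_is_subgroup])
  qed
  then have fact: "(\<lambda>X. the_elem (g ` X)) \<in> iso (L Mod N) V"
    using g.FactGroup_iso_set by (simp add: ker)
  interpret N: normal N L
    using g.normal_kernel by (simp add: ker)
  \<comment> \<open>The isomorphism theorem gives the direction from the quotient to
    \<open>V\<close>; the matching is stated in the opposite one.\<close>
  define h where "h = inv_into (carrier (L Mod N)) (\<lambda>X. the_elem (g ` X))"
  have h: "h (g x) = N #>\<^bsub>L\<^esub> x" if "x \<in> carrier L" for x
    unfolding h_def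
  proof (rule inv_into_f_eq)
    show "inj_on (\<lambda>X. the_elem (g ` X)) (carrier (L Mod N))"
      using fact by (simp add: iso_def bij_betw_def)
    show "N #>\<^bsub>L\<^esub> x \<in> carrier (L Mod N)"
      using that by (auto simp: FactGroup_def RCOSETS_def)
    show "the_elem (g ` (N #>\<^bsub>L\<^esub> x)) = g x"
      using g.the_elem_rcos_kernel[OF that] by (simp add: ker)
  qed
  have "h \<in> iso V (L Mod N)"
    unfolding h_def by (rule group.iso_set_sym[OF N.factorgroup_is_group fact])
  moreover have "h y1 = N #>\<^bsub>L\<^esub> inv\<^bsub>L\<^esub> a1" "h y2 = N #>\<^bsub>L\<^esub> a3" "h y3 = N #>\<^bsub>L\<^esub> inv\<^bsub>L\<^esub> a2"
    "h y4 = N #>\<^bsub>L\<^esub> a4" "h (inv\<^bsub>V\<^esub> y4) = N #>\<^bsub>L\<^esub> inv\<^bsub>L\<^esub> a4"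
    using h[of "inv\<^bsub>L\<^esub> a1"] h[of a3] h[of "inv\<^bsub>L\<^esub> a2"] h[of a4] h[of "inv\<^bsub>L\<^esub> a4"] L.closed y
    by (simp_all add: ga)
  ultimately show ?thesis
    by blast
qed


section \<open>Action on the parameters\<close>

text \<open>An eigenvector condition. It includes membership in \<open>birat\<close>, so the rules
  for products, inverses and powers chain without further conditions on the maps.\<close>

definition scales :: "('v::linorder ratfun \<Rightarrow> 'v ratfun) \<Rightarrow> 'v ratfun \<Rightarrow> complex \<Rightarrow> bool" where
  "scales \<phi> x c \<longleftrightarrow> \<phi> \<in> carrier birat \<and> \<phi> x = cst c * x"

lemma scales_mult: "scales \<phi> x c \<Longrightarrow> scales \<psi> x d \<Longrightarrow> scales (\<phi> \<otimes>\<^bsub>birat\<^esub> \<psi>) x (c * d)"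
  unfolding scales_def by (simp add: birat_comp_apply birat_hom(2,3) cst_mult mult_ac)

lemma scales_inv:
  assumes "scales \<phi> x c" "c \<noteq> 0"
  shows "scales (inv\<^bsub>birat\<^esub> \<phi>) x (inverse c)"
proof -
  have \<phi>: "\<phi> \<in> carrier birat" "\<phi> x = cst c * x"
    using assms by (simp_all add: scales_def)
  have "(inv\<^bsub>birat\<^esub> \<phi>) (\<phi> (cst (inverse c) * x)) = cst (inverse c) * x"
    by (rule birat_inv_apply[OF \<phi>(1)])
  moreover have "\<phi> (cst (inverse c) * x) = cst (inverse c * c) * x"
    by (simp add: birat_hom[OF \<phi>(1)] \<phi>(2) cst_mult)
  ultimately show ?thesis
    using \<phi>(1) assms(2) by (simp add: scales_def)
qed

lemma scales_int_pow:
  assumes \<phi>: "scales \<phi> x c" "c \<noteq> 0"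
  shows "scales (\<phi> [^]\<^bsub>birat\<^esub> (n :: int)) x (c powi n)"
proof -
  have \<phi>': "\<phi> \<in> carrier birat"
    using \<phi>(1) by (simp add: scales_def)
  have pow: "scales (\<phi> [^]\<^bsub>birat\<^esub> (k :: nat)) x (c ^ k)" for k
  proof (induction k)
    case 0
    show ?case
      by (simp add: scales_def) (simp add: one_birat)
  next
    case (Suc k)
    then show ?case
      using scales_mult[OF Suc \<phi>(1)] by (simp add: mult.commute[of c])
  qed
  show ?thesis
  proof (cases n rule: int_cases2)
    case (nonneg k)
    then show ?thesis
      by (simp only: int_pow_int power_int_of_nat pow)
  next
    case (nonpos k)
    show ?thesis
      unfolding nonpos birat.int_pow_neg_int[OF \<phi>'] power_int_minus power_int_of_nat
      by (rule scales_inv[OF pow]) (simp add: \<phi>(2))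
  qed
qed

lemma scales_one: "scales \<one>\<^bsub>birat\<^esub> x c \<Longrightarrow> x \<noteq> 0 \<Longrightarrow> c = 1"
  by (simp add: scales_def one_birat) (metis cst_1 cst_eq_iff)

lemma power_int_eq_1_imp:
  fixes c :: complex
  assumes "norm c \<noteq> 1" "c \<noteq> 0" "c powi n = 1"
  shows "n = 0"
proof (rule ccontr)
  assume "n \<noteq> 0"
  have "norm c powi n = 1"
    using assms(3) by (metis norm_one norm_power_int)
  then have "norm c ^ nat \<bar>n\<bar> = 1"
    by (cases n rule: int_cases2) (simp_all add: power_int_minus)
  moreover have "nat \<bar>n\<bar> > 0"
    using \<open>n \<noteq> 0\<close> by simp
  ultimately have "norm c = 1"
    using power_eq_imp_eq_base[of "norm c" "nat \<bar>n\<bar>" 1] by simp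
  then show False
    using assms(1) by simp
qed

lemma birat_pointwise: "\<phi> \<otimes>\<^bsub>birat\<^esub> \<psi> = \<phi>' \<otimes>\<^bsub>birat\<^esub> \<psi>' \<Longrightarrow> \<phi> (\<psi> u) = \<phi>' (\<psi>' u)"
  by (simp add: mult_birat fun_eq_iff)

section \<open>Commutativity of the deformations and their action on the parameters\<close>

context
  fixes q :: complex
  assumes q: "q \<noteq> 0"
begin

lemma
  shows T_a1_la1_in_birat: "T_a1_la1 q \<in> carrier birat"
    and T_a2_la1_in_birat: "T_a2_la1 q \<in> carrier birat"
    and T_ka1_la1_in_birat: "T_ka1_la1 q \<in> carrier birat"
proof -
  show *: "T_a1_la1 q \<in> carrier birat"
    by (simp add: T_a1_la1_eq q S_a1_a2_in_birat T_half_in_birat)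
  then show "T_a2_la1 q \<in> carrier birat"
    by (simp add: T_a2_la1_def S_a1_a2_in_birat)
  show "T_ka1_la1 q \<in> carrier birat"
    by (simp add: T_ka1_la1_eq q scaling_in_birat T_half_in_birat)
qed

lemmas gens_in_birat =
  T_ka1_ka2_la1_la2_in_birat[OF q] T_a1_la1_in_birat T_a2_la1_in_birat T_ka1_la1_in_birat T_ka1_la2_in_birat[OF q]

lemma gens_commute:
    "S \<in> {T_ka1_ka2_la1_la2 q, T_a1_la1 q, T_a2_la1 q, T_ka1_la1 q, T_ka1_la2 q} \<Longrightarrow>
     T \<in> {T_ka1_ka2_la1_la2 q, T_a1_la1 q, T_a2_la1 q, T_ka1_la1 q, T_ka1_la2 q} \<Longrightarrow>
     S \<otimes>\<^bsub>birat\<^esub> T = T \<otimes>\<^bsub>birat\<^esub> S"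
  and T_scaling_eq: "T_scaling q = scaling q"
proof -
  let ?E = "T_ka1_ka2_la1_la2 q" and ?D = "T_ka1_la2 q" and ?c = "scaling q" and ?s = S_a1_a2
  define x where "x = T_half q"
  define x' where "x' = inv\<^bsub>birat\<^esub> x"
  have x: "x \<in> carrier birat"
    by (simp add: x_def T_half_in_birat q)
  \<comment> \<open>The relations are turned into rewrite rules on values. They move
    \<open>?c\<close>, \<open>?E\<close>, \<open>?D\<close> inward and \<open>?s\<close> outward
    past \<open>x'\<close> applied twice, which brings both sides of every commutation to the same
    word.\<close>
  have xx [simp]: "x (x' u) = u" "x' (x u) = u" for u
    by (simp_all add: x'_def x birat_inv_apply)
  have ss [simp]: "?s (?s u) = u" for u
    using fun_cong[OF S_a1_a2_involution, of u] by (simp add: mult_birat one_birat)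
  have xxs: "?s (x (x u)) = x (x (?s u))" for u
    using fun_cong[OF T_half_sq_S_a1_a2[OF q], of u] by (simp add: mult_birat x_def)
  have xs [simp]: "x' (x' (?s u)) = ?s (x' (x' u))" for u
  proof -
    have "x' (x' (?s (x (x (x' (x' u)))))) = ?s (x' (x' u))"
      unfolding xxs by simp
    then show ?thesis
      by simp
  qed
  have comm [simp]: "?c (?s u) = ?s (?c u)" "?c (x u) = x (?c u)" "?E (?s u) = ?s (?E u)"
    "?E (x u) = x (?E u)" "?E (?c u) = ?c (?E u)" "?D (?s u) = ?s (?D u)" "?D (x u) = x (?D u)"
    "?D (?c u) = ?c (?D u)" "?D (?E u) = ?E (?D u)" for u
    unfolding x_def
    by (intro birat_pointwise scaling_comm T_ka1_la2_comm q)+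
  have comm' [simp]: "?c (x' u) = x' (?c u)" "?E (x' u) = x' (?E u)" "?D (x' u) = x' (?D u)" for u
    using comm(2,4,7)[of "x' u", THEN arg_cong[where f = x']] by (simp_all only: xx)
  have a1: "T_a1_la1 q = ?s \<circ> x'"
    by (simp add: T_a1_la1_eq q mult_birat x_def x'_def)
  have s': "inv\<^bsub>birat\<^esub> ?s = ?s"
    by (rule group.inv_equality[OF group_birat S_a1_a2_involution S_a1_a2_in_birat S_a1_a2_in_birat])
  have a2: "T_a2_la1 q = x' \<circ> ?s"
    by (simp add: T_a2_la1_def a1 s' mult_birat fun_eq_iff)
  have k: "T_ka1_la1 q = x' \<circ> x' \<circ> ?c"
    by (simp add: T_ka1_la1_eq q mult_birat x_def x'_def)
  show "S \<otimes>\<^bsub>birat\<^esub> T = T \<otimes>\<^bsub>birat\<^esub> S"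
    if "S \<in> {T_ka1_ka2_la1_la2 q, T_a1_la1 q, T_a2_la1 q, T_ka1_la1 q, T_ka1_la2 q}"
      "T \<in> {T_ka1_ka2_la1_la2 q, T_a1_la1 q, T_a2_la1 q, T_ka1_la1 q, T_ka1_la2 q}"
    using that by (auto simp: mult_birat a1 a2 k fun_eq_iff)
  \<comment> \<open>Both sides equal \<open>x' x' ?c\<close>; solving for \<open>?c\<close> yields
    the composite.\<close>
  have "T_ka1_la1 q = T_a1_la1 q \<otimes>\<^bsub>birat\<^esub> ?c \<otimes>\<^bsub>birat\<^esub> T_a2_la1 q"
    by (simp add: mult_birat a1 a2 k fun_eq_iff)
  then show "T_scaling q = ?c"
    unfolding T_scaling_def
    using T_a1_la1_in_birat T_a2_la1_in_birat scaling_in_birat[OF q]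
    by (simp add: birat.m_assoc) (simp add: birat.inv_solve_left flip: birat.m_assoc)
qed

lemma params_scale:
  "T_ka1_ka2_la1_la2 q ka1 = cst q * ka1" "T_ka1_ka2_la1_la2 q ka2 = cst q * ka2"
  "T_ka1_ka2_la1_la2 q aa1 = aa1" "T_ka1_ka2_la1_la2 q aa2 = aa2" "T_ka1_ka2_la1_la2 q la1 = cst q * la1"
  "T_a1_la1 q ka1 = ka1" "T_a1_la1 q ka2 = ka2" "T_a1_la1 q aa1 = cst q * aa1" "T_a1_la1 q aa2 = aa2"
  "T_a1_la1 q la1 = cst q * la1"
  "T_a2_la1 q ka1 = ka1" "T_a2_la1 q ka2 = ka2" "T_a2_la1 q aa1 = aa1" "T_a2_la1 q aa2 = cst q * aa2"
  "T_a2_la1 q la1 = cst q * la1"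
  "T_ka1_la1 q ka1 = cst q * ka1" "T_ka1_la1 q ka2 = ka2" "T_ka1_la1 q aa1 = aa1" "T_ka1_la1 q aa2 = aa2"
  "T_ka1_la1 q la1 = cst q * la1"
  "T_ka1_la2 q ka1 = cst q * ka1" "T_ka1_la2 q ka2 = ka2" "T_ka1_la2 q aa1 = aa1" "T_ka1_la2 q aa2 = aa2"
  "T_ka1_la2 q la1 = la1"
proof -
  have a1: "T_a1_la1 q ka1 = ka1" "T_a1_la1 q ka2 = ka2" "T_a1_la1 q aa1 = cst q * aa1"
    "T_a1_la1 q aa2 = aa2" "T_a1_la1 q la1 = cst q * la1"
    by (simp_all add: T_a1_la1_def Let_def subst_var)
  then show "T_a1_la1 q ka1 = ka1" "T_a1_la1 q ka2 = ka2" "T_a1_la1 q aa1 = cst q * aa1"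
    "T_a1_la1 q aa2 = aa2" "T_a1_la1 q la1 = cst q * la1"
    by simp_all
  have s': "inv\<^bsub>birat\<^esub> S_a1_a2 = S_a1_a2"
    by (rule group.inv_equality[OF group_birat S_a1_a2_involution S_a1_a2_in_birat S_a1_a2_in_birat])
  show "T_a2_la1 q ka1 = ka1" "T_a2_la1 q ka2 = ka2" "T_a2_la1 q aa1 = aa1" "T_a2_la1 q aa2 = cst q * aa2"
    "T_a2_la1 q la1 = cst q * la1"
    by (simp_all add: T_a2_la1_def s' birat_comp_apply S_a1_a2_var a1 birat_hom[OF S_a1_a2_in_birat])
qed (simp_all add: T_ka1_ka2_la1_la2_def T_ka1_la1_def T_ka1_la2_def Let_def subst_var)

end

section \<open>Commutativity of the translations and their action on the parameters\<close>

context
  fixes r :: complex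
  assumes r: "r \<noteq> 0"
begin

lemma
  shows T_0_in_birat: "T_0 r \<in> carrier birat" and T_1_in_birat: "T_1 r \<in> carrier birat"
    and T_2_in_birat: "T_2 r \<in> carrier birat" and T_3_in_birat: "T_3 r \<in> carrier birat"
proof -
  show *: "T_0 r \<in> carrier birat"
    by (simp add: T_0_eq r refl_1_in_birat refl_2_in_birat sigma_0_in_birat)
  then show "T_1 r \<in> carrier birat" "T_2 r \<in> carrier birat"
    by (simp_all add: T_1_def T_2_def r sigma_0_in_birat)
  show "T_3 r \<in> carrier birat"
    by (simp add: T_3_def r w_0_in_birat sigma_1_in_birat)
qed

lemma translations_commute:
    "S \<in> {T_0 r, T_1 r, T_2 r, T_3 r} \<Longrightarrow> T \<in> {T_0 r, T_1 r, T_2 r, T_3 r} \<Longrightarrow>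
     S \<otimes>\<^bsub>birat\<^esub> T = T \<otimes>\<^bsub>birat\<^esub> S"
  and T_0_T_1_T_2: "T_0 r \<otimes>\<^bsub>birat\<^esub> T_1 r \<otimes>\<^bsub>birat\<^esub> T_2 r = \<one>\<^bsub>birat\<^esub>"
proof -
  define \<sigma> where "\<sigma> = sigma_0 r"
  define s1 where "s1 = refl_1"
  define s2 where "s2 u = \<sigma> (\<sigma> (s1 (\<sigma> u)))" for u
  define s0 where "s0 u = \<sigma> (s1 (\<sigma> (\<sigma> u)))" for u
  have \<sigma>\<sigma> [simp]: "\<sigma> (\<sigma> (\<sigma> u)) = u" for u
    using fun_cong[OF sigma_0_cube[OF r], of u] by (simp add: \<sigma>_def mult_birat one_birat)
  have s1s1 [simp]: "s1 (s1 u) = u" for u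
    using fun_cong[OF refl_1_involution, of u] by (simp add: s1_def mult_birat one_birat)
  have [simp]: "s0 (s0 u) = u" "s2 (s2 u) = u" for u
    by (simp_all add: s0_def s2_def)
  \<comment> \<open>These rules collect the rotations on the right, shifting indices:
    \<open>T_1\<close> becomes \<open>s0 s1 \<sigma>\<close> and \<open>T_2\<close> becomes
    \<open>s2 s0 \<sigma>\<close>. Both orders of \<open>T_0\<close> and \<open>T_1\<close> then
    reduce to \<open>s1 s0 \<sigma>^2\<close>.\<close>
  have \<sigma>s [simp]: "\<sigma> (s1 u) = s0 (\<sigma> u)" "\<sigma> (s2 u) = s1 (\<sigma> u)" "\<sigma> (s0 u) = s2 (\<sigma> u)" for u
    by (simp_all add: s0_def s2_def)
  have s2: "refl_2 r u = s2 u" for u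
    by (simp add: refl_2_def r mult_birat s2_def s1_def \<sigma>_def)
  have b12 [simp]: "s1 (s2 (s1 u)) = s2 (s1 (s2 u))" for u
    using fun_cong[OF refl_braid[OF r], of u] by (simp add: mult_birat s2 s1_def)
  \<comment> \<open>The other two braid relations are rotations of the first.\<close>
  have b01 [simp]: "s0 (s1 (s0 u)) = s1 (s0 (s1 u))" for u
    using arg_cong[OF b12[of "\<sigma> (\<sigma> u)"], of \<sigma>] by (simp only: \<sigma>s \<sigma>\<sigma>)
  have b20 [simp]: "s0 (s2 (s0 u)) = s2 (s0 (s2 u))" for u
    using arg_cong[OF b01[of "\<sigma> (\<sigma> u)"], of \<sigma>] by (simp only: \<sigma>s \<sigma>\<sigma>)
  have T0: "T_0 r = s1 \<circ> s2 \<circ> \<sigma>"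
    by (simp add: T_0_eq r mult_birat s2 s1_def \<sigma>_def fun_eq_iff)
  have T1: "T_1 r = \<sigma> \<circ> T_0 r \<circ> \<sigma> \<circ> \<sigma>" and T2: "T_2 r = \<sigma> \<circ> \<sigma> \<circ> T_0 r \<circ> \<sigma>"
    by (simp_all add: T_1_def T_2_def mult_birat \<sigma>_def comp_assoc)
  have c3: "T_3 r (\<sigma> u) = \<sigma> (T_3 r u)" "T_3 r (s1 u) = s1 (T_3 r u)" for u
    using birat_pointwise[OF w_0_sigma_0[OF r], of u] birat_pointwise[OF w_0_refl_1[OF r], of u]
      birat_pointwise[OF sigma_1_comm(1)[OF r], of "w_0 r u"] birat_pointwise[OF sigma_1_comm(2)[OF r], of "w_0 r u"]
    by (simp_all add: T_3_def mult_birat \<sigma>_def s1_def)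
  then have c3': "T_3 r (s0 u) = s0 (T_3 r u)" "T_3 r (s2 u) = s2 (T_3 r u)" for u
    by (simp_all only: s0_def s2_def)
  show "S \<otimes>\<^bsub>birat\<^esub> T = T \<otimes>\<^bsub>birat\<^esub> S"
    if "S \<in> {T_0 r, T_1 r, T_2 r, T_3 r}" "T \<in> {T_0 r, T_1 r, T_2 r, T_3 r}"
    using that by (auto simp: mult_birat T0 T1 T2 c3 c3' fun_eq_iff)
  show "T_0 r \<otimes>\<^bsub>birat\<^esub> T_1 r \<otimes>\<^bsub>birat\<^esub> T_2 r = \<one>\<^bsub>birat\<^esub>"
    by (simp add: mult_birat one_birat T0 T1 T2 fun_eq_iff)
qed

text \<open>\<open>bb0\<close>, \<open>bb1\<close> and \<open>f_0 f_1 f_2\<close> are common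
  eigenvectors of the four translations. Factors \<open>cst 1\<close> are written out to fit
  \<open>scales\<close>.\<close>

lemma translations_scale:
  "T_0 r bb0 = cst (inverse r) * bb0" "T_0 r bb1 = cst r * bb1" "T_0 r qc2 = cst 1 * qc2"
  "T_1 r bb0 = cst r * bb0" "T_1 r bb1 = cst 1 * bb1" "T_1 r qc2 = cst 1 * qc2"
  "T_2 r bb0 = cst 1 * bb0" "T_2 r bb1 = cst (inverse r) * bb1" "T_2 r qc2 = cst 1 * qc2"
  "T_3 r bb0 = cst 1 * bb0" "T_3 r bb1 = cst 1 * bb1" "T_3 r qc2 = cst (r\<^sup>2) * qc2"
proof -
  have inv: "cst (inverse r) = (1 / cst r :: wvar ratfun)"
    using r by (simp add: field_simps flip: cst_mult)
  note h = birat_hom[OF sigma_0_in_birat[OF r]] birat_hom[OF T_0_in_birat] birat_hom[OF sigma_1_in_birat]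
  have T0: "T_0 r bb0 = bb0 / cst r" "T_0 r bb1 = cst r * bb1"
    by (simp_all add: T_0_def Let_def subst_var)
  then have T0': "T_0 r (bb2 r) = bb2 r"
    using r by (simp add: h)
  have \<sigma>Q: "sigma_0 r qc2 = qc2"
    by (simp add: h sigma_0_var[OF r])
  have "refl_1 qc2 = qc2"
    using wvar_nonzero(1,2) by (simp add: birat_hom[OF refl_1_in_birat] refl_1_var[OF r])
  then have T0Q: "T_0 r qc2 = qc2"
    by (simp only: T_0_eq[OF r] refl_2_def[OF r] birat_comp_apply \<sigma>Q)
  show "T_0 r bb0 = cst (inverse r) * bb0" "T_0 r bb1 = cst r * bb1" "T_0 r qc2 = cst 1 * qc2"
    using T0Q by (simp_all add: T0 inv)
  note v = sigma_0_var[OF r] sigma_0_bb2[OF r]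
  show "T_1 r bb0 = cst r * bb0" "T_1 r bb1 = cst 1 * bb1" "T_1 r qc2 = cst 1 * qc2"
    "T_2 r bb0 = cst 1 * bb0" "T_2 r bb1 = cst (inverse r) * bb1" "T_2 r qc2 = cst 1 * qc2"
    unfolding T_1_def T_2_def birat_comp_apply v \<sigma>Q T0 T0' T0Q cst_1 inv
    by (simp_all only: h v T0 T0' T0Q \<sigma>Q mult_1_left) simp
  have "T_3 r qc2 = cst (r\<^sup>2) / (sigma_1 qc2)"
    unfolding T_3_def birat_comp_apply w_0_var(3)[OF r] by (simp only: h)
  also have "sigma_1 qc2 = 1 / qc2"
    by (simp add: h sigma_1_var[OF r])
  finally show "T_3 r qc2 = cst (r\<^sup>2) * qc2"
    by simp
  show "T_3 r bb0 = cst 1 * bb0" "T_3 r bb1 = cst 1 * bb1"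
    by (simp_all add: T_3_def birat_comp_apply w_0_var[OF r] sigma_1_var[OF r])
qed

end

theorem mainTheorem1:
  fixes q r :: complex
  assumes "norm q \<noteq> 1" and "q \<noteq> 0" and "r\<^sup>2 = q"
  defines "gens \<equiv> {T_ka1_ka2_la1_la2 q, T_a1_la1 q, T_a2_la1 q, T_ka1_la1 q, T_ka1_la2 q}"
    and "L \<equiv> deformation_lattice q"
    and "N \<equiv> generate (deformation_lattice q) {T_ka1_ka2_la1_la2 q, T_scaling q}"
    and "V \<equiv> translation_group r"
  shows
    "gens \<subseteq> carrier birat \<and>
     {T_0 r, T_1 r, T_2 r, T_3 r} \<subseteq> carrier birat \<and>
     \<comment> \<open>the generators commute and are a basis\<close>
     (\<forall>S\<in>gens. \<forall>T\<in>gens. S \<otimes>\<^bsub>birat\<^esub> T = T \<otimes>\<^bsub>birat\<^esub> S) \<and>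
     (\<lambda>n. T_ka1_ka2_la1_la2 q [^]\<^bsub>birat\<^esub> (n 0 :: int) \<otimes>\<^bsub>birat\<^esub> T_a1_la1 q [^]\<^bsub>birat\<^esub> (n 1 :: int)
           \<otimes>\<^bsub>birat\<^esub> T_a2_la1 q [^]\<^bsub>birat\<^esub> (n 2 :: int) \<otimes>\<^bsub>birat\<^esub> T_ka1_la1 q [^]\<^bsub>birat\<^esub> (n 3 :: int)
           \<otimes>\<^bsub>birat\<^esub> T_ka1_la2 q [^]\<^bsub>birat\<^esub> (n 4 :: int))
       \<in> iso (product_group {..<5::nat} (\<lambda>_. integer_group)) L \<and>
     \<comment> \<open>the composite transformation\<close>
     T_scaling q ka1 = cst q * ka1 \<and> T_scaling q ka2 = ka2 \<and>
     T_scaling q aa1 = aa1 / cst q \<and> T_scaling q aa2 = aa2 / cst q \<and>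
     T_scaling q la1 = la1 / cst q \<and> T_scaling q la2 = la2 \<and>
     T_scaling q ww = ka2 * ww / ka1 \<and> T_scaling q yy = yy / cst q \<and> T_scaling q zz = zz \<and>
     \<comment> \<open>the correspondences and the quotient\<close>
     T_0 r \<otimes>\<^bsub>birat\<^esub> T_1 r \<otimes>\<^bsub>birat\<^esub> T_2 r = \<one>\<^bsub>birat\<^esub> \<and>
     N \<lhd> L \<and>
     (\<forall>((u\<^sub>0, u\<^sub>1, u\<^sub>2), u\<^sub>3) \<in> correspondences q.
        u\<^sub>0 \<otimes>\<^bsub>birat\<^esub> u\<^sub>1 \<otimes>\<^bsub>birat\<^esub> u\<^sub>2 = T_scaling q \<and>
        (\<exists>h \<in> iso V (L Mod N).
           h (T_0 r) = N #>\<^bsub>L\<^esub> u\<^sub>0 \<and> h (T_1 r) = N #>\<^bsub>L\<^esub> u\<^sub>1 \<and>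
           h (T_2 r) = N #>\<^bsub>L\<^esub> u\<^sub>2 \<and> h (T_3 r) = N #>\<^bsub>L\<^esub> u\<^sub>3 \<and>
           h \<one>\<^bsub>V\<^esub> = N #>\<^bsub>L\<^esub> T_scaling q)) \<and>
     V \<cong> L Mod N"
proof -
  have r: "r \<noteq> 0" and norm_r: "norm r \<noteq> 1"
    using assms(1-3) by (auto simp: norm_power)
  let ?E = "T_ka1_ka2_la1_la2 q" and ?a1 = "T_a1_la1 q" and ?a2 = "T_a2_la1 q"
    and ?k = "T_ka1_la1 q" and ?D = "T_ka1_la2 q"
  let ?Ts = "{T_0 r, T_1 r, T_2 r, T_3 r}"
  have L_eq: "L = subgroup_generated birat gens" and V_eq: "V = subgroup_generated birat ?Ts"
    by (simp_all only: L_def gens_def deformation_lattice_def V_def translation_group_def)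
  have gens: "gens \<subseteq> carrier birat"
    using gens_in_birat[OF assms(2)] by (simp add: gens_def)
  have Ts: "?Ts \<subseteq> carrier birat"
    by (simp add: T_0_in_birat T_1_in_birat T_2_in_birat T_3_in_birat r)
  have comm: "S \<otimes>\<^bsub>birat\<^esub> T = T \<otimes>\<^bsub>birat\<^esub> S" if "S \<in> gens" "T \<in> gens" for S T
    using gens_commute(1)[OF assms(2)] that by (simp only: gens_def)
  interpret L: comm_group L
    unfolding L_eq by (rule birat.comm_group_subgroup_generated_commuting[OF gens comm])
  interpret V: comm_group V
    unfolding V_eq by (rule birat.comm_group_subgroup_generated_commuting[OF Ts translations_commute(1)[OF r]])
  have gens_L: "gens \<subseteq> carrier L"
    unfolding L_eq by (rule birat.subgroup_generated_subset_carrier_subset[OF gens])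
  have Ts_V: "?Ts \<subseteq> carrier V"
    unfolding V_eq by (rule birat.subgroup_generated_subset_carrier_subset[OF Ts])
  have L_ops: "mult L = mult birat" "\<one>\<^bsub>L\<^esub> = \<one>\<^bsub>birat\<^esub>"
      "x \<in> carrier L \<Longrightarrow> inv\<^bsub>L\<^esub> x = inv\<^bsub>birat\<^esub> x" "x \<in> carrier L \<Longrightarrow> x [^]\<^bsub>L\<^esub> n = x [^]\<^bsub>birat\<^esub> n" for x and n :: int
    by (simp_all add: L_eq birat.int_pow_subgroup_generated)
  have V_ops: "mult V = mult birat" "\<one>\<^bsub>V\<^esub> = \<one>\<^bsub>birat\<^esub>"
      "x \<in> carrier V \<Longrightarrow> x [^]\<^bsub>V\<^esub> n = x [^]\<^bsub>birat\<^esub> n" for x and n :: int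
    by (simp_all add: V_eq birat.int_pow_subgroup_generated)
  have five: "five_elements L ?E ?a1 ?a2 ?k ?D"
    using gens_L by unfold_locales (simp_all add: gens_def)
  interpret F: five_elements L ?E ?a1 ?a2 ?k ?D by (rule five)
  have monomial: "F.monomial = (\<lambda>n. ?E [^]\<^bsub>birat\<^esub> n 0 \<otimes>\<^bsub>birat\<^esub> ?a1 [^]\<^bsub>birat\<^esub> n 1 \<otimes>\<^bsub>birat\<^esub> ?a2 [^]\<^bsub>birat\<^esub> n 2
      \<otimes>\<^bsub>birat\<^esub> ?k [^]\<^bsub>birat\<^esub> n 3 \<otimes>\<^bsub>birat\<^esub> ?D [^]\<^bsub>birat\<^esub> n 4)"
    using F.closed by (simp add: fun_eq_iff F.monomial_def L_ops)
  have iso: "F.monomial \<in> iso int_vectors L"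
  proof (rule F.monomial_iso)
    show "generate L {?E, ?a1, ?a2, ?k, ?D} = carrier L"
      using birat.generate_subgroup_generated[OF gens] by (simp add: L_eq gens_def)
    fix n :: "nat \<Rightarrow> int"
    assume 1: "F.monomial n = \<one>\<^bsub>L\<^esub>"
    \<comment> \<open>For a common eigenvector \<open>x\<close>, the product of powers of the
      eigenvalues is the eigenvalue of the identity.\<close>
    have scale: "c0 powi n 0 * c1 powi n 1 * c2 powi n 2 * c3 powi n 3 * c4 powi n 4 = 1"
      if "scales ?E x c0" "scales ?a1 x c1" "scales ?a2 x c2" "scales ?k x c3" "scales ?D x c4" "x \<noteq> 0"
        "c0 \<noteq> 0" "c1 \<noteq> 0" "c2 \<noteq> 0" "c3 \<noteq> 0" "c4 \<noteq> 0" for x c0 c1 c2 c3 c4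
    proof (rule scales_one)
      show "scales \<one>\<^bsub>birat\<^esub> x (c0 powi n 0 * c1 powi n 1 * c2 powi n 2 * c3 powi n 3 * c4 powi n 4)"
        unfolding L_ops(2)[symmetric] 1[symmetric] monomial
        by (intro scales_mult scales_int_pow that)
    qed (fact that)
    note scale_simps = scales_def gens_in_birat assms(2) params_scale[OF assms(2)]
    \<comment> \<open>\<open>ka2\<close>, \<open>aa1\<close>, \<open>aa2\<close> are each moved by
      one generator only, which determines \<open>n 0\<close>, \<open>n 1\<close>,
      \<open>n 2\<close>; then \<open>la1\<close> determines \<open>n 3\<close> and
      \<open>ka1\<close> determines \<open>n 4\<close>.\<close>
    have "q powi n 0 = 1"
      using scale[of ka2 q 1 1 1 1] by (simp add: scale_simps)
    moreover have "q powi n 1 = 1"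
      using scale[of aa1 1 q 1 1 1] by (simp add: scale_simps)
    moreover have "q powi n 2 = 1"
      using scale[of aa2 1 1 q 1 1] by (simp add: scale_simps)
    moreover have "q powi n 0 * q powi n 1 * q powi n 2 * q powi n 3 = 1"
      using scale[of la1 q q q q 1] by (simp add: scale_simps)
    moreover have "q powi n 0 * q powi n 3 * q powi n 4 = 1"
      using scale[of ka1 q 1 1 q q] by (simp add: scale_simps)
    ultimately show "n 0 = 0 \<and> n 1 = 0 \<and> n 2 = 0 \<and> n 3 = 0 \<and> n 4 = 0"
      using power_int_eq_1_imp[OF assms(1,2)] by simp
  qed
  have indep: "a = b \<and> b = c \<and> d = 0"
    if "T_0 r [^]\<^bsub>V\<^esub> a \<otimes>\<^bsub>V\<^esub> T_1 r [^]\<^bsub>V\<^esub> b \<otimes>\<^bsub>V\<^esub> T_2 r [^]\<^bsub>V\<^esub> c \<otimes>\<^bsub>V\<^esub> T_3 r [^]\<^bsub>V\<^esub> d = \<one>\<^bsub>V\<^esub>"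
    for a b c d :: int
  proof -
    have 1: "T_0 r [^]\<^bsub>birat\<^esub> a \<otimes>\<^bsub>birat\<^esub> T_1 r [^]\<^bsub>birat\<^esub> b \<otimes>\<^bsub>birat\<^esub> T_2 r [^]\<^bsub>birat\<^esub> c \<otimes>\<^bsub>birat\<^esub> T_3 r [^]\<^bsub>birat\<^esub> d = \<one>\<^bsub>birat\<^esub>"
      using that Ts_V by (simp add: V_ops)
    have scale: "c0 powi a * c1 powi b * c2 powi c * c3 powi d = 1"
      if "scales (T_0 r) x c0" "scales (T_1 r) x c1" "scales (T_2 r) x c2" "scales (T_3 r) x c3" "x \<noteq> 0"
        "c0 \<noteq> 0" "c1 \<noteq> 0" "c2 \<noteq> 0" "c3 \<noteq> 0" for x c0 c1 c2 c3
    proof (rule scales_one)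
      show "scales \<one>\<^bsub>birat\<^esub> x (c0 powi a * c1 powi b * c2 powi c * c3 powi d)"
        unfolding 1[symmetric] by (intro scales_mult scales_int_pow that)
    qed (fact that)
    note scale_simps = scales_def T_0_in_birat T_1_in_birat T_2_in_birat T_3_in_birat translations_scale[OF r] r
    \<comment> \<open>\<open>bb0\<close> detects \<open>b - a\<close>, \<open>bb1\<close> detects
      \<open>a - c\<close>, and the product of the \<open>f_i\<close> detects
      \<open>d\<close>.\<close>
    have "inverse r powi a * r powi b * 1 powi c * 1 powi d = 1"
      by (rule scale[of bb0]) (simp_all add: scale_simps)
    then have "r powi (b - a) = 1"
      using r by (simp add: power_int_diff field_simps)
    then have ab: "b - a = 0"
      by (rule power_int_eq_1_imp[OF norm_r r])
    have "r powi a * 1 powi b * inverse r powi c * 1 powi d = 1"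
      by (rule scale[of bb1]) (simp_all add: scale_simps)
    then have "r powi (a - c) = 1"
      using r by (simp add: power_int_diff field_simps)
    then have ac: "a - c = 0"
      by (rule power_int_eq_1_imp[OF norm_r r])
    have "1 powi a * 1 powi b * 1 powi c * r\<^sup>2 powi d = 1"
      by (rule scale[of qc2]) (simp_all add: scale_simps)
    then have "q powi d = 1"
      using assms(3) by simp
    then have "d = 0"
      by (rule power_int_eq_1_imp[OF assms(1,2)])
    with ab ac show ?thesis
      by simp
  qed
  have Sc: "T_scaling q = inv\<^bsub>L\<^esub> ?a1 \<otimes>\<^bsub>L\<^esub> ?k \<otimes>\<^bsub>L\<^esub> inv\<^bsub>L\<^esub> ?a2"
    using F.closed by (simp add: T_scaling_def L_ops)
  have N_eq: "N = generate L {?E, inv\<^bsub>L\<^esub> ?a1 \<otimes>\<^bsub>L\<^esub> ?k \<otimes>\<^bsub>L\<^esub> inv\<^bsub>L\<^esub> ?a2}"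
    by (simp only: N_def Sc L_def)
  have Sc_L: "T_scaling q \<in> carrier L" and Sc_N: "T_scaling q \<in> N"
    using F.closed by (auto simp: Sc N_eq intro: generate.incl)
  have sub_N: "subgroup N L"
    unfolding N_eq by (rule L.generate_is_subgroup) (use F.closed in auto)
  then have normal_N: "N \<lhd> L"
    by (rule L.subgroup_imp_normal)
  have Sc_rcos: "N #>\<^bsub>L\<^esub> T_scaling q = N"
    by (rule subgroup.rcos_const[OF sub_N L.group_axioms Sc_N])
  have gen_V: "generate V ?Ts = carrier V"
    unfolding V_eq by (rule birat.generate_subgroup_generated[OF Ts])
  have T012: "T_0 r \<otimes>\<^bsub>V\<^esub> T_1 r \<otimes>\<^bsub>V\<^esub> T_2 r = \<one>\<^bsub>V\<^esub>"
    by (simp add: V_ops T_0_T_1_T_2[OF r])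
  \<comment> \<open>The target triple stays fixed and the translations are permuted cyclically, so
    one application of \<open>quotient_iso\<close> serves all correspondences.\<close>
  have matching: "\<exists>h \<in> iso V (L Mod N). h y1 = N #>\<^bsub>L\<^esub> inv\<^bsub>L\<^esub> ?a1 \<and> h y2 = N #>\<^bsub>L\<^esub> ?k \<and>
      h y3 = N #>\<^bsub>L\<^esub> inv\<^bsub>L\<^esub> ?a2 \<and> h (T_3 r) = N #>\<^bsub>L\<^esub> u \<and> h \<one>\<^bsub>V\<^esub> = N #>\<^bsub>L\<^esub> T_scaling q"
    if y: "(y1, y2, y3) \<in> {(T_0 r, T_1 r, T_2 r), (T_2 r, T_0 r, T_1 r), (T_1 r, T_2 r, T_0 r)}"
      and u: "u \<in> {?D, inv\<^bsub>L\<^esub> ?D}" for y1 y2 y3 u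
  proof -
    \<comment> \<open>Matching \<open>T_3\<close> with the inverse of \<open>?D\<close> amounts to
      matching its inverse with \<open>?D\<close>.\<close>
    define y4 where "y4 = (if u = ?D then T_3 r else inv\<^bsub>V\<^esub> T_3 r)"
    have y4: "y4 = T_3 r \<and> u = ?D \<or> y4 = inv\<^bsub>V\<^esub> T_3 r \<and> u = inv\<^bsub>L\<^esub> ?D"
      using u by (auto simp: y4_def)
    have cl: "y1 \<in> carrier V" "y2 \<in> carrier V" "y3 \<in> carrier V" "y4 \<in> carrier V"
      using y Ts_V by (auto simp: y4_def)
    have "T_3 r \<in> generate V {y1, y2, y3, y4}"
      using y4 Ts_V generate.incl[of y4 "{y1, y2, y3, y4}" V] generate.inv[of y4 "{y1, y2, y3, y4}" V] by auto
    then have "?Ts \<subseteq> generate V {y1, y2, y3, y4}"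
      using y generate.incl[of _ "{y1, y2, y3, y4}" V] by auto
    then have "carrier V \<subseteq> generate V {y1, y2, y3, y4}"
      unfolding gen_V[symmetric]
      by (rule V.generate_subgroup_incl) (use cl in \<open>simp add: V.generate_is_subgroup\<close>)
    then have gen: "generate V {y1, y2, y3, y4} = carrier V"
      using V.generate_incl[of "{y1, y2, y3, y4}"] cl by auto
    have rel: "y1 \<otimes>\<^bsub>V\<^esub> y2 \<otimes>\<^bsub>V\<^esub> y3 = \<one>\<^bsub>V\<^esub>"
      using y T012 Ts_V by (auto simp: V.m_ac)
    have ind: "a = b \<and> b = c \<and> d = 0"
      if "y1 [^]\<^bsub>V\<^esub> a \<otimes>\<^bsub>V\<^esub> y2 [^]\<^bsub>V\<^esub> b \<otimes>\<^bsub>V\<^esub> y3 [^]\<^bsub>V\<^esub> c \<otimes>\<^bsub>V\<^esub> y4 [^]\<^bsub>V\<^esub> d = \<one>\<^bsub>V\<^esub>" for a b c d :: int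
    proof -
      have d: "y4 [^]\<^bsub>V\<^esub> d = T_3 r [^]\<^bsub>V\<^esub> (if y4 = T_3 r then d else - d)"
        using y4 Ts_V by (auto simp: V.int_pow_inv V.int_pow_neg)
      \<comment> \<open>A cyclic permutation of the translations permutes the first three exponents,
        and their equality does not depend on the order; inverting \<open>T_3\<close> changes the
        sign of \<open>d\<close>.\<close>
      show ?thesis
        using y that[unfolded d] indep[of a b c "if y4 = T_3 r then d else - d"]
          indep[of b c a "if y4 = T_3 r then d else - d"] indep[of c a b "if y4 = T_3 r then d else - d"] Ts_V
        by (auto simp: V.m_ac split: if_splits)
    qed
    obtain h where h: "h \<in> iso V (L Mod N)" "h y1 = N #>\<^bsub>L\<^esub> inv\<^bsub>L\<^esub> ?a1" "h y2 = N #>\<^bsub>L\<^esub> ?k"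
        "h y3 = N #>\<^bsub>L\<^esub> inv\<^bsub>L\<^esub> ?a2" "h y4 = N #>\<^bsub>L\<^esub> ?D" "h (inv\<^bsub>V\<^esub> y4) = N #>\<^bsub>L\<^esub> inv\<^bsub>L\<^esub> ?D"
      using quotient_iso[OF five iso V.comm_group_axioms cl gen rel ind N_eq] by blast
    have "h (T_3 r) = N #>\<^bsub>L\<^esub> u"
      using y4 h(5,6) Ts_V by auto
    moreover have "h \<one>\<^bsub>V\<^esub> = N #>\<^bsub>L\<^esub> T_scaling q"
      using hom_one[OF _ V.group_axioms normal.factorgroup_is_group[OF normal_N], of h] h(1)
      by (simp add: iso_def Sc_rcos)
    ultimately show ?thesis
      using h by blast
  qed
  have correspondences: "u0 \<otimes>\<^bsub>birat\<^esub> u1 \<otimes>\<^bsub>birat\<^esub> u2 = T_scaling q \<and>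
      (\<exists>h \<in> iso V (L Mod N).
         h (T_0 r) = N #>\<^bsub>L\<^esub> u0 \<and> h (T_1 r) = N #>\<^bsub>L\<^esub> u1 \<and>
         h (T_2 r) = N #>\<^bsub>L\<^esub> u2 \<and> h (T_3 r) = N #>\<^bsub>L\<^esub> u3 \<and>
         h \<one>\<^bsub>V\<^esub> = N #>\<^bsub>L\<^esub> T_scaling q)"
    if corr: "((u0, u1, u2), u3) \<in> correspondences q" for u0 u1 u2 u3
  proof -
    have u3: "u3 \<in> {?D, inv\<^bsub>L\<^esub> ?D}"
      using corr F.closed by (auto simp: correspondences_def L_ops)
    consider (1) "u0 = inv\<^bsub>L\<^esub> ?a1" "u1 = ?k" "u2 = inv\<^bsub>L\<^esub> ?a2"
      | (2) "u0 = ?k" "u1 = inv\<^bsub>L\<^esub> ?a2" "u2 = inv\<^bsub>L\<^esub> ?a1"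
      | (3) "u0 = inv\<^bsub>L\<^esub> ?a2" "u1 = inv\<^bsub>L\<^esub> ?a1" "u2 = ?k"
      using corr F.closed by (auto simp: correspondences_def L_ops)
    then show ?thesis
    proof cases
      case 1
      then show ?thesis
        using matching[of "T_0 r" "T_1 r" "T_2 r", OF _ u3] Sc by (auto simp: L_ops(1))
    next
      case 2
      have "u0 \<otimes>\<^bsub>L\<^esub> u1 \<otimes>\<^bsub>L\<^esub> u2 = T_scaling q"
        unfolding 2 Sc using F.closed by (simp add: L.m_ac)
      then show ?thesis
        using matching[of "T_2 r" "T_0 r" "T_1 r", OF _ u3] 2 by (auto simp: L_ops(1))
    next
      case 3
      have "u0 \<otimes>\<^bsub>L\<^esub> u1 \<otimes>\<^bsub>L\<^esub> u2 = T_scaling q"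
        unfolding 3 Sc using F.closed by (simp add: L.m_ac)
      then show ?thesis
        using matching[of "T_1 r" "T_2 r" "T_0 r", OF _ u3] 3 by (auto simp: L_ops(1))
    qed
  qed
  have iso_V: "V \<cong> L Mod N"
    using matching[of "T_0 r" "T_1 r" "T_2 r" ?D] unfolding is_iso_def by blast
  have scaling_var: "T_scaling q ka1 = cst q * ka1" "T_scaling q ka2 = ka2"
     "T_scaling q aa1 = aa1 / cst q" "T_scaling q aa2 = aa2 / cst q"
     "T_scaling q la1 = la1 / cst q" "T_scaling q la2 = la2"
     "T_scaling q ww = ka2 * ww / ka1" "T_scaling q yy = yy / cst q" "T_scaling q zz = zz"
    using assms(2) by (simp_all add: T_scaling_eq deformation_var birat_hom[OF scaling_in_birat])
  have all_correspondences: "\<forall>((u\<^sub>0, u\<^sub>1, u\<^sub>2), u\<^sub>3) \<in> correspondences q.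
        u\<^sub>0 \<otimes>\<^bsub>birat\<^esub> u\<^sub>1 \<otimes>\<^bsub>birat\<^esub> u\<^sub>2 = T_scaling q \<and>
        (\<exists>h \<in> iso V (L Mod N).
           h (T_0 r) = N #>\<^bsub>L\<^esub> u\<^sub>0 \<and> h (T_1 r) = N #>\<^bsub>L\<^esub> u\<^sub>1 \<and>
           h (T_2 r) = N #>\<^bsub>L\<^esub> u\<^sub>2 \<and> h (T_3 r) = N #>\<^bsub>L\<^esub> u\<^sub>3 \<and>
           h \<one>\<^bsub>V\<^esub> = N #>\<^bsub>L\<^esub> T_scaling q)"
    by (rule ballI, simp only: split_paired_all prod.case, rule correspondences)
  have all_comm: "\<forall>S\<in>gens. \<forall>T\<in>gens. S \<otimes>\<^bsub>birat\<^esub> T = T \<otimes>\<^bsub>birat\<^esub> S"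
    by (intro ballI comm)
  show ?thesis
    by (intro conjI gens Ts all_comm iso[unfolded monomial] scaling_var T_0_T_1_T_2[OF r] normal_N
        all_correspondences iso_V)
qed

end
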